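(* Let $H$ be a prehilbert space and $\{A_1,\dots,A_r\}\subset(\mathrm{End}\,H)[[z,z^{-1}]]$ a system of generators, with associated operators $D,T\in\mathrm{End}(H)$, vector $\Omega\in H$, generated space of fields $\mathcal S$ and state-field correspondence $V:H\to\mathcal S$. Suppose that it generates a Virasoro operator $L\in\mathcal S$, $L(z)=\sum_{n\in\mathbb Z}L_nz^{-n-2}$, with $D=L_0$ and $T=L_{-1}$. Then the system generates a vertex operator superalgebra: with $\omega=R(L)$, $(H,V,\Omega,\omega)$ is a vertex operator superalgebra.
   Context: Fields and locality. $H$ is a prehilbert space. A field is $A(z)=\sum_{n\in\mathbb Z}A(n)z^{-n-1}\in(\mathrm{End}\,H)[[z,z^{-1}]]$; $A'(z)=\frac d{dz}A(z)$. Two fields $A,B$ are local with sign $\varepsilon\in\mathbb Z_2$ if there is $N\in\mathbb N$ such that for all $c,d\in H$ there is $X\in(z-w)^{-N}\mathbb C[z^{\pm1},w^{\pm1}]$ with $X(z,w)=(A(z)B(w)c,d)$ for $|z|>|w|$ and $X(z,w)=(-1)^\varepsilon(B(w)A(z)c,d)$ for $|w|>|z|$. With $[X,Y]_\varepsilon=XY-(-1)^\varepsilon YX$, one defines $A_nB(w)=\sum_m(A_nB)(m)w^{-m-1}$ by $(A_nB)(m)=\sum_{p=0}^n(-1)^p\binom np[A(n-p),B(m+p)]_\varepsilon$ if $n\ge0$ and $(A_nB)(m)=\sum_{p\ge0}\binom{p-n-1}p\big(A(n-p)B(m+p)-(-1)^{\varepsilon+n}B(m+n-p)A(p)\big)$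 if $n<0$. System of generators. $\{A_1,\dots,A_r\}$ is a system of generators if there are $D,T\in\mathrm{End}(H)$, $\Omega\in H$ such that: (a) for all $i,j$, $A_i$ and $A_j$ are local with some $N=N_{ij}$ and sign $\varepsilon_{ij}=\varepsilon_{ii}\varepsilon_{jj}$; (b) $[T,A_i]=A_i'$; (c) $H=\bigoplus_{n\in\frac12\mathbb N}H_n$ with $D=n$ on $H_n$, $\dim H_n<\infty$, $H_n\perp H_m$ for $n\neq m$, and each $A_i$ is graded: $[D,A_i(z)]=zA_i'(z)+\alpha_iA_i(z)$ with $\alpha_i\in\mathbb N+\frac{\varepsilon_{ii}}2$; (d) $\Omega\in H_0$, $\|\Omega\|=1$, $A_i(m)\Omega=D\Omega=T\Omega=0$ for all $i$ and $m\in\mathbb N$; (e) $\{A_i(m)\}_{i,\,m\in\mathbb Z}$ acts irreducibly on $H$, so that $H$ is the minimal space containing $\Omega$ and stable under these operators. Generated fields. $S$ is the smallest set of fields containing $\mathrm{Id},A_1,\dots,A_r$ and stable under $(A,B)\mapsto A_nB$ ($n\in\mathbb Z$) and $A\mapsto A'$; $S_\varepsilon$ is the set of those $A\in S$ local with themselves with sign $\varepsilon$; $\mathcal S_\varepsilon=\mathrm{span}\,S_\varepsilon$, $\mathcal S=\mathcal S_{\bar0}\oplus\mathcal S_{\bar1}$. The map $R:\mathcal S\to H$, $R(A)=A(z)\Omega|_{z=0}=A(-1)\Omega$, is a linear bijection, and the state-field correspondence $V:H\to\mathcal S$ is its inverse; $V(a)(z)$ is written $V(a,z)$. $H_\varepsilon=\bigoplus_{n\in\mathbb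 N+\varepsilon/2}H_n$. Virasoro operator. $L\in\mathcal S$ is a Virasoro operator if, writing $L(z)=\sum_nL_nz^{-n-2}$ and $\omega=R(L)=L_{-2}\Omega$, one has $[L_m,L_n]=(m-n)L_{m+n}+\frac c{12}m(m^2-1)\delta_{m+n,0}$ with $c=2\|\omega\|^2$. A vertex operator superalgebra is $(H,V,\Omega,\omega)$ with $H=H_{\bar0}\oplus H_{\bar1}$ a prehilbert superspace, $V:H\to(\mathrm{End}\,H)[[z,z^{-1}]]$ linear, $\Omega,\omega\in H$, such that, with $\mathcal S_\varepsilon=V(H_\varepsilon)$, $\mathcal S=\mathcal S_{\bar0}\oplus\mathcal S_{\bar1}$: (1) for all $A\in\mathcal S$, $n\in\mathbb N$: $A(n)\Omega=0$; $V(a,z)\Omega|_{z=0}=a$; $V(\Omega,z)=\mathrm{Id}$. (2) $\{A(n):A\in\mathcal S,n\in\mathbb Z\}$ acts irreducibly on $H$. (3) for $A\in\mathcal S_{\varepsilon_1}$, $B\in\mathcal S_{\varepsilon_2}$: $A,B$ are local with sign $\varepsilon_1\varepsilon_2$, and $A_nB\in\mathcal S_{\varepsilon_1+\varepsilon_2}$. (4) $V(\omega,z)=\sum_nL_nz^{-n-2}$ with $L_0\Omega=L_{-1}\Omega=0$, $\omega=L_{-2}\Omega$, and $[L_m,L_n]=(m-n)L_{m+n}+\frac c{12}m(m^2-1)\delta_{m+n,0}$, $c=2\|\omega\|^2$. (5) $L_0$ decomposes $H$ into $\bigoplus_{n\in\frac12\mathbb N}H_n$, $\dim H_n<\infty$,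 $H_n\perp H_m$ for $n\ne m$, $H_\varepsilon=\bigoplus_{n\in\mathbb N+\varepsilon/2}H_n$, $\Omega\in H_0$, $\omega\in H_2$, and $[L_0,V(a,z)]=zV'(a,z)+\alpha V(a,z)$ for $a\in H_\alpha$. (6) $[L_{-1},V(a,z)]=V'(a,z)=V(L_{-1}a,z)\in\mathcal S$. *)

theory Defs
  imports
    "HOL-Analysis.Analysis"
    "HOL-Library.Function_Algebras"
    "HOL-Library.Groups_Big_Fun"
    "HOL-Library.Z2"
begin

section \<open>Complex vector spaces and prehilbert spaces\<close>

class complex_vector = ab_group_add +
  fixes scaleC :: "complex \<Rightarrow> 'a \<Rightarrow> 'a" (infixr "*\<^sub>C" 75)
  assumes scaleC_add_right: "c *\<^sub>C (x + y) = c *\<^sub>C x + c *\<^sub>C y"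
    and scaleC_add_left: "(c + d) *\<^sub>C x = c *\<^sub>C x + d *\<^sub>C x"
    and scaleC_scaleC: "c *\<^sub>C d *\<^sub>C x = (c * d) *\<^sub>C x"
    and scaleC_one: "1 *\<^sub>C x = x"

global_interpretation complex_vector:
  vector_space "scaleC :: complex \<Rightarrow> 'a \<Rightarrow> 'a::complex_vector"
  by standard (simp_all add: scaleC_add_right scaleC_add_left scaleC_scaleC scaleC_one)

abbreviation csubspace :: "'a::complex_vector set \<Rightarrow> bool"
  where "csubspace \<equiv> module.subspace scaleC"

abbreviation cspan :: "'a::complex_vector set \<Rightarrow> 'a set"
  where "cspan \<equiv> module.span scaleC"

abbreviation clinear :: "('a::complex_vector \<Rightarrow> 'b::complex_vector) \<Rightarrow> bool"
  where "clinear \<equiv> Vector_Spaces.linear scaleC scaleC"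

instantiation "fun" :: (type, complex_vector) complex_vector
begin

definition scaleC_fun :: "complex \<Rightarrow> ('a \<Rightarrow> 'b) \<Rightarrow> 'a \<Rightarrow> 'b"
  where "scaleC_fun c f = (\<lambda>x. c *\<^sub>C f x)"

instance
  by standard
    (simp_all add: scaleC_fun_def fun_eq_iff scaleC_add_right scaleC_add_left scaleC_scaleC scaleC_one)

end

text \<open>The inner product is linear in the first variable and antilinear in the second.
  No completeness is assumed.\<close>

class prehilbert = complex_vector +
  fixes cinner :: "'a \<Rightarrow> 'a \<Rightarrow> complex"
  assumes cinner_add_left: "cinner (x + y) z = cinner x z + cinner y z"
    and cinner_scaleC_left: "cinner (c *\<^sub>C x) y = c * cinner x y"
    and cinner_commute: "cinner x y = cnj (cinner y x)"
    and cinner_pos: "x \<noteq> 0 \<Longrightarrow> 0 < Re (cinner x x)"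

definition hnorm :: "'h::prehilbert \<Rightarrow> real"
  where "hnorm x = sqrt (Re (cinner x x))"

definition fin_dim :: "'h::complex_vector set \<Rightarrow> bool"
  where "fin_dim W \<longleftrightarrow> (\<exists>B. finite B \<and> W = cspan B)"

text \<open>\<open>direct_sum U I W\<close>: the space \<open>U\<close> is the internal direct sum of the subspaces
  \<open>W i\<close>, \<open>i \<in> I\<close>.\<close>

definition direct_sum :: "'h::complex_vector set \<Rightarrow> 'i set \<Rightarrow> ('i \<Rightarrow> 'h set) \<Rightarrow> bool"
  where "direct_sum U I W \<longleftrightarrow>
    csubspace U \<and> (\<forall>i\<in>I. csubspace (W i) \<and> W i \<subseteq> U) \<and>
    (\<forall>u\<in>U. \<exists>!x. (\<forall>i\<in>I. x i \<in> W i) \<and> (\<forall>i. i \<notin> I \<longrightarrow> x i = 0) \<and>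
      finite {i. x i \<noteq> 0} \<and> u = Sum_any x)"

definition acts_irreducibly :: "('h \<Rightarrow> 'h::complex_vector) set \<Rightarrow> bool"
  where "acts_irreducibly M \<longleftrightarrow>
    (\<exists>v::'h. v \<noteq> 0) \<and>
    (\<forall>W. csubspace W \<and> (\<forall>f\<in>M. f ` W \<subseteq> W) \<longrightarrow> W = {0} \<or> W = UNIV)"

definition half_nats :: "real set"
  where "half_nats = {real k / 2 | k :: nat. True}"

text \<open>The index set \<open>\<nat> + \<epsilon>/2\<close>; signs and parities are elements of the
  two-element field \<^typ>\<open>bit\<close>.\<close>

definition shifted_nats :: "bit \<Rightarrow> real set"
  where "shifted_nats \<epsilon> = {real k + of_bool (\<epsilon> = 1) / 2 | k :: nat. True}"

definition parity_sign :: "bit \<Rightarrow> complex"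
  where "parity_sign \<epsilon> = (if \<epsilon> = 1 then - 1 else 1)"

text \<open>\<open>D\<close> decomposes \<open>H\<close> into the graded pieces \<open>G n\<close>, \<open>n \<in> \<nat>/2\<close>; the values of \<open>G\<close>
  at other reals are irrelevant.\<close>

definition grading_of :: "('h \<Rightarrow> 'h::prehilbert) \<Rightarrow> (real \<Rightarrow> 'h set) \<Rightarrow> bool"
  where "grading_of D G \<longleftrightarrow>
    direct_sum UNIV half_nats G \<and>
    (\<forall>n\<in>half_nats. \<forall>v\<in>G n. D v = complex_of_real n *\<^sub>C v) \<and>
    (\<forall>n\<in>half_nats. fin_dim (G n)) \<and>
    (\<forall>n\<in>half_nats. \<forall>m\<in>half_nats. n \<noteq> m \<longrightarrow> (\<forall>v\<in>G n. \<forall>w\<in>G m. cinner v w = 0))"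

definition parity_part :: "(real \<Rightarrow> 'h::complex_vector set) \<Rightarrow> bit \<Rightarrow> 'h set"
  where "parity_part G \<epsilon> = cspan (\<Union>n\<in>shifted_nats \<epsilon>. G n)"

section \<open>Fields and locality\<close>

text \<open>\<open>A n\<close> is the coefficient of \<open>z\<^sup>-\<^sup>n\<^sup>-\<^sup>1\<close> in the formal series \<open>A(z)\<close>.\<close>

type_synonym 'h modes = "int \<Rightarrow> 'h \<Rightarrow> 'h"

definition is_field :: "'h::complex_vector modes \<Rightarrow> bool"
  where "is_field A \<longleftrightarrow> (\<forall>n. clinear (A n))"

definition id_field :: "'h::complex_vector modes"
  where "id_field n = (if n = - 1 then id else (\<lambda>v. 0))"

text \<open>The coefficient of \<open>z\<^sup>-\<^sup>m\<^sup>-\<^sup>1\<close> in \<open>d/dz A(z) = (\<Sum>n. (- n - 1) A(n) z\<^sup>-\<^sup>n\<^sup>-\<^sup>2)\<close>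
  is the one with \<open>n = m - 1\<close>.\<close>

definition deriv_field :: "'h::complex_vector modes \<Rightarrow> 'h modes"
  where "deriv_field A m = (\<lambda>v. of_int (- m) *\<^sub>C A (m - 1) v)"

text \<open>Multiplication of \<open>A(z)\<close> by \<open>z\<close>.\<close>

definition z_times :: "'h modes \<Rightarrow> 'h modes"
  where "z_times A m = A (m + 1)"

definition commutator_field :: "('h \<Rightarrow> 'h) \<Rightarrow> 'h modes \<Rightarrow> 'h::complex_vector modes"
  where "commutator_field D A m = (\<lambda>v. D (A m v) - A m (D v))"

definition laurent_poly2 :: "(complex \<Rightarrow> complex \<Rightarrow> complex) set"
  where "laurent_poly2 = {(\<lambda>z w. \<Sum>(i, j)\<in>F. a (i, j) * z powi i * w powi j)
    | (F :: (int \<times> int) set) (a :: int \<times> int \<Rightarrow> complex). finite F}"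

definition diag_pole_functions :: "nat \<Rightarrow> (complex \<Rightarrow> complex \<Rightarrow> complex) set"
  where "diag_pole_functions N = {(\<lambda>z w. P z w / (z - w) ^ N) | P. P \<in> laurent_poly2}"

text \<open>The matrix coefficients \<open>(A(z)B(w)c,d)\<close> and \<open>(B(w)A(z)c,d)\<close> are evaluated as
  unconditionally convergent double series on \<open>|z| > |w| > 0\<close> and \<open>|w| > |z| > 0\<close>
  (negative powers of both variables occur, whence \<open>z, w \<noteq> 0\<close>).\<close>

definition local_with_sign :: "bit \<Rightarrow> 'h::prehilbert modes \<Rightarrow> 'h modes \<Rightarrow> bool"
  where "local_with_sign \<epsilon> A B \<longleftrightarrow>
    (\<exists>N::nat. \<forall>c d. \<exists>X\<in>diag_pole_functions N.
      (\<forall>z w. w \<noteq> 0 \<and> norm w < norm z \<longrightarrow>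
        ((\<lambda>(m, n). cinner (A m (B n c)) d * z powi (- m - 1) * w powi (- n - 1))
          has_sum X z w) UNIV) \<and>
      (\<forall>z w. z \<noteq> 0 \<and> norm z < norm w \<longrightarrow>
        ((\<lambda>(m, n). parity_sign \<epsilon> *
            (cinner (B n (A m c)) d * z powi (- m - 1) * w powi (- n - 1)))
          has_sum X z w) UNIV))"

text \<open>The modes of \<open>A\<^sub>n B\<close>. For \<open>n < 0\<close> the operator series is evaluated vectorwise;
  \<open>Sum_any\<close> adds up a finitely supported family (and is \<open>0\<close> otherwise). In a system of
  generators the grading makes the family finitely supported on every vector.\<close>

definition nth_product :: "bit \<Rightarrow> 'h::complex_vector modes \<Rightarrow> int \<Rightarrow> 'h modes \<Rightarrow> 'h modes"
  where "nth_product \<epsilon> A n B m = (\<lambda>v.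
    if n \<ge> 0 then
      (\<Sum>p\<le>nat n. ((- 1) ^ p * of_nat (nat n choose p)) *\<^sub>C
        (A (n - int p) (B (m + int p) v) - parity_sign \<epsilon> *\<^sub>C B (m + int p) (A (n - int p) v)))
    else
      Sum_any (\<lambda>p::nat. of_nat (nat (int p - n - 1) choose p) *\<^sub>C
        (A (n - int p) (B (m + int p) v)
          - (parity_sign \<epsilon> * (- 1) powi n) *\<^sub>C B (m + n - int p) (A (int p) v))))"

section \<open>Systems of generators\<close>

text \<open>The system is \<open>A 1, \<dots>, A r\<close>, and \<open>G n\<close> is the graded piece \<open>H\<^sub>n\<close>.\<close>

definition system_of_generators ::
  "nat \<Rightarrow> (nat \<Rightarrow> 'h modes) \<Rightarrow> ('h \<Rightarrow> 'h) \<Rightarrow> ('h \<Rightarrow> 'h) \<Rightarrow> 'h \<Rightarrow> (real \<Rightarrow> 'h::prehilbert set) \<Rightarrow> bool"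
  where "system_of_generators r A D T \<Omega> G \<longleftrightarrow>
    (\<forall>i\<in>{1..r}. is_field (A i)) \<and> clinear D \<and> clinear T \<and>
    (\<exists>(\<epsilon> :: nat \<Rightarrow> nat \<Rightarrow> bit) (\<alpha> :: nat \<Rightarrow> real).
      (\<forall>i\<in>{1..r}. \<forall>j\<in>{1..r}.
        local_with_sign (\<epsilon> i j) (A i) (A j) \<and> \<epsilon> i j = \<epsilon> i i * \<epsilon> j j) \<and>
      (\<forall>i\<in>{1..r}. commutator_field T (A i) = deriv_field (A i)) \<and>
      grading_of D G \<and>
      (\<forall>i\<in>{1..r}. \<alpha> i \<in> shifted_nats (\<epsilon> i i) \<and>
        commutator_field D (A i)
          = z_times (deriv_field (A i)) + complex_of_real (\<alpha> i) *\<^sub>C A i)) \<and>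
    \<Omega> \<in> G 0 \<and> hnorm \<Omega> = 1 \<and>
    (\<forall>i\<in>{1..r}. \<forall>m\<ge>0. A i m \<Omega> = 0) \<and> D \<Omega> = 0 \<and> T \<Omega> = 0 \<and>
    acts_irreducibly {A i m | i m. i \<in> {1..r}}"

text \<open>The set \<open>S\<close> generated by a set \<open>\<A>\<close> of fields. The product \<open>A\<^sub>n B\<close> is a partial
  operation, taken with a sign with which \<open>A\<close> and \<open>B\<close> are local.\<close>

inductive_set generated_fields :: "'h::prehilbert modes set \<Rightarrow> 'h modes set"
  for \<A> :: "'h modes set" where
  gen_id: "id_field \<in> generated_fields \<A>"
| gen_base: "A \<in> \<A> \<Longrightarrow> A \<in> generated_fields \<A>"
| gen_product: "A \<in> generated_fields \<A> \<Longrightarrow> B \<in> generated_fields \<A> \<Longrightarrow>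
    local_with_sign \<epsilon> A B \<Longrightarrow> nth_product \<epsilon> A n B \<in> generated_fields \<A>"
| gen_deriv: "A \<in> generated_fields \<A> \<Longrightarrow> deriv_field A \<in> generated_fields \<A>"

definition field_space_parity :: "'h::prehilbert modes set \<Rightarrow> bit \<Rightarrow> 'h modes set"
  where "field_space_parity \<A> \<epsilon> = cspan {A \<in> generated_fields \<A>. local_with_sign \<epsilon> A A}"

definition field_space :: "'h::prehilbert modes set \<Rightarrow> 'h modes set"
  where "field_space \<A> =
    {A + B | A B. A \<in> field_space_parity \<A> 0 \<and> B \<in> field_space_parity \<A> 1}"

definition vacuum_value :: "'h \<Rightarrow> 'h modes \<Rightarrow> 'h"
  where "vacuum_value \<Omega> A = A (- 1) \<Omega>"

definition state_field :: "'h::prehilbert modes set \<Rightarrow> 'h \<Rightarrow> 'h \<Rightarrow> 'h modes"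
  where "state_field \<A> \<Omega> = inv_into (field_space \<A>) (vacuum_value \<Omega>)"

section \<open>Virasoro operators\<close>

text \<open>\<open>L\<^sub>n\<close> is the coefficient of \<open>z\<^sup>-\<^sup>n\<^sup>-\<^sup>2\<close> in \<open>L(z)\<close>.\<close>

definition vmode :: "'h modes \<Rightarrow> int \<Rightarrow> 'h \<Rightarrow> 'h"
  where "vmode L n = L (n + 1)"

definition virasoro_relations :: "'h::complex_vector modes \<Rightarrow> real \<Rightarrow> bool"
  where "virasoro_relations L c \<longleftrightarrow>
    (\<forall>m n v. vmode L m (vmode L n v) - vmode L n (vmode L m v)
      = of_int (m - n) *\<^sub>C vmode L (m + n) v
        + (if m + n = 0 then complex_of_real (c / 12 * of_int (m * (m\<^sup>2 - 1))) *\<^sub>C v else 0))"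

definition virasoro_operator :: "'h::prehilbert modes set \<Rightarrow> 'h \<Rightarrow> 'h modes \<Rightarrow> bool"
  where "virasoro_operator \<A> \<Omega> L \<longleftrightarrow>
    L \<in> field_space \<A> \<and> virasoro_relations L (2 * (hnorm (vacuum_value \<Omega> L))\<^sup>2)"

section \<open>Vertex operator superalgebras\<close>

text \<open>The superspace structure \<open>H = H\<^sub>0 \<oplus> H\<^sub>1\<close> is the family \<open>Hs\<close>.\<close>

definition vertex_operator_superalgebra ::
  "(bit \<Rightarrow> 'h::prehilbert set) \<Rightarrow> ('h \<Rightarrow> 'h modes) \<Rightarrow> 'h \<Rightarrow> 'h \<Rightarrow> bool"
  where "vertex_operator_superalgebra Hs V \<Omega> \<omega> \<longleftrightarrow>
    direct_sum UNIV UNIV Hs \<and> (\<forall>a. is_field (V a)) \<and> clinear V \<and>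
    (let S = (\<lambda>\<epsilon>. V ` Hs \<epsilon>); SS = range V; L = vmode (V \<omega>) in
      direct_sum SS UNIV S \<and>
      (\<forall>A\<in>SS. \<forall>n\<ge>0. A n \<Omega> = 0) \<and> (\<forall>a. V a (- 1) \<Omega> = a) \<and> V \<Omega> = id_field \<and>
      acts_irreducibly {A n | A n. A \<in> SS} \<and>
      (\<forall>\<epsilon>\<^sub>1 \<epsilon>\<^sub>2. \<forall>A\<in>S \<epsilon>\<^sub>1. \<forall>B\<in>S \<epsilon>\<^sub>2. local_with_sign (\<epsilon>\<^sub>1 * \<epsilon>\<^sub>2) A B \<and>
        (\<forall>n. nth_product (\<epsilon>\<^sub>1 * \<epsilon>\<^sub>2) A n B \<in> S (\<epsilon>\<^sub>1 + \<epsilon>\<^sub>2))) \<and>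
      L 0 \<Omega> = 0 \<and> L (- 1) \<Omega> = 0 \<and> \<omega> = L (- 2) \<Omega> \<and>
      virasoro_relations (V \<omega>) (2 * (hnorm \<omega>)\<^sup>2) \<and>
      (\<exists>G. grading_of (L 0) G \<and>
        (\<forall>\<epsilon>. direct_sum (Hs \<epsilon>) (shifted_nats \<epsilon>) G) \<and> \<Omega> \<in> G 0 \<and> \<omega> \<in> G 2 \<and>
        (\<forall>\<alpha>\<in>half_nats. \<forall>a\<in>G \<alpha>. commutator_field (L 0) (V a)
          = z_times (deriv_field (V a)) + complex_of_real \<alpha> *\<^sub>C V a)) \<and>
      (\<forall>a. commutator_field (L (- 1)) (V a) = deriv_field (V a) \<and>
        deriv_field (V a) = V (L (- 1) a) \<and> deriv_field (V a) \<in> SS))"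

end

theory Submission
  imports Defs
begin

text \<open>Matrix coefficients of a graded pair of fields are supported on finitely many lines
  \<open>m + n = const\<close> and are bounded above in the second index, so analytic locality is equivalent to
  the formal identity \<open>(z - w)\<^sup>N [A(z), B(w)]\<^sub>\<epsilon> = 0\<close>. In this form locality passes to
  products (Dong's lemma), and every generated field \<open>B\<close> is graded, translation covariant,
  satisfies \<open>B(m) \<Omega> = 0\<close> for \<open>m \<ge> 0\<close>, and is local with all fields having these properties.
  If \<open>B(-1) \<Omega> = 0\<close>, then \<open>B(z) \<Omega> = 0\<close> by translation covariance; by locality the common kernel of
  the modes of \<open>B\<close> is stable under the generators, so \<open>B = 0\<close> by irreducibility. Since
  \<open>A(n) B(-1) \<Omega> = (A\<^sub>n B)(-1) \<Omega>\<close>, irreducibility also makes \<open>B \<mapsto> B(-1) \<Omega>\<close> surjective, and all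
  axioms can be transported through this bijection.\<close>

text \<open>Three notions of sign have to be matched: the self-locality sign that defines the parity
  of a generated field, the sign governing its locality with other fields, and the parity of states
  read off half-integral degrees. The link is twice the degree modulo 2. It is \<open>e i\<close>
  for the generator \<open>A i\<close>, adds up under products and is unchanged by derivatives,
  whatever sign was chosen when a product was formed. It sends vacuum values of fields of parity
  \<epsilon> into the span of the pieces of degree in \<nat> + \<epsilon>/2. H carries no topology,
  so only matrix coefficients can converge. A product A_n B with n < 0 is an infinite sum, finite on
  each vector. It is treated as the residue in z of (z - w)^n times the two ordered products, with
  (z - w)^n expanded in the domain belonging to each order. This makes both signs of n uniform and
  reduces Dong's lemma to y - z = (x - z) - (x - y). The inner product does the work of projections
  onto degrees: a vector is located in its degree by pairing it with all homogeneous
  vectors.\<close>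

lemma clinear_simps:
  assumes "clinear f"
  shows "f (x + y) = f x + f y" "f (c *\<^sub>C x) = c *\<^sub>C f x" "f 0 = 0" "f (x - y) = f x - f y" "f (- x) = - f x"
proof -
  interpret module_hom scaleC scaleC f
    using assms by (simp add: linear_iff_module_hom)
  show "f (x + y) = f x + f y" "f (c *\<^sub>C x) = c *\<^sub>C f x" "f 0 = 0" "f (x - y) = f x - f y" "f (- x) = - f x"
    by (fact add scale zero diff neg)+
qed

lemma clinear_sum: "clinear f \<Longrightarrow> f (sum g S) = (\<Sum>a\<in>S. f (g a))"
  by (simp add: linear_iff_module_hom module_hom.sum)

lemma clinearI:
  assumes "\<And>x y. f (x + y) = f x + f y" "\<And>c x. f (c *\<^sub>C x) = c *\<^sub>C f x"
  shows "clinear f"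
  using assms by unfold_locales

lemma is_fieldD: "is_field A \<Longrightarrow> clinear (A n)"
  by (simp add: is_field_def)

section \<open>Multiplication of formal distributions by powers of \<open>z - w\<close>\<close>

text \<open>An array \<open>F k l\<close> stands for the coefficients of \<open>z\<^sup>-\<^sup>k\<^sup>-\<^sup>1 w\<^sup>-\<^sup>l\<^sup>-\<^sup>1\<close>.\<close>

definition diff_mul :: "(int \<Rightarrow> int \<Rightarrow> 'a::ab_group_add) \<Rightarrow> int \<Rightarrow> int \<Rightarrow> 'a"
  where "diff_mul F k l = F (k + 1) l - F k (l + 1)"

text \<open>The coefficient of z^(n-j) w^j in (z - w)^n expanded for |z| > |w|. The generalised
  binomial admits negative n.\<close>

definition alt_gbinom :: "int \<Rightarrow> nat \<Rightarrow> complex"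
  where "alt_gbinom n j = (- 1) ^ j * (of_int n gchoose j)"

lemma alt_gbinom_0 [simp]: "alt_gbinom n 0 = 1"
  by (simp add: alt_gbinom_def)

lemma alt_gbinom_zero: "alt_gbinom 0 (Suc j) = 0"
  by (simp add: alt_gbinom_def)

lemma alt_gbinom_Suc: "alt_gbinom (n + 1) (Suc j) = alt_gbinom n (Suc j) - alt_gbinom n j"
  using gbinomial_Suc_Suc[of "of_int n :: complex" j] by (simp add: alt_gbinom_def algebra_simps)

lemma alt_gbinom_Suc': "alt_gbinom (1 + n) (Suc j) = alt_gbinom n (Suc j) - alt_gbinom n j"
  using alt_gbinom_Suc[of n j] by (simp add: add.commute)

text \<open>The absorption identity for binomials. Coefficientwise it says that the sum of the two
  partial derivatives kills (z - w)^n.\<close>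

lemma alt_gbinom_absorb: "of_nat (Suc j) * alt_gbinom n (Suc j) = - (of_int n - of_nat j) * alt_gbinom n j"
proof -
  have "of_nat (Suc j) * (of_int n gchoose Suc j) = (of_int n - of_nat j) * (of_int n gchoose j :: complex)"
    using gbinomial_mult_1[of "of_int n :: complex" j] by (simp add: algebra_simps)
  from arg_cong[OF this, of "\<lambda>x. - ((- 1) ^ j * x)"] show ?thesis
    unfolding alt_gbinom_def
    by (simp only: power_Suc mult_minus_left mult_minus_right mult.left_commute mult.assoc mult_1_left)
qed

text \<open>Negating the upper index yields the coefficients that \<open>nth_product\<close> uses
  for negative \<open>n\<close>. The conversion by \<open>nat\<close> loses nothing, since
  \<open>int j - n - 1\<close> is nonnegative there.\<close>

lemma alt_gbinom_neg:
  assumes "n < 0"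
  shows "alt_gbinom n j = of_nat (nat (int j - n - 1) choose j)"
proof -
  have "of_nat (nat (int j - n - 1)) = (of_int (int (nat (int j - n - 1))) :: complex)"
    by (simp only: of_int_of_nat_eq)
  also have "\<dots> = of_nat j - of_int n - 1"
    using assms by simp
  finally have eq: "of_nat j - of_int n - 1 = (of_nat (nat (int j - n - 1)) :: complex)" ..
  have "(- 1) ^ j * ((- 1) ^ j * x) = x" for x :: complex
    unfolding mult.assoc[symmetric] power_mult_distrib[symmetric] by simp
  then show ?thesis
    unfolding alt_gbinom_def gbinomial_negated_upper[of "of_int n"] eq binomial_gbinomial .
qed

lemma alt_gbinom_nonneg: "alt_gbinom (int n) j = (- 1) ^ j * of_nat (n choose j)"
  by (simp add: alt_gbinom_def binomial_gbinomial)

text \<open>The powers of w are bounded below, uniformly in the exponent of z. This is what makes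
  multiplication by an expansion in powers of w/z a finite sum in each coefficient.\<close>

definition bounded_right :: "(int \<Rightarrow> int \<Rightarrow> 'a::zero) \<Rightarrow> bool"
  where "bounded_right F \<longleftrightarrow> (\<exists>l0. \<forall>k l. l \<ge> l0 \<longrightarrow> F k l = 0)"

definition bounded_left :: "(int \<Rightarrow> int \<Rightarrow> 'a::zero) \<Rightarrow> bool"
  where "bounded_left F \<longleftrightarrow> (\<exists>k0. \<forall>k l. k \<ge> k0 \<longrightarrow> F k l = 0)"

text \<open>Multiplication by \<open>(z - w)\<^sup>n\<close> expanded in \<open>|z| > |w|\<close>, respectively in \<open>|w| > |z|\<close>.\<close>

definition pow_right :: "int \<Rightarrow> (int \<Rightarrow> int \<Rightarrow> 'a::complex_vector) \<Rightarrow> int \<Rightarrow> int \<Rightarrow> 'a"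
  where "pow_right n F k l = Sum_any (\<lambda>j. alt_gbinom n j *\<^sub>C F (k + n - int j) (l + int j))"

definition pow_left :: "int \<Rightarrow> (int \<Rightarrow> int \<Rightarrow> 'a::complex_vector) \<Rightarrow> int \<Rightarrow> int \<Rightarrow> 'a"
  where "pow_left n F k l = ((- 1) powi n) *\<^sub>C pow_right n (\<lambda>l k. F k l) l k"

lemma bounded_right_iff_left: "bounded_left F \<longleftrightarrow> bounded_right (\<lambda>l k. F k l)"
  by (auto simp: bounded_left_def bounded_right_def)

text \<open>Any cutoff past the bound is allowed, so several expansions can be compared at a common
  cutoff, or at neighbouring ones when an index has to be shifted.\<close>

lemma pow_right_eq_sum:
  assumes "\<And>k l. l \<ge> bd \<Longrightarrow> F k l = 0" "int J \<ge> bd - l"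
  shows "pow_right n F k l = (\<Sum>j<J. alt_gbinom n j *\<^sub>C F (k + n - int j) (l + int j))"
  unfolding pow_right_def
proof (rule Sum_any.expand_superset)
  show "{j. alt_gbinom n j *\<^sub>C F (k + n - int j) (l + int j) \<noteq> 0} \<subseteq> {..<J}"
  proof
    fix j assume "j \<in> {j. alt_gbinom n j *\<^sub>C F (k + n - int j) (l + int j) \<noteq> 0}"
    then have "F (k + n - int j) (l + int j) \<noteq> 0" by auto
    then have "\<not> l + int j \<ge> bd" using assms(1) by blast
    then show "j \<in> {..<J}" using assms(2) by simp
  qed
qed simp

text \<open>Also used with \<open>F = G\<close>, for an array obtained from a single bounded one by
  a map that preserves zero.\<close>

lemma bounded_right_comb:
  assumes "bounded_right F" "bounded_right G" "\<And>k l. F k l = 0 \<Longrightarrow> G k l = 0 \<Longrightarrow> H k l = 0"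
  shows "bounded_right H"
proof -
  obtain a where a: "\<And>k l. l \<ge> a \<Longrightarrow> F k l = 0" using assms(1) unfolding bounded_right_def by blast
  obtain b where b: "\<And>k l. l \<ge> b \<Longrightarrow> G k l = 0" using assms(2) unfolding bounded_right_def by blast
  show ?thesis unfolding bounded_right_def
    by (intro exI[of _ "max a b"] allI impI assms(3) a b) auto
qed

lemma bounded_right_shift:
  assumes "bounded_right F"
  shows "bounded_right (\<lambda>k l. F (k + a) (l + b))"
proof -
  obtain bd where bd: "\<And>k l. l \<ge> bd \<Longrightarrow> F k l = 0" using assms unfolding bounded_right_def by blast
  show ?thesis unfolding bounded_right_def
    by (intro exI[of _ "bd - b"] allI impI bd) auto
qed

lemma pow_right_lin:
  assumes "bounded_right F" "bounded_right G"
  shows "pow_right n (\<lambda>k l. a *\<^sub>C F k l + b *\<^sub>C G k l) k l = a *\<^sub>C pow_right n F k l + b *\<^sub>C pow_right n G k l"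
proof -
  obtain p where p: "\<And>k l. l \<ge> p \<Longrightarrow> F k l = 0" using assms(1) unfolding bounded_right_def by blast
  obtain q where q: "\<And>k l. l \<ge> q \<Longrightarrow> G k l = 0" using assms(2) unfolding bounded_right_def by blast
  define J where "J = nat (max p q - l)"
  have J: "int J \<ge> max p q - l" unfolding J_def by linarith
  have 1: "pow_right n F k l = (\<Sum>j<J. alt_gbinom n j *\<^sub>C F (k + n - int j) (l + int j))"
    by (rule pow_right_eq_sum[where bd = "max p q"]) (use p J in auto)
  have 2: "pow_right n G k l = (\<Sum>j<J. alt_gbinom n j *\<^sub>C G (k + n - int j) (l + int j))"
    by (rule pow_right_eq_sum[where bd = "max p q"]) (use q J in auto)
  have 3: "pow_right n (\<lambda>k l. a *\<^sub>C F k l + b *\<^sub>C G k l) k l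
     = (\<Sum>j<J. alt_gbinom n j *\<^sub>C (a *\<^sub>C F (k + n - int j) (l + int j) + b *\<^sub>C G (k + n - int j) (l + int j)))"
    by (rule pow_right_eq_sum[where bd = "max p q"]) (use p q J in auto)
  show ?thesis unfolding 1 2 3
    by (simp add: complex_vector.scale_sum_right scaleC_add_right scaleC_scaleC mult.commute sum.distrib)
qed

lemma pow_right_clinear:
  assumes "bounded_right F" "clinear f"
  shows "f (pow_right n F k l) = pow_right n (\<lambda>k l. f (F k l)) k l"
proof -
  obtain p where p: "\<And>k l. l \<ge> p \<Longrightarrow> F k l = 0" using assms(1) unfolding bounded_right_def by blast
  define J where "J = nat (p - l)"
  have J: "int J \<ge> p - l" by (simp add: J_def)
  have 1: "pow_right n F k l = (\<Sum>j<J. alt_gbinom n j *\<^sub>C F (k + n - int j) (l + int j))"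
    by (rule pow_right_eq_sum[where bd = p]) (use p J in auto)
  have 2: "pow_right n (\<lambda>k l. f (F k l)) k l = (\<Sum>j<J. alt_gbinom n j *\<^sub>C f (F (k + n - int j) (l + int j)))"
    by (rule pow_right_eq_sum[where bd = p]) (use p J clinear_simps[OF assms(2)] in auto)
  show ?thesis unfolding 1 2
    by (simp add: clinear_sum[OF assms(2)] clinear_simps[OF assms(2)])
qed

lemma pow_right_shift:
  "pow_right n (\<lambda>k l. F (k + a) (l + b)) k l = pow_right n F (k + a) (l + b)"
  unfolding pow_right_def by (simp add: algebra_simps)

lemma pow_right_0:
  assumes "bounded_right F"
  shows "pow_right 0 F = F"
proof (intro ext)
  fix k l
  obtain p where p: "\<And>k l. l \<ge> p \<Longrightarrow> F k l = 0" using assms(1) unfolding bounded_right_def by blast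
  define J where "J = nat (p - l)"
  have "pow_right 0 F k l = (\<Sum>j<Suc J. alt_gbinom 0 j *\<^sub>C F (k - int j) (l + int j))"
    using pow_right_eq_sum[where bd = p and J = "Suc J" and n = 0 and F = F and k = k and l = l] p
    by (simp add: J_def del: sum.lessThan_Suc)
  also have "\<dots> = F k l"
    by (subst sum.lessThan_Suc_shift) (simp add: alt_gbinom_zero scaleC_one)
  finally show "pow_right 0 F k l = F k l" .
qed

lemma diff_mul_pow_right:
  assumes "bounded_right F"
  shows "diff_mul (pow_right n F) = pow_right (n + 1) F"
proof (intro ext)
  fix k l
  obtain p where p: "\<And>k l. l \<ge> p \<Longrightarrow> F k l = 0" using assms(1) unfolding bounded_right_def by blast
  define J where "J = nat (p - l)"
  let ?S = "\<lambda>j. F (k + n - int j) (l + 1 + int j)"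
  \<comment> \<open>The first and third sums run one index further than the second, so that
    splitting off j = 0 aligns all three and leaves Pascal's rule for the coefficients.\<close>
  have 1: "pow_right n F (k + 1) l = (\<Sum>j<Suc J. alt_gbinom n j *\<^sub>C F (k + 1 + n - int j) (l + int j))"
    by (rule pow_right_eq_sum[where bd = p]) (use p in \<open>auto simp: J_def\<close>)
  have 2: "pow_right n F k (l + 1) = (\<Sum>j<J. alt_gbinom n j *\<^sub>C F (k + n - int j) (l + 1 + int j))"
    by (rule pow_right_eq_sum[where bd = p]) (use p in \<open>auto simp: J_def\<close>)
  have 3: "pow_right (n + 1) F k l = (\<Sum>j<Suc J. alt_gbinom (n + 1) j *\<^sub>C F (k + (n + 1) - int j) (l + int j))"
    by (rule pow_right_eq_sum[where bd = p]) (use p in \<open>auto simp: J_def\<close>)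
  show "diff_mul (pow_right n F) k l = pow_right (n + 1) F k l"
    unfolding diff_mul_def 1 2 3 sum.lessThan_Suc_shift
    by (simp add: alt_gbinom_Suc' complex_vector.scale_left_diff_distrib sum_subtractf ac_simps add_diff_eq)
qed

lemma diff_mul_pow_right_funpow:
  assumes "bounded_right F"
  shows "(diff_mul ^^ j) (pow_right n F) = pow_right (n + int j) F"
  by (induction j) (simp_all add: diff_mul_pow_right[OF assms] algebra_simps)

lemma pow_right_nat: "bounded_right F \<Longrightarrow> pow_right (int j) F = (diff_mul ^^ j) F"
  using diff_mul_pow_right_funpow[of F j 0] by (simp add: pow_right_0)

text \<open>\<open>\<partial>\<^sub>z + \<partial>\<^sub>w\<close> annihilates \<open>z - w\<close>.\<close>

lemma pow_right_deriv:
  assumes "bounded_right F"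
  shows "pow_right n (\<lambda>k l. of_int (- k) *\<^sub>C F (k - 1) l + of_int (- l) *\<^sub>C F k (l - 1)) k l
    = of_int (- k) *\<^sub>C pow_right n F (k - 1) l + of_int (- l) *\<^sub>C pow_right n F k (l - 1)"
proof -
  obtain p where p: "\<And>k l. l \<ge> p \<Longrightarrow> F k l = 0" using assms(1) unfolding bounded_right_def by blast
  \<comment> \<open>One more than the bound of \<open>F\<close> requires, because the differentiated
    array also contains \<open>F\<close> at second index \<open>l - 1\<close>.\<close>
  define J where "J = nat (p + 1 - l)"
  let ?a = "\<lambda>j. F (k + n - int j - 1) (l + int j)"
  let ?b = "\<lambda>j. F (k + n - int j) (l + int j - 1)"
  have 1: "pow_right n F (k - 1) l = (\<Sum>j<J. alt_gbinom n j *\<^sub>C F (k - 1 + n - int j) (l + int j))"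
    by (rule pow_right_eq_sum[where bd = p]) (use p in \<open>auto simp: J_def\<close>)
  have 2: "pow_right n F k (l - 1) = (\<Sum>j<Suc J. alt_gbinom n j *\<^sub>C F (k + n - int j) (l - 1 + int j))"
    by (rule pow_right_eq_sum[where bd = p]) (use p in \<open>auto simp: J_def\<close>)
  have 3: "pow_right n (\<lambda>k l. of_int (- k) *\<^sub>C F (k - 1) l + of_int (- l) *\<^sub>C F k (l - 1)) k l
    = (\<Sum>j<Suc J. alt_gbinom n j *\<^sub>C (of_int (- (k + n - int j)) *\<^sub>C F (k + n - int j - 1) (l + int j)
        + of_int (- (l + int j)) *\<^sub>C F (k + n - int j) (l + int j - 1)))"
    by (rule pow_right_eq_sum[where bd = "p + 1"]) (use p in \<open>auto simp: J_def\<close>)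
  have aJ: "?a J = 0" by (rule p) (simp add: J_def)
  \<comment> \<open>\<open>?b (Suc j)\<close> is \<open>?a j\<close>. Shifting the index and
    absorbing the factor j turns the error from the derivative in w into the one from the derivative
    in z, and the two cancel.\<close>
  have 4: "(\<Sum>j<Suc J. (of_nat j * alt_gbinom n j) *\<^sub>C ?b j) = (\<Sum>j<J. (- (of_int n - of_nat j) * alt_gbinom n j) *\<^sub>C ?a j)"
    unfolding sum.lessThan_Suc_shift alt_gbinom_absorb by (simp add: algebra_simps)
  have cancel: "x + y + z - y = x + z" for x y z :: 'a
    by simp
  have "(\<Sum>j<Suc J. alt_gbinom n j *\<^sub>C (of_int (- (k + n - int j)) *\<^sub>C ?a j + of_int (- (l + int j)) *\<^sub>C ?b j))
     = (\<Sum>j<Suc J. (of_int (- k) * alt_gbinom n j) *\<^sub>C ?a j + (- (of_int n - of_nat j) * alt_gbinom n j) *\<^sub>C ?a j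
         + (of_int (- l) * alt_gbinom n j) *\<^sub>C ?b j - (of_nat j * alt_gbinom n j) *\<^sub>C ?b j)"
    by (rule sum.cong[OF refl]) (simp add: scaleC_scaleC complex_vector.scale_right_distrib
        complex_vector.scale_left_diff_distrib complex_vector.scale_left_distrib algebra_simps)
  also have "\<dots> = (\<Sum>j<Suc J. (of_int (- k) * alt_gbinom n j) *\<^sub>C ?a j) + (\<Sum>j<J. (- (of_int n - of_nat j) * alt_gbinom n j) *\<^sub>C ?a j)
         + (\<Sum>j<Suc J. (of_int (- l) * alt_gbinom n j) *\<^sub>C ?b j) - (\<Sum>j<Suc J. (of_nat j * alt_gbinom n j) *\<^sub>C ?b j)"
    using aJ by (simp add: sum.distrib sum_subtractf sum_negf)
  also have "\<dots> = (\<Sum>j<Suc J. (of_int (- k) * alt_gbinom n j) *\<^sub>C ?a j) + (\<Sum>j<Suc J. (of_int (- l) * alt_gbinom n j) *\<^sub>C ?b j)"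
    unfolding 4 using cancel .
  also have "\<dots> = (\<Sum>j<J. (of_int (- k) * alt_gbinom n j) *\<^sub>C ?a j) + (\<Sum>j<Suc J. (of_int (- l) * alt_gbinom n j) *\<^sub>C ?b j)"
    using aJ by simp
  also have "\<dots> = of_int (- k) *\<^sub>C (\<Sum>j<J. alt_gbinom n j *\<^sub>C F (k - 1 + n - int j) (l + int j))
      + of_int (- l) *\<^sub>C (\<Sum>j<Suc J. alt_gbinom n j *\<^sub>C F (k + n - int j) (l - 1 + int j))"
    unfolding complex_vector.scale_sum_right scaleC_scaleC
    by (intro arg_cong2[of _ _ _ _ "(+)"] sum.cong refl) (simp_all add: algebra_simps)
  finally show ?thesis unfolding 3 1 2 .
qed

text \<open>Every term of the expansion has total index \<open>k + l + n\<close>, because (z - w)^n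
  is homogeneous of degree n. This is the source of the shift by n in the degree of A_n B.\<close>

lemma pow_right_euler:
  assumes "bounded_right F"
  shows "pow_right n (\<lambda>k l. (x - of_int (k + l)) *\<^sub>C F k l) k l = (x - of_int (k + l + n)) *\<^sub>C pow_right n F k l"
proof -
  obtain p where p: "\<And>k l. l \<ge> p \<Longrightarrow> F k l = 0" using assms(1) unfolding bounded_right_def by blast
  define J where "J = nat (p - l)"
  have 1: "pow_right n F k l = (\<Sum>j<J. alt_gbinom n j *\<^sub>C F (k + n - int j) (l + int j))"
    by (rule pow_right_eq_sum[where bd = p]) (use p in \<open>auto simp: J_def\<close>)
  have 2: "pow_right n (\<lambda>k l. (x - of_int (k + l)) *\<^sub>C F k l) k l
     = (\<Sum>j<J. alt_gbinom n j *\<^sub>C (x - of_int (k + n - int j + (l + int j))) *\<^sub>C F (k + n - int j) (l + int j))"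
    by (rule pow_right_eq_sum[where bd = p]) (use p in \<open>auto simp: J_def\<close>)
  show ?thesis unfolding 1 2
    by (simp add: complex_vector.scale_sum_right scaleC_scaleC algebra_simps)
qed

text \<open>Since (z - w)^n = (-1)^n (w - z)^n, each fact about \<open>pow_left\<close> is the one
  about \<open>pow_right\<close> with the two variables exchanged.\<close>

lemma pow_left_lin:
  assumes "bounded_left F" "bounded_left G"
  shows "pow_left n (\<lambda>k l. a *\<^sub>C F k l + b *\<^sub>C G k l) k l = a *\<^sub>C pow_left n F k l + b *\<^sub>C pow_left n G k l"
  using assms unfolding pow_left_def bounded_right_iff_left
  by (simp add: pow_right_lin scaleC_add_right scaleC_scaleC mult.commute)

lemma pow_left_clinear:
  assumes "bounded_left F" "clinear f"
  shows "f (pow_left n F k l) = pow_left n (\<lambda>k l. f (F k l)) k l"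
  using assms unfolding pow_left_def bounded_right_iff_left
  by (simp only: clinear_simps[OF assms(2)] pow_right_clinear)

lemma minus_one_powi_Suc: "(- 1) powi (n + 1) = - ((- 1) powi n :: complex)"
  by (simp add: power_int_add)

lemma diff_mul_pow_left:
  assumes "bounded_left F"
  shows "diff_mul (pow_left n F) = pow_left (n + 1) F"
proof (intro ext)
  fix k l
  have "diff_mul (pow_left n F) k l = - ((- 1) powi n) *\<^sub>C diff_mul (pow_right n (\<lambda>l k. F k l)) l k"
    by (simp add: diff_mul_def pow_left_def complex_vector.scale_right_diff_distrib)
  also have "\<dots> = pow_left (n + 1) F k l"
    using assms unfolding bounded_right_iff_left
    by (simp add: diff_mul_pow_right pow_left_def minus_one_powi_Suc)
  finally show "diff_mul (pow_left n F) k l = pow_left (n + 1) F k l" .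
qed

lemma diff_mul_pow_left_funpow:
  assumes "bounded_left F"
  shows "(diff_mul ^^ j) (pow_left n F) = pow_left (n + int j) F"
  by (induction j) (simp_all add: diff_mul_pow_left[OF assms] algebra_simps)

lemma pow_left_0: "bounded_left F \<Longrightarrow> pow_left 0 F = F"
  unfolding bounded_right_iff_left by (intro ext) (simp add: pow_left_def pow_right_0)

lemma pow_left_nat: "bounded_left F \<Longrightarrow> pow_left (int j) F = (diff_mul ^^ j) F"
  using diff_mul_pow_left_funpow[of F j 0] by (simp add: pow_left_0)

lemma pow_left_deriv:
  assumes "bounded_left F"
  shows "pow_left n (\<lambda>k l. of_int (- k) *\<^sub>C F (k - 1) l + of_int (- l) *\<^sub>C F k (l - 1)) k l
    = of_int (- k) *\<^sub>C pow_left n F (k - 1) l + of_int (- l) *\<^sub>C pow_left n F k (l - 1)"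
proof -
  have "pow_right n (\<lambda>l k. of_int (- k) *\<^sub>C F (k - 1) l + of_int (- l) *\<^sub>C F k (l - 1)) l k
    = of_int (- k) *\<^sub>C pow_right n (\<lambda>l k. F k l) l (k - 1) + of_int (- l) *\<^sub>C pow_right n (\<lambda>l k. F k l) (l - 1) k"
    using pow_right_deriv[of "\<lambda>l k. F k l" n l k] assms
    unfolding bounded_right_iff_left by (subst (1 2) add.commute)
  then show ?thesis
    unfolding pow_left_def
    by (simp only: complex_vector.scale_right_distrib scaleC_scaleC mult.commute)
qed

lemma pow_left_euler:
  assumes "bounded_left F"
  shows "pow_left n (\<lambda>k l. (x - of_int (k + l)) *\<^sub>C F k l) k l = (x - of_int (k + l + n)) *\<^sub>C pow_left n F k l"
proof -
  have "pow_right n (\<lambda>l k. (x - of_int (k + l)) *\<^sub>C F k l) l k = (x - of_int (k + l + n)) *\<^sub>C pow_right n (\<lambda>l k. F k l) l k"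
    using pow_right_euler[of "\<lambda>l k. F k l" n x l k] assms
    unfolding bounded_right_iff_left by (simp only: add.commute)
  then show ?thesis
    unfolding pow_left_def by (simp only: scaleC_scaleC mult.commute)
qed

section \<open>Locality of mode families and Dong's lemma\<close>

definition truncated :: "'h::complex_vector modes \<Rightarrow> bool"
  where "truncated A \<longleftrightarrow> (\<forall>v. \<exists>M. \<forall>m\<ge>M. A m v = 0)"

text \<open>\<open>(z - w)\<^sup>N (A(z) B(w) - s B(w) A(z)) = 0\<close> for some \<open>N\<close>.\<close>

definition local_modes :: "complex \<Rightarrow> 'h::complex_vector modes \<Rightarrow> 'h modes \<Rightarrow> bool"
  where "local_modes s A B \<longleftrightarrow>
    (\<exists>N. \<forall>v. (diff_mul ^^ N) (\<lambda>k l. A k (B l v) - s *\<^sub>C B l (A k v)) = (\<lambda>k l. 0))"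

lemma bounded_right_AB:
  assumes "is_field A" "truncated B"
  shows "bounded_right (\<lambda>k l. A k (B l v))"
proof -
  obtain M where "\<forall>m\<ge>M. B m v = 0" using assms(2) unfolding truncated_def by blast
  then show ?thesis
    unfolding bounded_right_def
    by (intro exI[of _ M]) (auto simp: clinear_simps(3)[OF is_fieldD[OF assms(1)]])
qed

lemma bounded_left_BA:
  assumes "is_field B" "truncated A"
  shows "bounded_left (\<lambda>k l. B l (A k v))"
  unfolding bounded_right_iff_left by (rule bounded_right_AB[OF assms])

section \<open>Iterated multiplication by z - w: nilpotency, linearity and cancellation\<close>

lemma funpow_additive:
  fixes f :: "'x::ab_group_add \<Rightarrow> 'x"
  assumes "\<And>x y. f (x - y) = f x - f y"
  shows "(f ^^ a) (x - y) = (f ^^ a) x - (f ^^ a) y"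
  by (induction a) (simp_all add: assms)

lemma funpow_zero:
  fixes f :: "'x::ab_group_add \<Rightarrow> 'x"
  assumes "\<And>x y. f (x - y) = f x - f y"
  shows "(f ^^ a) 0 = 0"
  using funpow_additive[of f a 0 0] assms by simp

lemma funpow_comm:
  assumes "\<And>x. f (g x) = g (f x)"
  shows "(f ^^ a) ((g ^^ b) x) = (g ^^ b) ((f ^^ a) x)"
proof -
  have "f ((g ^^ b) x) = (g ^^ b) (f x)" for x
    by (induction b) (simp_all add: assms)
  then show ?thesis
    by (induction a) simp_all
qed

text \<open>In a commutative ring, \<open>p\<^sup>a = 0\<close> and \<open>q\<^sup>b = 0\<close> imply \<open>(q - p)\<^sup>a\<^sup>+\<^sup>b = 0\<close>.\<close>

lemma funpow_diff_eq_0: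
  fixes P Q :: "'x::ab_group_add \<Rightarrow> 'x"
  assumes P: "\<And>x y. P (x - y) = P x - P y" and Q: "\<And>x y. Q (x - y) = Q x - Q y"
    and PQ: "\<And>x. P (Q x) = Q (P x)"
    and "(P ^^ a) Z = 0" "(Q ^^ b) Z = 0"
  shows "((\<lambda>x. Q x - P x) ^^ (a + b)) Z = 0"
  using assms(4,5)
proof (induction "a + b" arbitrary: a b Z)
  case 0
  then show ?case by simp
next
  case (Suc n)
  let ?R = "\<lambda>x. Q x - P x"
  have R: "?R (x - y) = ?R x - ?R y" for x y by (simp add: P Q)
  show ?case
  proof (cases "a = 0 \<or> b = 0")
    case True
    then have "Z = 0" using Suc.prems by auto
    then show ?thesis by (simp only: funpow_zero[of ?R, OF R])
  next
    case False
    then obtain a' b' where ab: "a = Suc a'" "b = Suc b'" by (meson not0_implies_Suc)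
    \<comment> \<open>\<open>Q Z\<close> is killed by the powers a and b - 1 of \<open>P\<close> and
      \<open>Q\<close>, and \<open>P Z\<close> by the powers a - 1 and b. Both pairs have a smaller
      sum, so the induction hypothesis applies to each half of \<open>?R Z\<close>.\<close>
    have "(P ^^ a) (Q Z) = Q ((P ^^ a) Z)" "(Q ^^ b) (P Z) = P ((Q ^^ b) Z)"
      using funpow_comm[of P Q a 1 Z] funpow_comm[of Q P b 1 Z] PQ by simp_all
    then have 1: "(P ^^ a) (Q Z) = 0" "(Q ^^ b) (P Z) = 0"
      using Suc.prems funpow_zero[of Q 1, OF Q] funpow_zero[of P 1, OF P] by simp_all
    have 2: "(Q ^^ b') (Q Z) = 0" "(P ^^ a') (P Z) = 0"
      using Suc.prems ab by (simp_all add: funpow_swap1)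
    have "(?R ^^ n) (Q Z) = 0" using Suc.hyps(1)[of a b' "Q Z"] 1 2 ab Suc.hyps(2) by simp
    moreover have "(?R ^^ n) (P Z) = 0" using Suc.hyps(1)[of a' b "P Z"] 1 2 ab Suc.hyps(2) by simp
    ultimately have "(?R ^^ n) (?R Z) = 0"
      by (simp only: funpow_additive[of ?R, OF R]) simp
    then show ?thesis
      unfolding Suc.hyps(2)[symmetric] by (simp only: funpow_Suc_right o_def)
  qed
qed

lemma diff_mul_funpow_clinear:
  assumes "clinear f"
  shows "(diff_mul ^^ N) (\<lambda>k l. f (F k l)) = (\<lambda>k l. f ((diff_mul ^^ N) F k l))"
  by (induction N) (simp_all add: fun_eq_iff diff_mul_def clinear_simps[OF assms])

lemma diff_mul_funpow_lin:
  fixes F G :: "int \<Rightarrow> int \<Rightarrow> 'a::complex_vector"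
  shows "(diff_mul ^^ N) (\<lambda>k l. a *\<^sub>C F k l + b *\<^sub>C G k l)
    = (\<lambda>k l. a *\<^sub>C (diff_mul ^^ N) F k l + b *\<^sub>C (diff_mul ^^ N) G k l)"
  by (induction N) (simp_all add: fun_eq_iff diff_mul_def scaleC_add_right
      complex_vector.scale_right_diff_distrib)

lemma diff_mul_funpow_diff:
  fixes F G :: "int \<Rightarrow> int \<Rightarrow> 'a::complex_vector"
  shows "(diff_mul ^^ N) (\<lambda>k l. F k l - b *\<^sub>C G k l)
    = (\<lambda>k l. (diff_mul ^^ N) F k l - b *\<^sub>C (diff_mul ^^ N) G k l)"
  using diff_mul_funpow_lin[of N 1 F "- b" G] by (simp add: scaleC_one)

lemma diff_mul_funpow_zero: "(diff_mul ^^ N) (\<lambda>k l. 0) = (\<lambda>k l. 0)"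
  by (induction N) (simp_all add: diff_mul_def)

lemma diff_mul_funpow_mono:
  assumes "(diff_mul ^^ N) F = (\<lambda>k l. 0)" "N \<le> M"
  shows "(diff_mul ^^ M) F = (\<lambda>k l. 0)"
proof -
  have "(diff_mul ^^ M) F = (diff_mul ^^ (M - N)) ((diff_mul ^^ N) F)"
    using assms(2) by (metis funpow_add comp_apply le_add_diff_inverse2)
  then show ?thesis by (simp add: assms(1) diff_mul_funpow_zero)
qed

lemma diff_mul_funpow_swap:
  "(diff_mul ^^ N) (\<lambda>k l. F l k) = (\<lambda>k l. ((- 1) ^ N) *\<^sub>C (diff_mul ^^ N) F l (k :: int) :: 'a::complex_vector)"
  by (induction N) (simp_all add: fun_eq_iff diff_mul_def scaleC_one complex_vector.scale_right_diff_distrib)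

lemma bounded_right_diff_mul:
  assumes "bounded_right F"
  shows "bounded_right (diff_mul F)"
proof -
  obtain bd where "\<And>k l. l \<ge> bd \<Longrightarrow> F k l = 0"
    using assms unfolding bounded_right_def by blast
  then show ?thesis
    unfolding bounded_right_def diff_mul_def by (intro exI[of _ bd]) simp
qed

text \<open>The bound is essential, as the formal delta function is killed by z - w. If (z - w) F =
  0, then F is constant along each antidiagonal \<open>k + l = const\<close>, and it vanishes far
  out on it.\<close>

lemma diff_mul_funpow_inject:
  assumes "bounded_right F" "(diff_mul ^^ N) F = (\<lambda>k l. 0)"
  shows "F k l = 0"
  using assms
proof (induction N arbitrary: k l F)
  case 0
  then show ?case by (simp add: fun_eq_iff)
next
  case (Suc N)
  obtain bd where bd: "\<And>k l. l \<ge> bd \<Longrightarrow> F k l = 0"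
    using Suc.prems(1) unfolding bounded_right_def by blast
  have 0: "diff_mul F k l = 0" for k l
    by (rule Suc.IH[OF bounded_right_diff_mul[OF Suc.prems(1)]]) (use Suc.prems(2) in \<open>simp add: funpow_swap1\<close>)
  have step: "F k l = F (k - int j) (l + int j)" for k l j
  proof (induction j)
    case (Suc j)
    then show ?case using 0[of "k - int (Suc j)" "l + int j"] by (simp add: diff_mul_def algebra_simps)
  qed simp
  have "F (k - int (nat (bd - l))) (l + int (nat (bd - l))) = 0" by (rule bd) simp
  then show ?case using step by metis
qed

lemma local_modes_sym:
  assumes "local_modes s A B" "s * s = 1"
  shows "local_modes s B A"
proof -
  obtain N where N: "\<And>v. (diff_mul ^^ N) (\<lambda>k l. A k (B l v) - s *\<^sub>C B l (A k v)) = (\<lambda>k l. 0)"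
    using assms(1) unfolding local_modes_def by blast
  have "(diff_mul ^^ N) (\<lambda>k l. B k (A l v) - s *\<^sub>C A l (B k v)) = (\<lambda>k l. 0)" for v
  proof -
    \<comment> \<open>The factor \<open>- s\<close> exchanges the two orders because s^2 = 1. The
      zero summand only gives the array the shape of a linear combination of two arrays.\<close>
    have eq: "(\<lambda>k l. B k (A l v) - s *\<^sub>C A l (B k v))
      = (\<lambda>k l. (- s) *\<^sub>C (A l (B k v) - s *\<^sub>C B k (A l v)) + 0 *\<^sub>C 0)"
      by (simp add: fun_eq_iff complex_vector.scale_right_diff_distrib scaleC_scaleC assms(2) scaleC_one)
    show ?thesis
      unfolding eq
      unfolding diff_mul_funpow_lin
      unfolding diff_mul_funpow_swap[of N "\<lambda>k l. A k (B l v) - s *\<^sub>C B l (A k v)"] N by simp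
  qed
  then show ?thesis unfolding local_modes_def by blast
qed

lemma local_modes_subspace_left:
  assumes "is_field B"
  shows "csubspace {A. local_modes s A B}"
proof (rule complex_vector.subspaceI)
  show "0 \<in> {A. local_modes s A B}"
    by (auto simp: local_modes_def clinear_simps[OF is_fieldD[OF assms]] intro!: exI[of _ 0])
next
  fix A1 A2 assume "A1 \<in> {A. local_modes s A B}" "A2 \<in> {A. local_modes s A B}"
  then obtain N1 N2 where
    N1: "\<And>v. (diff_mul ^^ N1) (\<lambda>k l. A1 k (B l v) - s *\<^sub>C B l (A1 k v)) = (\<lambda>k l. 0)" and
    N2: "\<And>v. (diff_mul ^^ N2) (\<lambda>k l. A2 k (B l v) - s *\<^sub>C B l (A2 k v)) = (\<lambda>k l. 0)"
    unfolding local_modes_def by blast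
  have "(diff_mul ^^ max N1 N2) (\<lambda>k l. (A1 + A2) k (B l v) - s *\<^sub>C B l ((A1 + A2) k v)) = (\<lambda>k l. 0)" for v
  proof -
    have eq: "(\<lambda>k l. (A1 + A2) k (B l v) - s *\<^sub>C B l ((A1 + A2) k v))
      = (\<lambda>k l. 1 *\<^sub>C (A1 k (B l v) - s *\<^sub>C B l (A1 k v)) + 1 *\<^sub>C (A2 k (B l v) - s *\<^sub>C B l (A2 k v)))"
      by (simp add: fun_eq_iff scaleC_one clinear_simps[OF is_fieldD[OF assms]] scaleC_add_right)
    show ?thesis
      unfolding eq
      unfolding diff_mul_funpow_lin
      by (simp add: diff_mul_funpow_mono[OF N1] diff_mul_funpow_mono[OF N2])
  qed
  then show "A1 + A2 \<in> {A. local_modes s A B}" unfolding local_modes_def by blast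
next
  fix c A1 assume "A1 \<in> {A. local_modes s A B}"
  then obtain N1 where
    N1: "\<And>v. (diff_mul ^^ N1) (\<lambda>k l. A1 k (B l v) - s *\<^sub>C B l (A1 k v)) = (\<lambda>k l. 0)"
    unfolding local_modes_def by blast
  have "(diff_mul ^^ N1) (\<lambda>k l. (c *\<^sub>C A1) k (B l v) - s *\<^sub>C B l ((c *\<^sub>C A1) k v)) = (\<lambda>k l. 0)" for v
  proof -
    have eq: "(\<lambda>k l. (c *\<^sub>C A1) k (B l v) - s *\<^sub>C B l ((c *\<^sub>C A1) k v))
      = (\<lambda>k l. c *\<^sub>C (A1 k (B l v) - s *\<^sub>C B l (A1 k v)) + 0 *\<^sub>C 0)"
      by (simp add: fun_eq_iff scaleC_fun_def scaleC_scaleC clinear_simps[OF is_fieldD[OF assms]]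
          complex_vector.scale_right_diff_distrib mult.commute)
    show ?thesis
      unfolding eq
      unfolding diff_mul_funpow_lin by (simp add: N1)
  qed
  then show "c *\<^sub>C A1 \<in> {A. local_modes s A B}" unfolding local_modes_def by blast
qed

text \<open>\<open>\<partial>\<^sub>z\<close> raises the order of the pole by one.\<close>

lemma local_modes_deriv:
  assumes "local_modes s A B" "is_field B"
  shows "local_modes s (deriv_field A) B"
proof -
  define der :: "(int \<Rightarrow> int \<Rightarrow> 'a) \<Rightarrow> int \<Rightarrow> int \<Rightarrow> 'a"
    where "der F k l = of_int (- k) *\<^sub>C F (k - 1) l" for F k l
  \<comment> \<open>The product rule: z - w times the z-derivative of F is the z-derivative of (z -
    w) F, minus F.\<close>
  have comm: "diff_mul (der F) = (\<lambda>k l. der (diff_mul F) k l - 1 *\<^sub>C F k l)" for F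
    by (simp add: fun_eq_iff diff_mul_def der_def algebra_simps complex_vector.scale_left_distrib
        complex_vector.scale_right_diff_distrib scaleC_one)
  have key: "(diff_mul ^^ N) F = (\<lambda>k l. 0) \<Longrightarrow> (diff_mul ^^ Suc N) (der F) = (\<lambda>k l. 0)" for N F
  proof (induction N arbitrary: F)
    case 0
    then show ?case by (simp add: fun_eq_iff diff_mul_def der_def)
  next
    case (Suc N)
    have "(diff_mul ^^ Suc (Suc N)) (der F) = (diff_mul ^^ Suc N) (diff_mul (der F))"
      by (simp only: funpow_Suc_right o_def)
    also have "\<dots> = (\<lambda>k l. 0)"
      unfolding comm diff_mul_funpow_diff Suc.prems
      using Suc.IH[of "diff_mul F"] Suc.prems by (simp add: funpow_swap1)
    finally show ?case .
  qed
  obtain N where N: "\<And>v. (diff_mul ^^ N) (\<lambda>k l. A k (B l v) - s *\<^sub>C B l (A k v)) = (\<lambda>k l. 0)"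
    using assms(1) unfolding local_modes_def by blast
  have "(\<lambda>k l. deriv_field A k (B l v) - s *\<^sub>C B l (deriv_field A k v))
    = der (\<lambda>k l. A k (B l v) - s *\<^sub>C B l (A k v))" for v
    by (simp add: fun_eq_iff der_def deriv_field_def clinear_simps[OF is_fieldD[OF assms(2)]] 
        complex_vector.scale_right_diff_distrib scaleC_scaleC mult.commute)
  then have "(diff_mul ^^ Suc N) (\<lambda>k l. deriv_field A k (B l v) - s *\<^sub>C B l (deriv_field A k v)) = (\<lambda>k l. 0)" for v
    using key[OF N] by simp
  then show ?thesis unfolding local_modes_def by blast
qed

text \<open>The residue in z of (z - w)^n A(z) B(w) - s (z - w)^n B(w) A(z), each power expanded in
  the domain of its operator order: the first index 0 selects the coefficient of 1/z. Both signs of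
  \<open>n\<close> are covered, and \<open>s\<close> may be any complex number.\<close>

definition nprod :: "complex \<Rightarrow> 'h::complex_vector modes \<Rightarrow> int \<Rightarrow> 'h modes \<Rightarrow> 'h modes"
  where "nprod s A n B m = (\<lambda>v. pow_right n (\<lambda>k l. A k (B l v)) 0 m - s *\<^sub>C pow_left n (\<lambda>k l. B l (A k v)) 0 m)"

lemma truncated_bound2:
  assumes "truncated A" "truncated B"
  obtains M where "\<And>m. m \<ge> M \<Longrightarrow> A m v = 0" "\<And>m. m \<ge> M \<Longrightarrow> B m v = 0"
proof -
  obtain a b where "\<forall>m\<ge>a. A m v = 0" "\<forall>m\<ge>b. B m v = 0"
    using assms unfolding truncated_def by blast
  then show ?thesis using that[of "max a b"] by simp
qed

lemma nth_product_eq_nprod: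
  assumes "is_field A" "is_field B" "truncated A" "truncated B"
  shows "nth_product \<epsilon> A n B = nprod (parity_sign \<epsilon>) A n B"
proof (intro ext)
  fix m v
  let ?s = "parity_sign \<epsilon>"
  have A0: "A k 0 = 0" and B0: "B k 0 = 0" for k
    using assms(1,2) by (simp_all add: clinear_simps(3)[OF is_fieldD])
  obtain M where M: "\<And>m. m \<ge> M \<Longrightarrow> A m v = 0" "\<And>m. m \<ge> M \<Longrightarrow> B m v = 0"
    using truncated_bound2[OF assms(3,4)] by blast
  show "nth_product \<epsilon> A n B m v = nprod ?s A n B m v"
  proof (cases "n \<ge> 0")
    case False
    \<comment> \<open>From this cutoff on both \<open>A (int j) v\<close> and
      \<open>B (m + int j) v\<close> vanish, so one range serves both expansions.\<close>
    define J where "J = nat (max M (M - m))"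
    have J: "int J \<ge> M" "int J \<ge> M - m" unfolding J_def by linarith+
    have 1: "pow_right n (\<lambda>k l. A k (B l v)) 0 m = (\<Sum>j<J. alt_gbinom n j *\<^sub>C A (n - int j) (B (m + int j) v))"
      using pow_right_eq_sum[where bd = M and J = J and F = "\<lambda>k l. A k (B l v)" and k = 0 and l = m] J M A0 by simp
    have 2: "pow_right n (\<lambda>l k. B l (A k v)) m 0 = (\<Sum>j<J. alt_gbinom n j *\<^sub>C B (m + n - int j) (A (int j) v))"
      using pow_right_eq_sum[where bd = M and J = J and F = "\<lambda>l k. B l (A k v)" and k = m and l = 0] J M B0 by simp
    have "nth_product \<epsilon> A n B m v = Sum_any (\<lambda>j. alt_gbinom n j *\<^sub>C
        (A (n - int j) (B (m + int j) v) - (?s * (- 1) powi n) *\<^sub>C B (m + n - int j) (A (int j) v)))"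
      using False by (simp add: nth_product_def alt_gbinom_neg)
    also have "\<dots> = (\<Sum>j<J. alt_gbinom n j *\<^sub>C
        (A (n - int j) (B (m + int j) v) - (?s * (- 1) powi n) *\<^sub>C B (m + n - int j) (A (int j) v)))"
    proof (rule Sum_any.expand_superset)
      have "alt_gbinom n j *\<^sub>C (A (n - int j) (B (m + int j) v)
          - (?s * (- 1) powi n) *\<^sub>C B (m + n - int j) (A (int j) v)) = 0" if "j \<ge> J" for j
      proof -
        have "A (int j) v = 0" "B (m + int j) v = 0" using that J by (auto intro!: M)
        then show ?thesis by (simp add: A0 B0)
      qed
      then have "j < J" if "alt_gbinom n j *\<^sub>C (A (n - int j) (B (m + int j) v)
          - (?s * (- 1) powi n) *\<^sub>C B (m + n - int j) (A (int j) v)) \<noteq> 0" for j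
        using that not_le by blast
      then show "{j. alt_gbinom n j *\<^sub>C (A (n - int j) (B (m + int j) v)
          - (?s * (- 1) powi n) *\<^sub>C B (m + n - int j) (A (int j) v)) \<noteq> 0} \<subseteq> {..<J}"
        by blast
    qed simp
    also have "\<dots> = nprod ?s A n B m v"
      unfolding nprod_def pow_left_def 1 2
      by (simp add: complex_vector.scale_sum_right complex_vector.scale_right_diff_distrib
          scaleC_scaleC sum_subtractf mult.commute mult.left_commute)
    finally show ?thesis .
  next
    case True
    define N where "N = nat n"
    have n: "n = int N" using True by (simp add: N_def)
    have big0: "alt_gbinom n j = 0" if "j > N" for j
      unfolding n alt_gbinom_nonneg using that by simp
    have sup: "{j. alt_gbinom n j *\<^sub>C X j \<noteq> 0} \<subseteq> {..N}" for X :: "nat \<Rightarrow> 'a"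
      using big0 by (auto simp: not_less[symmetric])
    have 1: "pow_right n (\<lambda>k l. A k (B l v)) 0 m = (\<Sum>j\<le>N. alt_gbinom n j *\<^sub>C A (n - int j) (B (m + int j) v))"
      unfolding pow_right_def by (subst Sum_any.expand_superset[OF _ sup]) simp_all
    have "pow_right n (\<lambda>l k. B l (A k v)) m 0 = (\<Sum>j\<le>N. alt_gbinom n j *\<^sub>C B (m + n - int j) (A (int j) v))"
      unfolding pow_right_def by (subst Sum_any.expand_superset[OF _ sup]) simp_all
    \<comment> \<open>\<open>pow_left\<close> counts powers of z, the definition counts powers of w.
      Reversing the order reconciles them, and the sign that this produces cancels the factor (-1)^n
      in \<open>pow_left\<close>.\<close>
    also have "\<dots> = (\<Sum>j\<le>N. alt_gbinom n (N - j) *\<^sub>C B (m + int j) (A (n - int j) v))"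
      by (rule sum.reindex_bij_witness[where i = "\<lambda>j. N - j" and j = "\<lambda>j. N - j"]) (auto simp: n of_nat_diff add_diff_eq)
    also have "\<dots> = (\<Sum>j\<le>N. ((- 1) powi n * alt_gbinom n j) *\<^sub>C B (m + int j) (A (n - int j) v))"
    proof (rule sum.cong[OF refl])
      fix j assume "j \<in> {..N}"
      then have j: "j \<le> N" by simp
      have "(- 1) ^ (N - j) = ((- 1) ^ N * (- 1) ^ j :: complex)"
        using j by (auto simp: minus_one_power_iff)
      then have "alt_gbinom n (N - j) = (- 1) powi n * alt_gbinom n j"
        unfolding n alt_gbinom_nonneg using j binomial_symmetric[OF j] by simp
      then show "alt_gbinom n (N - j) *\<^sub>C B (m + int j) (A (n - int j) v)
        = ((- 1) powi n * alt_gbinom n j) *\<^sub>C B (m + int j) (A (n - int j) v)" by simp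
    qed
    finally have 2: "pow_left n (\<lambda>k l. B l (A k v)) 0 m = (\<Sum>j\<le>N. alt_gbinom n j *\<^sub>C B (m + int j) (A (n - int j) v))"
      unfolding pow_left_def by (simp add: complex_vector.scale_sum_right scaleC_scaleC n)
    show ?thesis unfolding nprod_def 1 2
      by (simp add: nth_product_def n alt_gbinom_nonneg complex_vector.scale_sum_right scaleC_scaleC
          complex_vector.scale_right_diff_distrib sum_subtractf mult.commute mult.left_commute)
  qed
qed

lemma nprod_is_field:
  assumes "is_field A" "is_field B" "truncated A" "truncated B"
  shows "is_field (nprod s A n B)"
  unfolding is_field_def
proof (intro allI clinearI)
  fix m x y
  note cl = clinear_simps[OF is_fieldD[OF assms(1)]] clinear_simps[OF is_fieldD[OF assms(2)]]
  note br = bounded_right_AB[OF assms(1,4)] and bl = bounded_left_BA[OF assms(2,3)]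
  show "nprod s A n B m (x + y) = nprod s A n B m x + nprod s A n B m y"
    using pow_right_lin[OF br[of x] br[of y], of n 1 1] pow_left_lin[OF bl[of x] bl[of y], of n 1 1]
    by (simp add: nprod_def cl scaleC_one scaleC_add_right)
  fix c
  show "nprod s A n B m (c *\<^sub>C x) = c *\<^sub>C nprod s A n B m x"
    using pow_right_lin[OF br[of x] br[of x], of n c 0] pow_left_lin[OF bl[of x] bl[of x], of n c 0]
    by (simp add: nprod_def cl scaleC_scaleC complex_vector.scale_right_diff_distrib mult.commute)
qed

section \<open>Dong's lemma: arrays in three variables, the indices \<open>k\<close>,
  \<open>l\<close>, \<open>m\<close> belonging to A(x), B(y), C(z)\<close>

definition diff12 :: "(int \<Rightarrow> int \<Rightarrow> int \<Rightarrow> 'a::ab_group_add) \<Rightarrow> int \<Rightarrow> int \<Rightarrow> int \<Rightarrow> 'a"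
  where "diff12 F k l m = F (k + 1) l m - F k (l + 1) m"

definition diff13 :: "(int \<Rightarrow> int \<Rightarrow> int \<Rightarrow> 'a::ab_group_add) \<Rightarrow> int \<Rightarrow> int \<Rightarrow> int \<Rightarrow> 'a"
  where "diff13 F k l m = F (k + 1) l m - F k l (m + 1)"

definition diff23 :: "(int \<Rightarrow> int \<Rightarrow> int \<Rightarrow> 'a::ab_group_add) \<Rightarrow> int \<Rightarrow> int \<Rightarrow> int \<Rightarrow> 'a"
  where "diff23 F k l m = F k (l + 1) m - F k l (m + 1)"

lemmas diff3_defs = diff12_def diff13_def diff23_def

lemma diff3_funpow:
  "(diff12 ^^ N) F = (\<lambda>k l m. (diff_mul ^^ N) (\<lambda>k l. F k l m) k l)"
  "(diff13 ^^ N) F = (\<lambda>k l m. (diff_mul ^^ N) (\<lambda>k m. F k l m) k m)"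
  "(diff23 ^^ N) F = (\<lambda>k l m. (diff_mul ^^ N) (\<lambda>l m. F k l m) l m)"
  by (induction N) (simp_all add: fun_eq_iff diff3_defs diff_mul_def)

lemma diff3_lin:
  fixes F G :: "int \<Rightarrow> int \<Rightarrow> int \<Rightarrow> 'a::complex_vector"
  shows "(diff12 ^^ N) (\<lambda>k l m. F k l m + c *\<^sub>C G k l m) = (\<lambda>k l m. (diff12 ^^ N) F k l m + c *\<^sub>C (diff12 ^^ N) G k l m)"
    "(diff13 ^^ N) (\<lambda>k l m. F k l m + c *\<^sub>C G k l m) = (\<lambda>k l m. (diff13 ^^ N) F k l m + c *\<^sub>C (diff13 ^^ N) G k l m)"
    "(diff23 ^^ N) (\<lambda>k l m. F k l m + c *\<^sub>C G k l m) = (\<lambda>k l m. (diff23 ^^ N) F k l m + c *\<^sub>C (diff23 ^^ N) G k l m)"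
  by (induction N) (simp_all add: fun_eq_iff diff3_defs scaleC_add_right complex_vector.scale_right_diff_distrib)

lemma diff3_comm:
  "diff12 (diff13 F) = diff13 (diff12 F)" "diff12 (diff23 F) = diff23 (diff12 F)"
  "diff13 (diff23 F) = diff23 (diff13 F)"
  by (simp_all add: fun_eq_iff diff3_defs algebra_simps)

lemma diff3_diff:
  "diff12 (F - G) = diff12 F - diff12 G" "diff13 (F - G) = diff13 F - diff13 G"
  "diff23 (F - G) = diff23 F - diff23 G"
  by (simp_all add: fun_eq_iff diff3_defs)

lemma diff3_zero: "(diff12 ^^ N) (\<lambda>k l m. 0) = (\<lambda>k l m. 0)" "(diff13 ^^ N) (\<lambda>k l m. 0) = (\<lambda>k l m. 0)"
  "(diff23 ^^ N) (\<lambda>k l m. 0) = (\<lambda>k l m. 0)"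
  by (induction N) (simp_all add: fun_eq_iff diff3_defs)

text \<open>After multiplying by (y - z)^b, the array is killed by powers of x - y and of x - z,
  hence by a power of their difference y - z = (x - z) - (x - y).\<close>

lemma diff23_kill:
  fixes Z :: "int \<Rightarrow> int \<Rightarrow> int \<Rightarrow> 'a::complex_vector"
  assumes "(diff12 ^^ a) Z = (\<lambda>k l m. 0)" "(diff23 ^^ b) ((diff13 ^^ c) Z) = (\<lambda>k l m. 0)"
  shows "(diff23 ^^ (a + c + b)) Z = (\<lambda>k l m. 0)"
proof -
  define Z' where "Z' = (diff23 ^^ b) Z"
  have z: "(\<lambda>k l m. 0) = (0 :: int \<Rightarrow> int \<Rightarrow> int \<Rightarrow> 'a)" by (simp add: fun_eq_iff)
  have "(diff12 ^^ a) Z' = (diff23 ^^ b) ((diff12 ^^ a) Z)"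
    unfolding Z'_def by (rule funpow_comm) (rule diff3_comm)
  then have 1: "(diff12 ^^ a) Z' = 0"
    unfolding z[symmetric] by (simp only: assms(1) diff3_zero)
  have "(diff13 ^^ c) Z' = (diff23 ^^ b) ((diff13 ^^ c) Z)"
    unfolding Z'_def by (rule funpow_comm) (rule diff3_comm)
  then have 2: "(diff13 ^^ c) Z' = 0"
    unfolding z[symmetric] by (simp only: assms(2))
  have "((\<lambda>F. diff13 F - diff12 F) ^^ (a + c)) Z' = 0"
    by (rule funpow_diff_eq_0[OF diff3_diff(1) diff3_diff(2) diff3_comm(1) 1 2])
  moreover have "(\<lambda>F :: int \<Rightarrow> int \<Rightarrow> int \<Rightarrow> 'a. diff13 F - diff12 F) = diff23"
    by (simp add: fun_eq_iff diff3_defs)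
  ultimately have "(diff23 ^^ (a + c)) Z' = 0" by simp
  then show ?thesis unfolding Z'_def z by (simp add: funpow_add)
qed

text \<open>Multiplications by x - z and y - z are combinations of index shifts, and these commute
  with the expansion of (x - y)^n. Boundedness is carried through the iteration because each further
  step needs it.\<close>

lemma diff23_diff13_pow_right:
  assumes "\<And>m. bounded_right (\<lambda>k l. F k l m)"
  shows "(diff23 ^^ b) ((diff13 ^^ c) (\<lambda>k l m. pow_right n (\<lambda>k l. F k l m) k l))
    = (\<lambda>k l m. pow_right n (\<lambda>k l. (diff23 ^^ b) ((diff13 ^^ c) F) k l m) k l)"
proof -
  have step: "diff23 (\<lambda>k l m. pow_right n (\<lambda>k l. F k l m) k l) = (\<lambda>k l m. pow_right n (\<lambda>k l. diff23 F k l m) k l)"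
      "diff13 (\<lambda>k l m. pow_right n (\<lambda>k l. F k l m) k l) = (\<lambda>k l m. pow_right n (\<lambda>k l. diff13 F k l m) k l)"
      "\<And>m. bounded_right (\<lambda>k l. diff23 F k l m)" "\<And>m. bounded_right (\<lambda>k l. diff13 F k l m)"
    if br: "\<And>m. bounded_right (\<lambda>k l. F k l m)" for F :: "int \<Rightarrow> int \<Rightarrow> int \<Rightarrow> 'a"
  proof -
    have 0: "bounded_right (\<lambda>k l. F (k + a) (l + b) m)" for a b m
      by (rule bounded_right_shift[OF br])
    have 1: "pow_right n (\<lambda>k l. F (k + a) (l + b) m - F k l (m + 1)) k l
      = pow_right n (\<lambda>k l. F k l m) (k + a) (l + b) - pow_right n (\<lambda>k l. F k l (m + 1)) k l" for a b k l m
      using pow_right_lin[OF 0 br, of n 1 a b m "- 1" "m + 1" k l]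
        pow_right_shift[of n "\<lambda>k l. F k l m" a b k l] by (simp add: scaleC_one)
    show "diff23 (\<lambda>k l m. pow_right n (\<lambda>k l. F k l m) k l) = (\<lambda>k l m. pow_right n (\<lambda>k l. diff23 F k l m) k l)"
      "diff13 (\<lambda>k l m. pow_right n (\<lambda>k l. F k l m) k l) = (\<lambda>k l m. pow_right n (\<lambda>k l. diff13 F k l m) k l)"
      using 1[of 0 1] 1[of 1 0] by (simp_all add: fun_eq_iff diff3_defs)
    fix m
    show "bounded_right (\<lambda>k l. diff23 F k l m)" "bounded_right (\<lambda>k l. diff13 F k l m)"
      by (rule bounded_right_comb[OF 0[of 0 1 m] br[of "m + 1"]], simp add: diff3_defs)
        (rule bounded_right_comb[OF 0[of 1 0 m] br[of "m + 1"]], simp add: diff3_defs)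
  qed
  have c: "(diff13 ^^ c) (\<lambda>k l m. pow_right n (\<lambda>k l. F k l m) k l)
      = (\<lambda>k l m. pow_right n (\<lambda>k l. (diff13 ^^ c) F k l m) k l)
    \<and> (\<forall>m. bounded_right (\<lambda>k l. (diff13 ^^ c) F k l m))"
    by (induction c) (simp_all add: assms step)
  have "(diff23 ^^ b) (\<lambda>k l m. pow_right n (\<lambda>k l. (diff13 ^^ c) F k l m) k l)
      = (\<lambda>k l m. pow_right n (\<lambda>k l. (diff23 ^^ b) ((diff13 ^^ c) F) k l m) k l)
    \<and> (\<forall>m. bounded_right (\<lambda>k l. (diff23 ^^ b) ((diff13 ^^ c) F) k l m))"
    by (induction b) (simp_all add: c step)
  with c show ?thesis by simp
qed

lemma diff23_diff13_swap:
  "(diff23 ^^ b) ((diff13 ^^ c) (\<lambda>k l m. F l k m)) = (\<lambda>k l m. (diff13 ^^ b) ((diff23 ^^ c) F) l k m)"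
proof -
  have "(diff13 ^^ c) (\<lambda>k l m. F l k m) = (\<lambda>k l m. (diff23 ^^ c) F l k m)"
    by (induction c) (simp_all add: fun_eq_iff diff3_defs)
  moreover have "(diff23 ^^ b) (\<lambda>k l m. H l k m) = (\<lambda>k l m. (diff13 ^^ b) H l k m)" for H :: "int \<Rightarrow> int \<Rightarrow> int \<Rightarrow> 'a"
    by (induction b) (simp_all add: fun_eq_iff diff3_defs)
  ultimately show ?thesis by simp
qed

text \<open>Exchanging the first two variables swaps x - z with y - z and turns this expansion into
  the other one.\<close>

lemma diff23_diff13_pow_left_eq_0:
  assumes "\<And>m. bounded_left (\<lambda>k l. F k l m)" "(diff23 ^^ b) ((diff13 ^^ c) F) = (\<lambda>k l m. 0)"
  shows "(diff23 ^^ b) ((diff13 ^^ c) (\<lambda>k l m. pow_left n (\<lambda>k l. F k l m) k l)) = (\<lambda>k l m. 0)"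
proof -
  define F' where "F' = (\<lambda>l k m. F k l m)"
  have br: "\<And>m. bounded_right (\<lambda>k l. F' k l m)"
    using assms(1) by (simp add: F'_def bounded_right_iff_left)
  have "(\<lambda>k l m. (diff13 ^^ b) ((diff23 ^^ c) F') l k m) = (\<lambda>k l m. 0)"
    using assms(2) diff23_diff13_swap[of b c F'] by (simp add: F'_def)
  then have "(diff13 ^^ b) ((diff23 ^^ c) F') = (\<lambda>k l m. 0)"
    by (simp add: fun_eq_iff)
  then have 0: "(diff23 ^^ c) ((diff13 ^^ b) F') = (\<lambda>k l m. 0)"
    using funpow_comm[of diff13 diff23 b c F', OF diff3_comm(3)] by simp
  have "(diff23 ^^ c) ((diff13 ^^ b) (\<lambda>k l m. pow_right n (\<lambda>k l. F' k l m) k l)) = (\<lambda>k l m. 0)"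
    unfolding diff23_diff13_pow_right[OF br] 0 by (simp add: pow_right_def)
  then have 1: "(diff13 ^^ b) ((diff23 ^^ c) (\<lambda>k l m. pow_right n (\<lambda>k l. F' k l m) k l)) = (\<lambda>k l m. 0)"
    by (subst funpow_comm) (simp_all add: diff3_comm(3))
  have "(\<lambda>k l m. pow_left n (\<lambda>k l. F k l m) k l)
    = (\<lambda>k l m. 0 + ((- 1) powi n) *\<^sub>C pow_right n (\<lambda>k l. F' k l m) l k)"
    by (simp add: pow_left_def F'_def)
  then show ?thesis
    by (simp only: diff3_lin diff3_zero diff23_diff13_swap[of b c "\<lambda>k l m. pow_right n (\<lambda>k l. F' k l m) k l"] 1) simp
qed

lemma diff23_diff13_sum_eq_0:
  assumes "(diff23 ^^ r) X = (\<lambda>k l m. 0)" "(diff13 ^^ r) Y = (\<lambda>k l m. 0)"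
  shows "(diff23 ^^ r) ((diff13 ^^ r) (\<lambda>k l m. X k l m + c *\<^sub>C Y k l m)) = (\<lambda>k l m. 0)"
proof -
  have "(diff23 ^^ r) ((diff13 ^^ r) X) = (diff13 ^^ r) ((diff23 ^^ r) X)"
    by (rule funpow_comm) (simp add: diff3_comm(3))
  then show ?thesis
    by (simp add: diff3_lin assms diff3_zero)
qed

text \<open>The argument takes place before the residue in x is taken. There the bracket with C is
  killed by a power of x - y, by locality of A and B, and by a power of (x - z)(y - z), by locality
  of both with C. So a power of y - z alone kills it, and this survives the residue.\<close>

lemma dong:
  assumes fld: "is_field A" "is_field B" "is_field C"
    and tr: "truncated A" "truncated B" "truncated C"
    and loc: "local_modes s A B" "local_modes s1 A C" "local_modes s2 B C"
  shows "local_modes (s1 * s2) (nprod s A n B) C"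
proof -
  note cA = clinear_simps[OF is_fieldD[OF fld(1)]] and cB = clinear_simps[OF is_fieldD[OF fld(2)]]
    and cC = clinear_simps[OF is_fieldD[OF fld(3)]]
  obtain a0 where a0: "\<And>v. (diff_mul ^^ a0) (\<lambda>k l. A k (B l v) - s *\<^sub>C B l (A k v)) = (\<lambda>k l. 0)"
    using loc(1) unfolding local_modes_def by blast
  obtain b0 where b0: "\<And>v. (diff_mul ^^ b0) (\<lambda>k l. A k (C l v) - s1 *\<^sub>C C l (A k v)) = (\<lambda>k l. 0)"
    using loc(2) unfolding local_modes_def by blast
  obtain c0 where c0: "\<And>v. (diff_mul ^^ c0) (\<lambda>k l. B k (C l v) - s2 *\<^sub>C C l (B k v)) = (\<lambda>k l. 0)"
    using loc(3) unfolding local_modes_def by blast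
  define r where "r = max b0 c0"
  have AC: "(diff_mul ^^ r) (\<lambda>k l. A k (C l v) - s1 *\<^sub>C C l (A k v)) = (\<lambda>k l. 0)" for v
    by (rule diff_mul_funpow_mono[OF b0]) (simp add: r_def)
  have BC: "(diff_mul ^^ r) (\<lambda>k l. B k (C l v) - s2 *\<^sub>C C l (B k v)) = (\<lambda>k l. 0)" for v
    by (rule diff_mul_funpow_mono[OF c0]) (simp add: r_def)
  \<comment> \<open>Large enough for the locality of A and B, and at least n, so that N - n is a
    natural number K: multiplying (x - y)^n by (x - y)^K leaves the polynomial (x - y)^N.\<close>
  define N where "N = max a0 (nat n)"
  have AB: "(diff_mul ^^ N) (\<lambda>k l. A k (B l v) - s *\<^sub>C B l (A k v)) = (\<lambda>k l. 0)" for v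
    by (rule diff_mul_funpow_mono[OF a0]) (simp add: N_def)
  define K where "K = nat (int N - n)"
  have K: "n + int K = int N" unfolding K_def N_def by linarith
  note br = bounded_right_AB[OF fld(1) tr(2)] and bl = bounded_left_BA[OF fld(2) tr(1)]
  \<comment> \<open>The product of A and B before its residue is taken; at first index 0 it is
    \<open>nprod\<close>.\<close>
  define Y where "Y x = (\<lambda>k l. pow_right n (\<lambda>k l. A k (B l x)) k l - s *\<^sub>C pow_left n (\<lambda>k l. B l (A k x)) k l)" for x
  have Y0: "(diff_mul ^^ K) (Y x) = (\<lambda>k l. 0)" for x
  proof -
    have "(diff_mul ^^ K) (Y x) = (\<lambda>k l. (diff_mul ^^ N) (\<lambda>k l. A k (B l x)) k l - s *\<^sub>C (diff_mul ^^ N) (\<lambda>k l. B l (A k x)) k l)"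
      unfolding Y_def diff_mul_funpow_diff diff_mul_pow_right_funpow[OF br] diff_mul_pow_left_funpow[OF bl] K
        pow_right_nat[OF br] pow_left_nat[OF bl] ..
    also have "\<dots> = (\<lambda>k l. 0)"
      using AB[of x] unfolding diff_mul_funpow_diff .
    finally show ?thesis .
  qed
  have Ynp: "Y x 0 l = nprod s A n B l x" for x l
    by (simp add: Y_def nprod_def)
  have main: "(diff_mul ^^ (K + r + r)) (\<lambda>l m. nprod s A n B l (C m v) - (s1 * s2) *\<^sub>C C m (nprod s A n B l v)) = (\<lambda>l m. 0)" for v
  proof -
    define Z where "Z = (\<lambda>k l m. Y (C m v) k l - (s1 * s2) *\<^sub>C C m (Y v k l))"
    have 1: "(diff12 ^^ K) Z = (\<lambda>k l m. 0)"
      unfolding diff3_funpow Z_def diff_mul_funpow_diff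
        diff_mul_funpow_clinear[OF is_fieldD[OF fld(3)]] Y0 by (simp add: cC)
    define P where "P = (\<lambda>k l m. A k (B l (C m v)) - (s1 * s2) *\<^sub>C C m (A k (B l v)))"
    define Q where "Q = (\<lambda>k l m. B l (A k (C m v)) - (s1 * s2) *\<^sub>C C m (B l (A k v)))"
    have brP: "bounded_right (\<lambda>k l. P k l m)" for m
      unfolding P_def by (rule bounded_right_comb[OF br[of "C m v"] br[of v]]) (simp add: cC)
    have blQ: "bounded_left (\<lambda>k l. Q k l m)" for m
      unfolding Q_def bounded_right_iff_left
      by (rule bounded_right_comb[OF bl[of "C m v", unfolded bounded_right_iff_left]
            bl[of v, unfolded bounded_right_iff_left]]) (simp add: cC)
    have brC: "bounded_right (\<lambda>k l. C m (A k (B l v)))" for m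
      by (rule bounded_right_comb[OF br[of v] br[of v]]) (simp add: cC)
    have blC: "bounded_left (\<lambda>k l. C m (B l (A k v)))" for m
      unfolding bounded_right_iff_left
      by (rule bounded_right_comb[OF bl[of v, unfolded bounded_right_iff_left]
            bl[of v, unfolded bounded_right_iff_left]]) (simp add: cC)
    have Pp: "pow_right n (\<lambda>k l. P k l m) k l = pow_right n (\<lambda>k l. A k (B l (C m v))) k l
        - (s1 * s2) *\<^sub>C C m (pow_right n (\<lambda>k l. A k (B l v)) k l)" for k l m
      unfolding P_def pow_right_clinear[OF br is_fieldD[OF fld(3)]]
      using pow_right_lin[OF br[of "C m v"] brC[of m], of n 1 "- (s1 * s2)" k l] by (simp add: scaleC_one)
    have Qq: "pow_left n (\<lambda>k l. Q k l m) k l = pow_left n (\<lambda>k l. B l (A k (C m v))) k l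
        - (s1 * s2) *\<^sub>C C m (pow_left n (\<lambda>k l. B l (A k v)) k l)" for k l m
      unfolding Q_def pow_left_clinear[OF bl is_fieldD[OF fld(3)]]
      using pow_left_lin[OF bl[of "C m v"] blC[of m], of n 1 "- (s1 * s2)" k l] by (simp add: scaleC_one)
    have Z: "Z = (\<lambda>k l m. pow_right n (\<lambda>k l. P k l m) k l + (- s) *\<^sub>C pow_left n (\<lambda>k l. Q k l m) k l)"
      unfolding Z_def Y_def Pp Qq
      by (simp add: fun_eq_iff cC complex_vector.scale_right_diff_distrib scaleC_scaleC mult.commute mult.left_commute)
    have P0: "(diff23 ^^ r) ((diff13 ^^ r) P) = (\<lambda>k l m. 0)"
    proof -
      \<comment> \<open>C(z) moves past B(y) and then past A(x). The two errors are killed by powers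
        of y - z and of x - z respectively.\<close>
      have "P = (\<lambda>k l m. A k (B l (C m v) - s2 *\<^sub>C C m (B l v))
          + s2 *\<^sub>C (A k (C m (B l v)) - s1 *\<^sub>C C m (A k (B l v))))"
        by (simp add: P_def fun_eq_iff cA complex_vector.scale_right_diff_distrib scaleC_scaleC mult.commute)
      moreover have "(diff23 ^^ r) ((diff13 ^^ r) \<dots>) = (\<lambda>k l m. 0)"
      proof (rule diff23_diff13_sum_eq_0)
        show "(diff23 ^^ r) (\<lambda>k l m. A k (B l (C m v) - s2 *\<^sub>C C m (B l v))) = (\<lambda>k l m. 0)"
          unfolding diff3_funpow diff_mul_funpow_clinear[OF is_fieldD[OF fld(1)]] BC by (simp add: cA)
      qed (simp add: diff3_funpow AC)
      ultimately show ?thesis by simp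
    qed
    have Q0: "(diff23 ^^ r) ((diff13 ^^ r) Q) = (\<lambda>k l m. 0)"
    proof -
      have "Q = (\<lambda>k l m. s1 *\<^sub>C (B l (C m (A k v)) - s2 *\<^sub>C C m (B l (A k v)))
          + 1 *\<^sub>C B l (A k (C m v) - s1 *\<^sub>C C m (A k v)))"
        by (simp add: Q_def fun_eq_iff cB complex_vector.scale_right_diff_distrib scaleC_scaleC scaleC_one)
      moreover have "(diff23 ^^ r) ((diff13 ^^ r) \<dots>) = (\<lambda>k l m. 0)"
      proof (rule diff23_diff13_sum_eq_0)
        have "(diff23 ^^ r) (\<lambda>k l m. 0 + s1 *\<^sub>C (B l (C m (A k v)) - s2 *\<^sub>C C m (B l (A k v)))) = (\<lambda>k l m. 0)"
          unfolding diff3_lin diff3_zero by (simp add: diff3_funpow BC)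
        then show "(diff23 ^^ r) (\<lambda>k l m. s1 *\<^sub>C (B l (C m (A k v)) - s2 *\<^sub>C C m (B l (A k v)))) = (\<lambda>k l m. 0)"
          by simp
        show "(diff13 ^^ r) (\<lambda>k l m. B l (A k (C m v) - s1 *\<^sub>C C m (A k v))) = (\<lambda>k l m. 0)"
          unfolding diff3_funpow diff_mul_funpow_clinear[OF is_fieldD[OF fld(2)]] AC by (simp add: cB)
      qed
      ultimately show ?thesis by simp
    qed
    have "(diff23 ^^ r) ((diff13 ^^ r) Z) = (\<lambda>k l m. 0)"
      unfolding Z diff3_lin diff23_diff13_pow_right[OF brP] P0 diff23_diff13_pow_left_eq_0[OF blQ Q0]
      by (simp add: pow_right_def)
    from diff23_kill[OF 1 this] have "(diff23 ^^ (K + r + r)) Z = (\<lambda>k l m. 0)" .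
    \<comment> \<open>Multiplication by y - z leaves the first index alone, so the residue in x can
      be taken now by setting it to 0.\<close>
    then have "(diff_mul ^^ (K + r + r)) (\<lambda>l m. Z 0 l m) = (\<lambda>l m. 0)"
      unfolding diff3_funpow by (simp add: fun_eq_iff)
    then show ?thesis by (simp add: Z_def Ynp)
  qed
  then show ?thesis unfolding local_modes_def by blast
qed

section \<open>Translation covariance, degree and vacuum values of products\<close>

lemma nprod_translation:
  assumes fld: "is_field A" "is_field B" and tr: "truncated A" "truncated B" and T: "clinear T"
    and A: "\<And>m v. T (A m v) = A m (T v) + of_int (- m) *\<^sub>C A (m - 1) v"
    and B: "\<And>m v. T (B m v) = B m (T v) + of_int (- m) *\<^sub>C B (m - 1) v"
  shows "T (nprod s A n B m v) = nprod s A n B m (T v) + of_int (- m) *\<^sub>C nprod s A n B (m - 1) v"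
proof -
  note cA = clinear_simps[OF is_fieldD[OF fld(1)]] and cB = clinear_simps[OF is_fieldD[OF fld(2)]]
    and cT = clinear_simps[OF T]
  note br = bounded_right_AB[OF fld(1) tr(2)] and bl = bounded_left_BA[OF fld(2) tr(1)]
  let ?F = "\<lambda>k l. A k (B l v)" and ?G = "\<lambda>k l. B l (A k v)"
  let ?dF = "\<lambda>k l. of_int (- k) *\<^sub>C ?F (k - 1) l + of_int (- l) *\<^sub>C ?F k (l - 1)"
  let ?dG = "\<lambda>k l. of_int (- k) *\<^sub>C ?G (k - 1) l + of_int (- l) *\<^sub>C ?G k (l - 1)"
  have brd: "bounded_right ?dF"
    by (rule bounded_right_comb[OF bounded_right_shift[OF br[of v], of "- 1" 0] bounded_right_shift[OF br[of v], of 0 "- 1"]])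
      simp
  have bld: "bounded_left ?dG"
    unfolding bounded_right_iff_left
    by (rule bounded_right_comb[OF bounded_right_shift[OF bl[of v, unfolded bounded_right_iff_left], of "- 1" 0]
        bounded_right_shift[OF bl[of v, unfolded bounded_right_iff_left], of 0 "- 1"]]) simp
  \<comment> \<open>The commutator with \<open>T\<close> acts on A(z) B(w) as the sum of both
    derivatives, which passes through (z - w)^n. At first index 0 the z-derivative has coefficient
    0, so only the derivative in w is left.\<close>
  have 1: "T (pow_right n ?F 0 m) = pow_right n (\<lambda>k l. A k (B l (T v))) 0 m + of_int (- m) *\<^sub>C pow_right n ?F 0 (m - 1)"
  proof -
    have "T (pow_right n ?F 0 m) = pow_right n (\<lambda>k l. 1 *\<^sub>C A k (B l (T v)) + 1 *\<^sub>C ?dF k l) 0 m"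
      unfolding pow_right_clinear[OF br T]
      by (rule arg_cong[of _ _ "\<lambda>F. pow_right n F 0 m"]) (simp add: fun_eq_iff A B cA scaleC_one)
    also have "\<dots> = pow_right n (\<lambda>k l. A k (B l (T v))) 0 m + of_int (- m) *\<^sub>C pow_right n ?F 0 (m - 1)"
      unfolding pow_right_lin[OF br brd] pow_right_deriv[OF br] by (simp add: scaleC_one)
    finally show ?thesis .
  qed
  have 2: "T (pow_left n ?G 0 m) = pow_left n (\<lambda>k l. B l (A k (T v))) 0 m + of_int (- m) *\<^sub>C pow_left n ?G 0 (m - 1)"
  proof -
    have "T (pow_left n ?G 0 m) = pow_left n (\<lambda>k l. 1 *\<^sub>C B l (A k (T v)) + 1 *\<^sub>C ?dG k l) 0 m"
      unfolding pow_left_clinear[OF bl T]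
      by (rule arg_cong[of _ _ "\<lambda>F. pow_left n F 0 m"]) (simp add: fun_eq_iff A B cB scaleC_one)
    also have "\<dots> = pow_left n (\<lambda>k l. B l (A k (T v))) 0 m + of_int (- m) *\<^sub>C pow_left n ?G 0 (m - 1)"
      unfolding pow_left_lin[OF bl bld] pow_left_deriv[OF bl] by (simp add: scaleC_one)
    finally show ?thesis .
  qed
  show ?thesis
    unfolding nprod_def cT 1 2
    by (simp add: scaleC_add_right complex_vector.scale_right_diff_distrib scaleC_scaleC mult.commute)
qed

text \<open>The parameters \<open>a\<close> and \<open>b\<close> are the degrees of the fields
  lowered by 1. The degree of the product is therefore the sum of the degrees minus n + 1.\<close>

lemma nprod_degree:
  assumes fld: "is_field A" "is_field B" and tr: "truncated A" "truncated B" and D: "clinear D"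
    and A: "\<And>m v. D (A m v) = A m (D v) + (a - of_int m) *\<^sub>C A m v"
    and B: "\<And>m v. D (B m v) = B m (D v) + (b - of_int m) *\<^sub>C B m v"
  shows "D (nprod s A n B m v) = nprod s A n B m (D v) + (a + b - of_int n - of_int m) *\<^sub>C nprod s A n B m v"
proof -
  note cA = clinear_simps[OF is_fieldD[OF fld(1)]] and cB = clinear_simps[OF is_fieldD[OF fld(2)]]
    and cD = clinear_simps[OF D]
  note br = bounded_right_AB[OF fld(1) tr(2)] and bl = bounded_left_BA[OF fld(2) tr(1)]
  let ?F = "\<lambda>k l. A k (B l v)" and ?G = "\<lambda>k l. B l (A k v)"
  let ?dF = "\<lambda>k l. (a + b - of_int (k + l)) *\<^sub>C ?F k l"
  let ?dG = "\<lambda>k l. (a + b - of_int (k + l)) *\<^sub>C ?G k l"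
  have brd: "bounded_right ?dF" by (rule bounded_right_comb[OF br[of v] br[of v]]) simp
  have bld: "bounded_left ?dG"
    unfolding bounded_right_iff_left
    by (rule bounded_right_comb[OF bl[of v, unfolded bounded_right_iff_left] bl[of v, unfolded bounded_right_iff_left]]) simp
  have 1: "D (pow_right n ?F 0 m) = pow_right n (\<lambda>k l. A k (B l (D v))) 0 m
    + (a + b - of_int n - of_int m) *\<^sub>C pow_right n ?F 0 m"
  proof -
    have "D (pow_right n ?F 0 m) = pow_right n (\<lambda>k l. 1 *\<^sub>C A k (B l (D v)) + 1 *\<^sub>C ?dF k l) 0 m"
      unfolding pow_right_clinear[OF br D]
      by (rule arg_cong[of _ _ "\<lambda>F. pow_right n F 0 m"])
        (simp add: fun_eq_iff A B cA scaleC_one complex_vector.scale_left_distrib complex_vector.scale_left_diff_distrib)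
    also have "\<dots> = pow_right n (\<lambda>k l. A k (B l (D v))) 0 m + (a + b - of_int n - of_int m) *\<^sub>C pow_right n ?F 0 m"
      unfolding pow_right_lin[OF br brd] pow_right_euler[OF br] by (simp add: scaleC_one algebra_simps)
    finally show ?thesis .
  qed
  have 2: "D (pow_left n ?G 0 m) = pow_left n (\<lambda>k l. B l (A k (D v))) 0 m
    + (a + b - of_int n - of_int m) *\<^sub>C pow_left n ?G 0 m"
  proof -
    have "D (pow_left n ?G 0 m) = pow_left n (\<lambda>k l. 1 *\<^sub>C B l (A k (D v)) + 1 *\<^sub>C ?dG k l) 0 m"
      unfolding pow_left_clinear[OF bl D]
      by (rule arg_cong[of _ _ "\<lambda>F. pow_left n F 0 m"])
        (simp add: fun_eq_iff A B cB scaleC_one complex_vector.scale_left_distrib complex_vector.scale_left_diff_distrib)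
    also have "\<dots> = pow_left n (\<lambda>k l. B l (A k (D v))) 0 m + (a + b - of_int n - of_int m) *\<^sub>C pow_left n ?G 0 m"
      unfolding pow_left_lin[OF bl bld] pow_left_euler[OF bl] by (simp add: scaleC_one algebra_simps)
    finally show ?thesis .
  qed
  show ?thesis
    unfolding nprod_def cD 1 2
    by (simp add: scaleC_add_right complex_vector.scale_right_diff_distrib scaleC_scaleC mult.commute)
qed

text \<open>The expansion in |w| > |z| contains only nonnegative modes of A applied to the vacuum
  and drops out. In the other one, at index -1, every term after j = 0 has a nonnegative mode of B
  on the vacuum.\<close>

lemma nprod_vacuum:
  assumes fld: "is_field A" "is_field B"
    and \<Omega>: "\<And>m. m \<ge> 0 \<Longrightarrow> A m \<Omega> = 0" "\<And>m. m \<ge> 0 \<Longrightarrow> B m \<Omega> = 0"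
  shows "m \<ge> 0 \<Longrightarrow> nprod s A n B m \<Omega> = 0" "nprod s A n B (- 1) \<Omega> = A n (B (- 1) \<Omega>)"
proof -
  note cA = clinear_simps[OF is_fieldD[OF fld(1)]] and cB = clinear_simps[OF is_fieldD[OF fld(2)]]
  have 1: "pow_left n (\<lambda>k l. B l (A k \<Omega>)) 0 m = 0" for m
    unfolding pow_left_def pow_right_def by (simp add: \<Omega> cB)
  show "m \<ge> 0 \<Longrightarrow> nprod s A n B m \<Omega> = 0"
    unfolding nprod_def 1 unfolding pow_right_def by (simp add: \<Omega> cA)
  have "pow_right n (\<lambda>k l. A k (B l \<Omega>)) 0 (- 1) = (\<Sum>j<1. alt_gbinom n j *\<^sub>C A (0 + n - int j) (B (- 1 + int j) \<Omega>))"
    by (rule pow_right_eq_sum[where bd = 0]) (simp_all add: \<Omega> cA)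
  then show "nprod s A n B (- 1) \<Omega> = A n (B (- 1) \<Omega>)"
    unfolding nprod_def 1 by (simp add: scaleC_one)
qed

section \<open>Locality as an identity of formal distributions\<close>

definition lterm :: "(int \<Rightarrow> int \<Rightarrow> complex) \<Rightarrow> complex \<Rightarrow> complex \<Rightarrow> int \<times> int \<Rightarrow> complex"
  where "lterm f z w = (\<lambda>(m, n). f m n * z powi (- m - 1) * w powi (- n - 1))"

lemma lterm_swap: "(lterm (\<lambda>k l. f l k) w z has_sum S) UNIV \<longleftrightarrow> (lterm f z w has_sum S) UNIV"
proof -
  have "(\<lambda>(x, y). lterm (\<lambda>k l. f l k) w z (y, x)) = lterm f z w"
    by (auto simp: lterm_def fun_eq_iff)
  then show ?thesis
    using has_sum_swap[where f = "lterm (\<lambda>k l. f l k) w z" and S = S and A = UNIV and B = UNIV] by simp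
qed

lemma lterm_diff:
  assumes "(lterm f z w has_sum S) UNIV" "(lterm g z w has_sum T) UNIV"
  shows "(lterm (\<lambda>k l. f k l - g k l) z w has_sum (S - T)) UNIV"
proof -
  have "lterm (\<lambda>k l. f k l - g k l) z w = (\<lambda>x. lterm f z w x + (- 1) * lterm g z w x)"
    by (auto simp: lterm_def fun_eq_iff algebra_simps)
  then show ?thesis using has_sum_add[OF assms(1) has_sum_cmult_right[OF assms(2), of "- 1"]] by simp
qed

lemma lterm_diff_mul:
  assumes "(lterm f z w has_sum S) UNIV" "z \<noteq> 0" "w \<noteq> 0"
  shows "(lterm (diff_mul f) z w has_sum ((z - w) * S)) UNIV"
proof -
  have 1: "(lterm (\<lambda>k l. f (k + 1) l) z w has_sum (z * S)) UNIV"
  proof -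
    have "((\<lambda>x. z * lterm f z w x) has_sum (z * S)) UNIV"
      by (rule has_sum_cmult_right[OF assms(1)])
    also have "?this \<longleftrightarrow> (lterm (\<lambda>k l. f (k + 1) l) z w has_sum (z * S)) UNIV"
    proof (rule has_sum_reindex_bij_witness[where i = "\<lambda>(m, n). (m + 1, n)" and j = "\<lambda>(m, n). (m - 1, n)"])
      fix x :: "int \<times> int"
      obtain m n where x: "x = (m, n)" by (cases x)
      have "z powi (- m) = z * z powi (- m - 1)"
        using power_int_add[of z 1 "- m - 1"] assms(2) by simp
      then show "lterm (\<lambda>k l. f (k + 1) l) z w (case x of (m, n) \<Rightarrow> (m - 1, n)) = z * lterm f z w x"
        by (simp add: x lterm_def)
    qed auto
    finally show ?thesis .
  qed
  have 2: "(lterm (\<lambda>k l. f k (l + 1)) z w has_sum (w * S)) UNIV"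
  proof -
    have "((\<lambda>x. w * lterm f z w x) has_sum (w * S)) UNIV"
      by (rule has_sum_cmult_right[OF assms(1)])
    also have "?this \<longleftrightarrow> (lterm (\<lambda>k l. f k (l + 1)) z w has_sum (w * S)) UNIV"
    proof (rule has_sum_reindex_bij_witness[where i = "\<lambda>(m, n). (m, n + 1)" and j = "\<lambda>(m, n). (m, n - 1)"])
      fix x :: "int \<times> int"
      obtain m n where x: "x = (m, n)" by (cases x)
      have "w powi (- n) = w * w powi (- n - 1)"
        using power_int_add[of w 1 "- n - 1"] assms(3) by simp
      then show "lterm (\<lambda>k l. f k (l + 1)) z w (case x of (m, n) \<Rightarrow> (m, n - 1)) = w * lterm f z w x"
        by (simp add: x lterm_def)
    qed auto
    finally show ?thesis .
  qed
  from lterm_diff[OF 1 2] show ?thesis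
    by (simp add: diff_mul_def[abs_def] left_diff_distrib)
qed

lemma lterm_diff_mul_funpow:
  assumes "(lterm f z w has_sum S) UNIV" "z \<noteq> 0" "w \<noteq> 0"
  shows "(lterm ((diff_mul ^^ N) f) z w has_sum ((z - w) ^ N * S)) UNIV"
proof (induction N)
  case (Suc N)
  from lterm_diff_mul[OF this assms(2,3)] show ?case by (simp add: mult.assoc)
qed (simp add: assms)

lemma geometric_has_sum:
  fixes z w :: complex
  assumes "norm w < norm z"
  shows "((\<lambda>j. w ^ j / z ^ (j + 1)) has_sum (1 / (z - w))) UNIV"
    and "((\<lambda>j. norm (w ^ j / z ^ (j + 1))) has_sum (1 / (norm z - norm w))) UNIV"
proof -
  have z: "z \<noteq> 0" using assms by auto
  have "(1 - w / z) * z = z - w" "(1 - norm w / norm z) * norm z = norm z - norm w"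
    using z by (simp_all add: left_diff_distrib)
  then have zw: "1 / (1 - w / z) / z = 1 / (z - w)"
      "1 / (1 - norm w / norm z) / norm z = 1 / (norm z - norm w)"
    by (metis divide_divide_eq_left)+
  have "norm (w / z) < 1" using assms z by (simp add: norm_divide)
  from geometric_sums[OF this] have "(\<lambda>j. (w / z) ^ j / z) sums (1 / (1 - w / z) / z)"
    by (rule sums_divide)
  then have 1: "(\<lambda>j. w ^ j / z ^ (j + 1)) sums (1 / (z - w))"
    unfolding zw by (simp add: power_divide mult.commute)
  have "norm (norm w / norm z) < 1" using assms z by simp
  from geometric_sums[OF this]
  have "(\<lambda>j. (norm w / norm z) ^ j / norm z) sums (1 / (1 - norm w / norm z) / norm z)"
    by (rule sums_divide)
  then have 2: "(\<lambda>j. norm (w ^ j / z ^ (j + 1))) sums (1 / (norm z - norm w))"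
    unfolding zw by (simp add: power_divide mult.commute norm_divide norm_mult norm_power)
  show "((\<lambda>j. norm (w ^ j / z ^ (j + 1))) has_sum (1 / (norm z - norm w))) UNIV"
    by (rule sums_nonneg_imp_has_sum[OF 2]) simp
  show "((\<lambda>j. w ^ j / z ^ (j + 1)) has_sum (1 / (z - w))) UNIV"
    by (rule norm_summable_imp_has_sum[OF sums_summable[OF 2] 1])
qed

lemma bounded_right_diff_mul_funpow: "bounded_right F \<Longrightarrow> bounded_right ((diff_mul ^^ N) F)"
  by (induction N) (simp_all add: bounded_right_diff_mul)

lemma bounded_left_diff_mul:
  assumes "bounded_left F"
  shows "bounded_left (diff_mul F)"
proof -
  obtain bd where "\<And>k l. k \<ge> bd \<Longrightarrow> F k l = 0"
    using assms unfolding bounded_left_def by blast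
  then show ?thesis
    unfolding bounded_left_def diff_mul_def by (intro exI[of _ bd]) simp
qed

lemma bounded_left_diff_mul_funpow: "bounded_left F \<Longrightarrow> bounded_left ((diff_mul ^^ N) F)"
  by (induction N) (simp_all add: bounded_left_diff_mul)

text \<open>Division by \<open>z - w\<close>: multiply by the geometric series of \<open>1 / (z - w)\<close> and collect
  coefficients; the sums over the fibres telescope.\<close>

lemma lterm_divide:
  assumes sum: "(lterm (diff_mul f) z w has_sum H) UNIV"
    and w: "w \<noteq> 0" "norm w < norm z" and br: "bounded_right f"
  shows "(lterm f z w has_sum (H / (z - w))) UNIV"
proof -
  have z: "z \<noteq> 0" using w by auto
  define h where "h = diff_mul f"
  define g :: "nat \<Rightarrow> complex" where "g j = w ^ j / z ^ (j + 1)" for j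
  let ?G = "\<lambda>(x, j). lterm h z w x * g j"
  have g: "(g has_sum (1 / (z - w))) UNIV" "((\<lambda>j. norm (g j)) has_sum (1 / (norm z - norm w))) UNIV"
    unfolding g_def using geometric_has_sum[OF w(2)] by simp_all
  have abs: "(\<lambda>x. norm (lterm h z w x)) summable_on UNIV"
    using has_sum_imp_summable[OF sum] summable_on_iff_abs_summable_on_complex unfolding h_def by blast
  \<comment> \<open>Absolute summability of the whole family is what permits regrouping it in two
    different ways.\<close>
  have "(\<lambda>p. norm (?G p)) summable_on (UNIV \<times> UNIV)"
  proof (rule summable_on_SigmaI)
    fix x
    show "((\<lambda>j. norm (?G (x, j))) has_sum (norm (lterm h z w x) * (1 / (norm z - norm w)))) UNIV"
      using has_sum_cmult_right[OF g(2), of "norm (lterm h z w x)"] by (simp add: norm_mult)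
  next
    show "(\<lambda>x. norm (lterm h z w x) * (1 / (norm z - norm w))) summable_on UNIV"
      by (rule summable_on_cmult_left[OF abs])
  qed simp
  then have summ: "?G summable_on (UNIV \<times> UNIV)"
    by (rule abs_summable_summable)
  have "(?G has_sum (H * (1 / (z - w)))) (UNIV \<times> UNIV)"
  proof (rule has_sum_SigmaI[OF _ _ summ])
    fix x
    show "((\<lambda>j. ?G (x, j)) has_sum (lterm h z w x * (1 / (z - w)))) UNIV"
      using has_sum_cmult_right[OF g(1), of "lterm h z w x"] by simp
  next
    show "((\<lambda>x. lterm h z w x * (1 / (z - w))) has_sum (H * (1 / (z - w)))) UNIV"
      using has_sum_cmult_left[OF sum, of "1 / (z - w)"] by (simp add: h_def)
  qed
  \<comment> \<open>The reindexing collects, over each pair (m, n), all products that contribute to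
    z^(-m-1) w^(-n-1).\<close>
  also have "(?G has_sum (H * (1 / (z - w)))) (UNIV \<times> UNIV)
    \<longleftrightarrow> ((\<lambda>(x, j). h (fst x - 1 - int j) (snd x + int j) * (z powi (- fst x - 1) * w powi (- snd x - 1)))
        has_sum (H * (1 / (z - w)))) (UNIV \<times> UNIV)"
  proof (rule has_sum_reindex_bij_witness[where
        i = "\<lambda>((m, n), j). ((m - 1 - int j, n + int j), j)" and j = "\<lambda>((m, n), j). ((m + 1 + int j, n - int j), j)"])
    fix p :: "(int \<times> int) \<times> nat"
    obtain m n j where p: "p = ((m, n), j)" by (metis prod.exhaust)
    have e1: "z powi (- (m + 1 + int j) - 1) = z powi (- m - 1) / z ^ (j + 1)"
      using power_int_diff[of z "- m - 1" "int (j + 1)"] z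
      by (simp only: power_int_of_nat) (simp add: algebra_simps)
    have e2: "w powi (- (n - int j) - 1) = w powi (- n - 1) * w ^ j"
      using power_int_add[of w "- n - 1" "int j"] w(1)
      by (simp only: power_int_of_nat) (simp add: algebra_simps)
    have idx: "m + 1 + int j - 1 - int j = m" "n - int j + int j = n" by simp_all
    show "(\<lambda>(x, j). h (fst x - 1 - int j) (snd x + int j) * (z powi (- fst x - 1) * w powi (- snd x - 1)))
        ((\<lambda>((m, n), j). ((m + 1 + int j, n - int j), j)) p) = ?G p"
      unfolding p lterm_def g_def prod.case fst_conv snd_conv idx e1 e2
      by (simp only: times_divide_eq_left times_divide_eq_right mult_ac)
  qed auto
  finally have "((\<lambda>(x, j). h (fst x - 1 - int j) (snd x + int j) * (z powi (- fst x - 1) * w powi (- snd x - 1)))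
        has_sum (H * (1 / (z - w)))) (UNIV \<times> UNIV)" .
  then have "(lterm f z w has_sum (H * (1 / (z - w)))) UNIV"
  proof (rule has_sum_Sigma')
    fix x :: "int \<times> int"
    obtain m n where x: "x = (m, n)" by (cases x)
    obtain bd where bd: "\<And>k l. l \<ge> bd \<Longrightarrow> f k l = 0"
      using br unfolding bounded_right_def by blast
    define J where "J = nat (bd - n)"
    \<comment> \<open>The fibre runs along an antidiagonal, where \<open>h\<close> is a difference
      of consecutive values of \<open>f\<close>; boundedness removes the far end of the
      telescope.\<close>
    have "(\<Sum>j<i. h (m - 1 - int j) (n + int j)) = f m n - f (m - int i) (n + int i)" for i
      by (induction i) (simp_all add: h_def diff_mul_def algebra_simps)
    moreover have "f (m - int J) (n + int J) = 0" by (rule bd) (simp add: J_def)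
    ultimately have tele: "(\<Sum>j<J. h (m - 1 - int j) (n + int j)) = f m n" by simp
    have "((\<lambda>j. h (m - 1 - int j) (n + int j)) has_sum f m n) UNIV"
    proof (rule has_sum_finite_neutralI[of "{..<J}"])
      fix j assume "j \<in> UNIV - {..<J}"
      then show "h (m - 1 - int j) (n + int j) = 0"
        by (simp add: h_def diff_mul_def bd J_def)
    qed (simp_all add: tele)
    from has_sum_cmult_left[OF this, of "z powi (- m - 1) * w powi (- n - 1)"]
    show "((\<lambda>j. (\<lambda>(x, j). h (fst x - 1 - int j) (snd x + int j) * (z powi (- fst x - 1) * w powi (- snd x - 1))) (x, j))
        has_sum lterm f z w x) UNIV"
      by (simp add: x lterm_def mult.assoc)
  qed
  then show ?thesis by simp
qed

lemma lterm_divide_funpow: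
  assumes "(lterm ((diff_mul ^^ N) f) z w has_sum H) UNIV" "w \<noteq> 0" "norm w < norm z" "bounded_right f"
  shows "(lterm f z w has_sum (H / (z - w) ^ N)) UNIV"
  using assms
proof (induction N arbitrary: f)
  case (Suc N)
  have "(lterm (diff_mul f) z w has_sum (H / (z - w) ^ N)) UNIV"
    by (rule Suc.IH) (use Suc.prems bounded_right_diff_mul[OF Suc.prems(4)] in \<open>simp_all add: funpow_swap1\<close>)
  from lterm_divide[OF this Suc.prems(2-4)] show ?case by (simp add: mult.commute)
qed simp

lemma lterm_divide_left_funpow:
  assumes "(lterm ((diff_mul ^^ N) f) z w has_sum H) UNIV" "z \<noteq> 0" "norm z < norm w" "bounded_left f"
  shows "(lterm f z w has_sum (H / (z - w) ^ N)) UNIV"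
  using assms
proof (induction N arbitrary: f)
  case (Suc N)
  have "(lterm (diff_mul f) z w has_sum (H / (z - w) ^ N)) UNIV"
    by (rule Suc.IH) (use Suc.prems bounded_left_diff_mul[OF Suc.prems(4)] in \<open>simp_all add: funpow_swap1\<close>)
  then have "(lterm (\<lambda>k l. diff_mul f l k) w z has_sum (H / (z - w) ^ N)) UNIV"
    by (rule lterm_swap[where f = "diff_mul f", THEN iffD2])
  then have "((\<lambda>x. (- 1) * lterm (\<lambda>k l. diff_mul f l k) w z x) has_sum ((- 1) * (H / (z - w) ^ N))) UNIV"
    by (rule has_sum_cmult_right)
  also have "(\<lambda>x. (- 1) * lterm (\<lambda>k l. diff_mul f l k) w z x) = lterm (diff_mul (\<lambda>k l. f l k)) w z"
    by (auto simp: fun_eq_iff lterm_def diff_mul_def algebra_simps)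
  finally have "(lterm (\<lambda>k l. f l k) w z has_sum ((- 1) * (H / (z - w) ^ N) / (w - z))) UNIV"
    using Suc.prems(2-4) by (intro lterm_divide) (simp_all add: bounded_right_iff_left)
  also have "(- 1) * (H / (z - w) ^ N) / (w - z) = H / (z - w) ^ Suc N"
    by (simp add: divide_simps) (simp add: algebra_simps)
  finally show ?case by (rule lterm_swap[where f = f, THEN iffD1])
qed simp

section \<open>Uniqueness of Laurent expansions in one and two variables\<close>

lemma laurent_series_unique:
  fixes g :: "int \<Rightarrow> complex"
  assumes bd: "\<And>n. n \<ge> bd \<Longrightarrow> g n = 0" and R: "R > 0"
    and sum: "\<And>w. w \<noteq> 0 \<Longrightarrow> norm w < R \<Longrightarrow> ((\<lambda>n. g n * w powi (- n - 1)) has_sum 0) UNIV"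
  shows "g n = 0"
proof -
  \<comment> \<open>Multiplying by w^bd turns the Laurent series into the power series with these
    coefficients.\<close>
  define b where "b k = g (bd - 1 - int k)" for k
  have b: "(\<lambda>k. b k * w ^ k) sums 0" if w: "w \<noteq> 0" "norm w < R" for w
  proof -
    have "((\<lambda>n. g n * w powi (- n - 1)) has_sum 0) {..<bd}"
      using sum[OF w] by (rule has_sum_cong_neutral[THEN iffD1, rotated -1]) (auto simp: bd)
    also have "?this \<longleftrightarrow> ((\<lambda>k. b k * w powi (- (bd - 1 - int k) - 1)) has_sum 0) UNIV"
      by (rule has_sum_reindex_bij_witness[where i = "\<lambda>k. bd - 1 - int k" and j = "\<lambda>n. nat (bd - 1 - n)"])
        (auto simp: b_def)
    finally have "((\<lambda>k. (b k * w powi (- (bd - 1 - int k) - 1)) * w powi bd) has_sum (0 * w powi bd)) UNIV"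
      by (rule has_sum_cmult_left)
    also have "(\<lambda>k. (b k * w powi (- (bd - 1 - int k) - 1)) * w powi bd) = (\<lambda>k. b k * w ^ k)"
    proof
      fix k
      have "w powi (- (bd - 1 - int k) - 1) * w powi bd = w ^ k"
        using power_int_add[of w "int k - bd" bd] w(1) by simp
      then show "(b k * w powi (- (bd - 1 - int k) - 1)) * w powi bd = b k * w ^ k" by simp
    qed
    finally show ?thesis by (simp add: has_sum_imp_sums)
  qed
  have b0: "b k = 0" for k
  proof (induction k rule: less_induct)
    case (less K)
    \<comment> \<open>Once the lower coefficients vanish, w^K can be divided out. The value w = 0 is
      excluded, so the next coefficient is obtained as a limit at 0 and not by evaluation.\<close>
    have "(\<lambda>k. b (k + K) * w ^ k) sums 0" if w: "w \<noteq> 0" "norm w < R" for w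
    proof -
      have "(\<lambda>k. b (k + K) * w ^ (k + K)) sums (0 - (\<Sum>i<K. b i * w ^ i))"
        using b[OF w] by (subst sums_iff_shift) simp
      then have "(\<lambda>k. b (k + K) * w ^ (k + K) * (1 / w ^ K)) sums (0 * (1 / w ^ K))"
        using less.IH by (intro sums_mult2) simp
      then show ?thesis using w(1) by (simp add: power_add)
    qed
    then have "((\<lambda>_. 0) \<longlongrightarrow> b (0 + K)) (at (0::complex))"
      by (rule powser_limit_0_strong[OF R])
    then have "b K = 0"
      using tendsto_unique[OF _ tendsto_const, of "at (0::complex)"] by (simp add: tendsto_const_iff)
    then show ?case .
  qed
  show ?thesis
  proof (cases "n \<ge> bd")
    case False
    then show ?thesis using b0[of "nat (bd - 1 - n)"] by (simp add: b_def)
  qed (rule bd)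
qed

text \<open>For fixed z this is a Laurent series in w whose coefficients are finite sums in z, hence
  all zero; each of these is then a Laurent polynomial in z that vanishes for all nonzero z.\<close>

lemma lterm_unique:
  assumes br: "bounded_right f" and fin: "\<And>n. finite {m. f m n \<noteq> 0}"
    and sum: "\<And>z w. w \<noteq> 0 \<Longrightarrow> norm w < norm z \<Longrightarrow> (lterm f z w has_sum 0) UNIV"
  shows "f m n = 0"
proof -
  obtain bd where bd: "\<And>k l. l \<ge> bd \<Longrightarrow> f k l = 0"
    using br unfolding bounded_right_def by blast
  define g where "g z n = (\<Sum>m | f m n \<noteq> 0. f m n * z powi (- m - 1))" for z n
  have gsum: "((\<lambda>m. f m n * z powi (- m - 1)) has_sum g z n) UNIV" for z n
    unfolding g_def by (rule has_sum_finite_neutralI[OF fin]) auto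
  have "g z n = 0" if z: "z \<noteq> 0" for z n
  proof (rule laurent_series_unique[where R = "norm z" and bd = bd])
    fix w :: complex assume w: "w \<noteq> 0" "norm w < norm z"
    have "((\<lambda>(x, y). lterm f z w (y, x)) has_sum 0) (UNIV \<times> UNIV)"
      using sum[OF w] has_sum_swap[where f = "lterm f z w" and S = 0 and A = UNIV and B = UNIV] by simp
    then show "((\<lambda>n. g z n * w powi (- n - 1)) has_sum 0) UNIV"
    proof (rule has_sum_Sigma')
      fix n
      show "((\<lambda>m. (\<lambda>(x, y). lterm f z w (y, x)) (n, m)) has_sum (g z n * w powi (- n - 1))) UNIV"
        using has_sum_cmult_left[OF gsum[where z = z and n = n], of "w powi (- n - 1)"] by (simp add: lterm_def)
    qed
  qed (use z in \<open>simp_all add: g_def bd\<close>)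
  then have sum0: "((\<lambda>m. f m n * z powi (- m - 1)) has_sum 0) UNIV" if "z \<noteq> 0" for z
    using gsum[where z = z and n = n] that by simp
  obtain M where M: "\<forall>m\<in>{m. f m n \<noteq> 0}. m \<le> M"
    using fin[of n] by (meson bdd_above.unfold bdd_above_finite)
  show ?thesis
  proof (rule laurent_series_unique[where g = "\<lambda>m. f m n" and bd = "M + 1" and R = 1])
    fix m assume "m \<ge> M + 1"
    then have "\<not> m \<le> M" by simp
    then show "f m n = 0" using M by blast
  qed (simp_all add: sum0)
qed

text \<open>Laurent polynomials are the arrays of finite support, with exponents i = - m - 1 and j =
  - n - 1.\<close>

lemma lterm_finite:
  assumes "finite {(m, n). q m n \<noteq> 0}"
  obtains P where "P \<in> laurent_poly2" "\<And>z w. (lterm q z w has_sum P z w) UNIV"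
proof -
  define S where "S = {(m, n). q m n \<noteq> 0}"
  define F where "F = (\<lambda>(m, n). (- m - 1, - n - 1)) ` S"
  define P where "P = (\<lambda>z w :: complex. \<Sum>(i, j)\<in>F. (\<lambda>(i, j). q (- i - 1) (- j - 1)) (i, j) * z powi i * w powi j)"
  have "finite F" using assms by (simp add: F_def S_def)
  then have "P \<in> laurent_poly2" unfolding P_def laurent_poly2_def by blast
  moreover have "(lterm q z w has_sum P z w) UNIV" for z w
  proof (rule has_sum_finite_neutralI[of S])
    have "inj_on (\<lambda>(m, n). (- m - 1, - n - 1)) S" by (auto simp: inj_on_def)
    then show "P z w = sum (lterm q z w) S"
      unfolding P_def F_def
      by (subst sum.reindex) (auto simp: lterm_def intro!: sum.cong)
  qed (use assms in \<open>auto simp: S_def lterm_def\<close>)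
  ultimately show ?thesis using that by blast
qed

lemma laurent_poly2_lterm:
  assumes "P \<in> laurent_poly2"
  obtains q where "finite {(m, n). q m n \<noteq> 0}" "\<And>z w. (lterm q z w has_sum P z w) UNIV"
proof -
  obtain F :: "(int \<times> int) set" and a where F: "finite F"
    and P: "P = (\<lambda>z w. \<Sum>(i, j)\<in>F. a (i, j) * z powi i * w powi j)"
    using assms unfolding laurent_poly2_def by blast
  define q where "q m n = (if (- m - 1, - n - 1) \<in> F then a (- m - 1, - n - 1) else 0)" for m n
  define S where "S = (\<lambda>(i, j). (- i - 1, - j - 1)) ` F"
  have S: "finite S" using F by (simp add: S_def)
  have qS: "q m n = 0" if "(m, n) \<notin> S" for m n
    using that by (force simp: q_def S_def)
  have "finite {(m, n). q m n \<noteq> 0}"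
    by (rule finite_subset[OF _ S]) (use qS in auto)
  moreover have "(lterm q z w has_sum P z w) UNIV" for z w
  proof (rule has_sum_finite_neutralI[of S])
    have "inj_on (\<lambda>(m, n). (- m - 1, - n - 1)) F" by (auto simp: inj_on_def)
    then show "P z w = sum (lterm q z w) S"
      unfolding P S_def
      by (subst sum.reindex) (auto simp: lterm_def q_def intro!: sum.cong)
  qed (use S qS in \<open>auto simp: lterm_def\<close>)
  ultimately show ?thesis using that by blast
qed

lemma finite_columns_diff_mul_funpow:
  assumes "\<And>n. finite {m. f m n \<noteq> (0 :: complex)}"
  shows "finite {m. (diff_mul ^^ N) f m n \<noteq> 0}"
proof (induction N arbitrary: n)
  case (Suc N)
  have "{m. (diff_mul ^^ Suc N) f m n \<noteq> 0}
    \<subseteq> (\<lambda>m. m - 1) ` {m. (diff_mul ^^ N) f m n \<noteq> 0} \<union> {m. (diff_mul ^^ N) f m (n + 1) \<noteq> 0}"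
  proof
    fix m assume "m \<in> {m. (diff_mul ^^ Suc N) f m n \<noteq> 0}"
    then have "(diff_mul ^^ N) f (m + 1) n \<noteq> 0 \<or> (diff_mul ^^ N) f m (n + 1) \<noteq> 0"
      by (auto simp: diff_mul_def)
    then show "m \<in> (\<lambda>m. m - 1) ` {m. (diff_mul ^^ N) f m n \<noteq> 0} \<union> {m. (diff_mul ^^ N) f m (n + 1) \<noteq> 0}"
      by (auto intro!: image_eqI[of _ _ "m + 1"])
  qed
  then show ?case by (rule finite_subset) (simp add: Suc.IH)
qed (simp add: assms)

lemma diff_mul_funpow_sub:
  fixes F G :: "int \<Rightarrow> int \<Rightarrow> complex"
  shows "(diff_mul ^^ N) (\<lambda>k l. F k l - G k l) = (\<lambda>k l. (diff_mul ^^ N) F k l - (diff_mul ^^ N) G k l)"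
  by (induction N) (simp_all add: fun_eq_iff diff_mul_def)

lemma diff_mul_funpow_swap_complex:
  fixes g :: "int \<Rightarrow> int \<Rightarrow> complex"
  shows "(diff_mul ^^ N) (\<lambda>k l. g l k) = (\<lambda>k l. (- 1) ^ N * (diff_mul ^^ N) g l k)"
proof (induction N)
  case (Suc N)
  then show ?case by (simp add: fun_eq_iff diff_mul_def right_diff_distrib)
qed simp

lemma cinner_simps:
  "cinner (x - y) z = cinner x z - cinner y z" "cinner 0 z = 0" "cinner z 0 = 0"
  "cinner z (x + y) = cinner z x + cinner z y" "cinner z (c *\<^sub>C y) = cnj c * cinner z y"
proof -
  show 0: "cinner 0 z = 0" for z :: 'a
    using cinner_add_left[of 0 0 z] by simp
  have "cinner (x - y) z + cinner y z = cinner x z"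
    by (simp flip: cinner_add_left)
  then show "cinner (x - y) z = cinner x z - cinner y z" by (simp add: algebra_simps)
  show "cinner z 0 = 0" using 0[of z] cinner_commute[of z 0] by simp
  show "cinner z (x + y) = cinner z x + cinner z y"
    using cinner_commute[of z "x + y"] cinner_commute[of z x] cinner_commute[of z y] by (simp add: cinner_add_left)
  show "cinner z (c *\<^sub>C y) = cnj c * cinner z y"
    using cinner_commute[of z "c *\<^sub>C y"] cinner_commute[of z y] by (simp add: cinner_scaleC_left)
qed

lemma cinner_eq_0I: "(\<And>d. cinner x d = 0) \<Longrightarrow> x = 0"
  using cinner_pos[of x] by force

lemma diff_mul_funpow_cinner:
  "(diff_mul ^^ N) (\<lambda>k l. cinner (F k l) d) = (\<lambda>k l. cinner ((diff_mul ^^ N) F k l) d)"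
  by (induction N) (simp_all add: fun_eq_iff diff_mul_def cinner_simps)

section \<open>Equivalence of analytic and formal locality\<close>

definition matrix_bounded :: "'h::prehilbert modes \<Rightarrow> 'h modes \<Rightarrow> bool"
  where "matrix_bounded A B \<longleftrightarrow> (\<forall>c d. \<exists>b. \<forall>m n. m + n < b \<longrightarrow> cinner (A m (B n c)) d = 0)"

text \<open>In a fixed column, truncation bounds \<open>m\<close> above and matrix boundedness
  bounds it below.\<close>

lemma matrix_bounded_finite_columns:
  assumes "truncated A" "matrix_bounded A B"
  shows "finite {m. cinner (A m (B n c)) d \<noteq> 0}"
proof -
  obtain b where b: "\<And>m n. m + n < b \<Longrightarrow> cinner (A m (B n c)) d = 0"
    using assms(2) unfolding matrix_bounded_def by blast
  obtain M where M: "\<And>m. m \<ge> M \<Longrightarrow> A m (B n c) = 0"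
    using assms(1) unfolding truncated_def by blast
  have "{m. cinner (A m (B n c)) d \<noteq> 0} \<subseteq> {b - n..M}"
  proof
    fix m assume "m \<in> {m. cinner (A m (B n c)) d \<noteq> 0}"
    then have "\<not> m + n < b" "\<not> m \<ge> M" using b M cinner_simps(2) by force+
    then show "m \<in> {b - n..M}" by simp
  qed
  then show ?thesis by (rule finite_subset) simp
qed

text \<open>After multiplication by (z - w)^N, both orders sum to the same Laurent polynomial, each
  on its own domain. Uniqueness of expansions identifies the coefficients of both with those of that
  polynomial, and the difference is then orthogonal to every \<open>d\<close>.\<close>

lemma local_with_sign_imp_local_modes:
  assumes fld: "is_field A" "is_field B" and tr: "truncated A" "truncated B"
    and mb: "matrix_bounded A B" "matrix_bounded B A"
    and loc: "local_with_sign \<epsilon> A B"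
  shows "local_modes (parity_sign \<epsilon>) A B"
proof -
  let ?s = "parity_sign \<epsilon>"
  obtain N where N: "\<And>c d. \<exists>X\<in>diag_pole_functions N.
      (\<forall>z w. w \<noteq> 0 \<and> norm w < norm z \<longrightarrow>
        ((\<lambda>(m, n). cinner (A m (B n c)) d * z powi (- m - 1) * w powi (- n - 1)) has_sum X z w) UNIV) \<and>
      (\<forall>z w. z \<noteq> 0 \<and> norm z < norm w \<longrightarrow>
        ((\<lambda>(m, n). ?s * (cinner (B n (A m c)) d * z powi (- m - 1) * w powi (- n - 1))) has_sum X z w) UNIV)"
    using loc unfolding local_with_sign_def by blast
  have "(diff_mul ^^ N) (\<lambda>k l. A k (B l c) - ?s *\<^sub>C B l (A k c)) k l = 0" for c k l
  proof (rule cinner_eq_0I)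
    fix d
    define f where "f m n = cinner (A m (B n c)) d" for m n
    define g where "g m n = ?s * cinner (B n (A m c)) d" for m n
    obtain P where P: "P \<in> laurent_poly2"
      and f: "\<And>z w. w \<noteq> 0 \<Longrightarrow> norm w < norm z \<Longrightarrow> (lterm f z w has_sum (P z w / (z - w) ^ N)) UNIV"
      and g: "\<And>z w. z \<noteq> 0 \<Longrightarrow> norm z < norm w \<Longrightarrow> (lterm g z w has_sum (P z w / (z - w) ^ N)) UNIV"
      using N[of c d] unfolding diag_pole_functions_def lterm_def f_def g_def by (auto simp: mult.assoc)
    obtain q where q: "finite {(m, n). q m n \<noteq> 0}" "\<And>z w. (lterm q z w has_sum P z w) UNIV"
      using laurent_poly2_lterm[OF P] by blast
    have qbd: "bounded_right q" "bounded_left q"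
    proof -
      obtain M where "\<forall>x\<in>snd ` {(m, n). q m n \<noteq> 0}. x \<le> M"
        using finite_imageI[OF q(1), of snd] by (meson bdd_above.unfold bdd_above_finite)
      then show "bounded_right q" unfolding bounded_right_def by (intro exI[of _ "M + 1"]) force
      obtain M where "\<forall>x\<in>fst ` {(m, n). q m n \<noteq> 0}. x \<le> M"
        using finite_imageI[OF q(1), of fst] by (meson bdd_above.unfold bdd_above_finite)
      then show "bounded_left q" unfolding bounded_left_def by (intro exI[of _ "M + 1"]) force
    qed
    have qfin: "finite {m. q m n \<noteq> 0}" "finite {m. q n m \<noteq> 0}" for n
      by (rule finite_subset[OF _ finite_imageI[OF q(1), of fst]], force)
        (rule finite_subset[OF _ finite_imageI[OF q(1), of snd]], force)
    have fq: "(diff_mul ^^ N) f m n = q m n" for m n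
    proof -
      have "(diff_mul ^^ N) f m n - q m n = 0"
      proof (rule lterm_unique[where f = "\<lambda>m n. (diff_mul ^^ N) f m n - q m n"])
        have "bounded_right f"
          unfolding f_def by (rule bounded_right_comb[OF bounded_right_AB[OF fld(1) tr(2), of c] bounded_right_AB[OF fld(1) tr(2), of c]])
            (simp add: cinner_simps)
        from bounded_right_diff_mul_funpow[OF this, of N]
        show "bounded_right (\<lambda>m n. (diff_mul ^^ N) f m n - q m n)"
          by (rule bounded_right_comb[OF _ qbd(1)]) simp
        fix n
        have "finite {m. (diff_mul ^^ N) f m n \<noteq> 0}"
          by (rule finite_columns_diff_mul_funpow) (simp add: f_def matrix_bounded_finite_columns[OF tr(1) mb(1)])
        then show "finite {m. (diff_mul ^^ N) f m n - q m n \<noteq> 0}"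
          by (rule finite_subset[rotated, OF finite_UnI[OF _ qfin(1)[of n]]]) auto
      next
        fix z w :: complex assume w: "w \<noteq> 0" "norm w < norm z"
        then have "z \<noteq> 0" "z - w \<noteq> 0" by auto
        with lterm_diff[OF lterm_diff_mul_funpow[OF f[OF w], of N] q(2)[of z w]] w
        show "(lterm (\<lambda>m n. (diff_mul ^^ N) f m n - q m n) z w has_sum 0) UNIV" by simp
      qed
      then show ?thesis by simp
    qed
    have gq: "(diff_mul ^^ N) g m n = q m n" for m n
    proof -
      have bl: "bounded_left g"
      using bounded_left_BA[OF fld(2) tr(1), of c] unfolding bounded_right_iff_left
      by (rule bounded_right_comb[OF _ bounded_left_BA[OF fld(2) tr(1), of c, unfolded bounded_right_iff_left]])
        (simp add: g_def cinner_simps)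
      have gfin: "finite {n. (diff_mul ^^ N) g m n \<noteq> 0}" for m
      proof -
        have "finite {n. (diff_mul ^^ N) (\<lambda>n m. g m n) n m \<noteq> 0}"
        proof (rule finite_columns_diff_mul_funpow)
          fix m
          show "finite {n. g m n \<noteq> 0}"
            unfolding g_def
            by (rule finite_subset[OF _ matrix_bounded_finite_columns[OF tr(2) mb(2), of m c d]]) auto
        qed
        then show ?thesis unfolding diff_mul_funpow_swap_complex[of N g] by simp
      qed
      have "(diff_mul ^^ N) g m n - q m n = 0"
      \<comment> \<open>The variables are exchanged because the uniqueness statement concerns the
        domain in which the first variable is the larger one.\<close>
      proof (rule lterm_unique[where f = "\<lambda>n m. (diff_mul ^^ N) g m n - q m n"])
        show "bounded_right (\<lambda>n m. (diff_mul ^^ N) g m n - q m n)"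
          using bounded_left_diff_mul_funpow[OF bl, of N] qbd(2) unfolding bounded_right_iff_left
          by (rule bounded_right_comb) simp
        fix n
        show "finite {m. (diff_mul ^^ N) g n m - q n m \<noteq> 0}"
          by (rule finite_subset[OF _ finite_UnI[OF gfin[of n] qfin(2)[of n]]]) auto
      next
        fix w z :: complex assume z: "z \<noteq> 0" "norm z < norm w"
        then have "w \<noteq> 0" "z - w \<noteq> 0" by auto
        with lterm_diff[OF lterm_diff_mul_funpow[OF g[OF z], of N] q(2)[of z w]] z
        have "(lterm (\<lambda>m n. (diff_mul ^^ N) g m n - q m n) z w has_sum 0) UNIV" by simp
        then show "(lterm (\<lambda>n m. (diff_mul ^^ N) g m n - q m n) w z has_sum 0) UNIV"
          by (rule lterm_swap[where f = "\<lambda>m n. (diff_mul ^^ N) g m n - q m n", THEN iffD2])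
      qed
      then show ?thesis by simp
    qed
    have "cinner ((diff_mul ^^ N) (\<lambda>k l. A k (B l c) - ?s *\<^sub>C B l (A k c)) k l) d
      = (diff_mul ^^ N) (\<lambda>k l. f k l - g k l) k l"
      unfolding f_def g_def cinner_scaleC_left[symmetric] cinner_simps(1)[symmetric] diff_mul_funpow_cinner ..
    then show "cinner ((diff_mul ^^ N) (\<lambda>k l. A k (B l c) - ?s *\<^sub>C B l (A k c)) k l) d = 0"
      by (simp add: diff_mul_funpow_sub fq gq)
  qed
  then show ?thesis unfolding local_modes_def by blast
qed

text \<open>Multiplied by (z - w)^N, both orders give one array \<open>q\<close>, which inherits a
  bound on each index from one of the two orders and a lower bound on the total index from the
  grading. It is thus a Laurent polynomial, and dividing it by (z - w)^N recovers the two convergent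
  series.\<close>

lemma local_modes_imp_local_with_sign:
  assumes fld: "is_field A" "is_field B" and tr: "truncated A" "truncated B"
    and mb: "matrix_bounded A B" "matrix_bounded B A"
    and loc: "local_modes (parity_sign \<epsilon>) A B"
  shows "local_with_sign \<epsilon> A B"
proof -
  let ?s = "parity_sign \<epsilon>"
  obtain N where N: "\<And>v. (diff_mul ^^ N) (\<lambda>k l. A k (B l v) - ?s *\<^sub>C B l (A k v)) = (\<lambda>k l. 0)"
    using loc unfolding local_modes_def by blast
  have "\<exists>X\<in>diag_pole_functions N.
      (\<forall>z w. w \<noteq> 0 \<and> norm w < norm z \<longrightarrow>
        ((\<lambda>(m, n). cinner (A m (B n c)) d * z powi (- m - 1) * w powi (- n - 1)) has_sum X z w) UNIV) \<and>
      (\<forall>z w. z \<noteq> 0 \<and> norm z < norm w \<longrightarrow>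
        ((\<lambda>(m, n). ?s * (cinner (B n (A m c)) d * z powi (- m - 1) * w powi (- n - 1))) has_sum X z w) UNIV)" for c d
  proof -
    define f where "f m n = cinner (A m (B n c)) d" for m n
    define g where "g m n = ?s * cinner (B n (A m c)) d" for m n
    define q where "q = (diff_mul ^^ N) f"
    have br: "bounded_right f"
      unfolding f_def by (rule bounded_right_comb[OF bounded_right_AB[OF fld(1) tr(2), of c] bounded_right_AB[OF fld(1) tr(2), of c]])
        (simp add: cinner_simps)
    have bl: "bounded_left g"
      using bounded_left_BA[OF fld(2) tr(1), of c] unfolding bounded_right_iff_left
      by (rule bounded_right_comb[OF _ bounded_left_BA[OF fld(2) tr(1), of c, unfolded bounded_right_iff_left]])
        (simp add: g_def cinner_simps)
    have "(diff_mul ^^ N) (\<lambda>k l. f k l - g k l) = (\<lambda>k l. cinner ((diff_mul ^^ N) (\<lambda>k l. A k (B l c) - ?s *\<^sub>C B l (A k c)) k l) d)"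
      unfolding f_def g_def cinner_scaleC_left[symmetric] cinner_simps(1)[symmetric] diff_mul_funpow_cinner ..
    then have gq: "(diff_mul ^^ N) g = q"
      by (simp add: diff_mul_funpow_sub N cinner_simps q_def fun_eq_iff)
    obtain b1 where b1: "\<And>k l. l \<ge> b1 \<Longrightarrow> q k l = 0"
      using bounded_right_diff_mul_funpow[OF br, of N] unfolding q_def bounded_right_def by blast
    obtain b2 where b2: "\<And>k l. k \<ge> b2 \<Longrightarrow> q k l = 0"
      using bounded_left_diff_mul_funpow[OF bl, of N] unfolding gq bounded_left_def by blast
    obtain b3 where b3: "\<And>m n. m + n < b3 \<Longrightarrow> f m n = 0"
      using mb(1) unfolding matrix_bounded_def f_def by blast
    \<comment> \<open>Each multiplication by z - w lowers the bound on the total index by one. The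
      three bounds together confine \<open>q\<close> to a triangle.\<close>
    have b4: "m + n < b3 - int N \<Longrightarrow> q m n = 0" for m n
      unfolding q_def by (induction N arbitrary: m n) (simp_all add: diff_mul_def b3)
    have "{(m, n). q m n \<noteq> 0} \<subseteq> {b3 - int N - b1..b2} \<times> {b3 - int N - b2..b1}"
    proof clarify
      fix m n assume "q m n \<noteq> 0"
      then have "\<not> n \<ge> b1" "\<not> m \<ge> b2" "\<not> m + n < b3 - int N" using b1 b2 b4 by blast+
      then show "m \<in> {b3 - int N - b1..b2} \<and> n \<in> {b3 - int N - b2..b1}" by auto
    qed
    then have fin: "finite {(m, n). q m n \<noteq> 0}" by (rule finite_subset) simp
    obtain P where P: "P \<in> laurent_poly2" "\<And>z w. (lterm q z w has_sum P z w) UNIV"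
      using lterm_finite[OF fin] by blast
    define X where "X = (\<lambda>z w. P z w / (z - w) ^ N)"
    have "X \<in> diag_pole_functions N" using P(1) by (auto simp: diag_pole_functions_def X_def)
    moreover have "(lterm f z w has_sum X z w) UNIV" if "w \<noteq> 0" "norm w < norm z" for z w
      unfolding X_def by (rule lterm_divide_funpow[OF _ that br]) (use P(2) in \<open>simp add: q_def\<close>)
    moreover have "(lterm g z w has_sum X z w) UNIV" if "z \<noteq> 0" "norm z < norm w" for z w
      unfolding X_def by (rule lterm_divide_left_funpow[OF _ that bl]) (use P(2) in \<open>simp add: gq\<close>)
    ultimately show ?thesis
      unfolding lterm_def f_def g_def by (intro bexI[of _ X]) (simp_all add: mult.assoc)
  qed
  then show ?thesis unfolding local_with_sign_def by blast
qed

lemma csubspaceD: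
  assumes "csubspace W"
  shows "0 \<in> W" "x \<in> W \<Longrightarrow> y \<in> W \<Longrightarrow> x + y \<in> W" "x \<in> W \<Longrightarrow> c *\<^sub>C x \<in> W"
    "x \<in> W \<Longrightarrow> y \<in> W \<Longrightarrow> x - y \<in> W"
  using assms by (auto simp: complex_vector.subspace_0 complex_vector.subspace_add
      complex_vector.subspace_scale complex_vector.subspace_diff)

lemma parity_sign_mult: "parity_sign \<epsilon> * parity_sign \<delta> = parity_sign (\<epsilon> + \<delta>)"
  by (cases \<epsilon>; cases \<delta>) (auto simp: parity_sign_def)

lemma parity_sign_square: "parity_sign \<epsilon> * parity_sign \<epsilon> = 1"
  by (auto simp: parity_sign_def)

lemma bit_mult_self: "\<epsilon> * \<epsilon> = (\<epsilon> :: bit)"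
  by (cases \<epsilon>) auto

section \<open>Linearity of the products in each factor\<close>

lemma is_field_truncated_subspace: "csubspace {B. is_field B \<and> truncated B}"
proof (rule complex_vector.subspaceI)
  show "0 \<in> {B. is_field B \<and> truncated B}"
    by (auto simp: is_field_def truncated_def intro!: clinearI)
next
  fix B C :: "'a modes" assume BC: "B \<in> {B. is_field B \<and> truncated B}" "C \<in> {B. is_field B \<and> truncated B}"
  then have "is_field (B + C)"
    unfolding is_field_def
    by (auto intro!: clinearI simp: clinear_simps(1,2)[OF is_fieldD] scaleC_add_right add_ac is_field_def)
  moreover have "truncated (B + C)"
    unfolding truncated_def
  proof
    fix v
    obtain M where "\<And>m. m \<ge> M \<Longrightarrow> B m v = 0" "\<And>m. m \<ge> M \<Longrightarrow> C m v = 0"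
      using truncated_bound2[of B C v] BC by blast
    then show "\<exists>M. \<forall>m\<ge>M. (B + C) m v = 0" by (intro exI[of _ M]) simp
  qed
  ultimately show "B + C \<in> {B. is_field B \<and> truncated B}" by simp
next
  fix c and B :: "'a modes" assume B: "B \<in> {B. is_field B \<and> truncated B}"
  then have "is_field (c *\<^sub>C B)"
    unfolding is_field_def
    by (auto intro!: clinearI simp: clinear_simps(1,2)[OF is_fieldD] scaleC_add_right is_field_def
        scaleC_fun_def scaleC_scaleC mult.commute)
  moreover have "truncated (c *\<^sub>C B)"
    unfolding truncated_def
  proof
    fix v
    obtain M where "\<forall>m\<ge>M. B m v = 0" using B unfolding truncated_def by blast
    then show "\<exists>M. \<forall>m\<ge>M. (c *\<^sub>C B) m v = 0" by (intro exI[of _ M]) (simp add: scaleC_fun_def)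
  qed
  ultimately show "c *\<^sub>C B \<in> {B. is_field B \<and> truncated B}" by simp
qed

lemma nprod_lin_left:
  assumes "is_field B1" "is_field B2" "is_field C" "truncated B1" "truncated B2" "truncated C"
  shows "nprod s (a *\<^sub>C B1 + b *\<^sub>C B2) n C = a *\<^sub>C nprod s B1 n C + b *\<^sub>C nprod s B2 n C"
proof (intro ext)
  fix m v
  note cl = clinear_simps[OF is_fieldD[OF assms(3)]]
  show "nprod s (a *\<^sub>C B1 + b *\<^sub>C B2) n C m v = (a *\<^sub>C nprod s B1 n C + b *\<^sub>C nprod s B2 n C) m v"
    using pow_right_lin[OF bounded_right_AB[OF assms(1,6)] bounded_right_AB[OF assms(2,6)], of n a v b v 0 m]
      pow_left_lin[OF bounded_left_BA[OF assms(3,4)] bounded_left_BA[OF assms(3,5)], of n a v b v 0 m]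
    by (simp add: nprod_def cl scaleC_fun_def complex_vector.scale_right_diff_distrib scaleC_add_right
        scaleC_scaleC mult.commute)
qed

lemma nprod_lin_right:
  assumes "is_field B" "is_field C1" "is_field C2" "truncated B" "truncated C1" "truncated C2"
  shows "nprod s B n (a *\<^sub>C C1 + b *\<^sub>C C2) = a *\<^sub>C nprod s B n C1 + b *\<^sub>C nprod s B n C2"
proof (intro ext)
  fix m v
  note cl = clinear_simps[OF is_fieldD[OF assms(1)]]
  show "nprod s B n (a *\<^sub>C C1 + b *\<^sub>C C2) m v = (a *\<^sub>C nprod s B n C1 + b *\<^sub>C nprod s B n C2) m v"
    using pow_right_lin[OF bounded_right_AB[OF assms(1,5)] bounded_right_AB[OF assms(1,6)], of n a v b v 0 m]
      pow_left_lin[OF bounded_left_BA[OF assms(2,4)] bounded_left_BA[OF assms(3,4)], of n a v b v 0 m]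
    by (simp add: nprod_def cl scaleC_fun_def complex_vector.scale_right_diff_distrib scaleC_add_right
        scaleC_scaleC mult.commute)
qed

text \<open>The induction over the span carries \<open>is_field\<close> and \<open>truncated\<close>
  along, because linearity of \<open>nprod\<close> in this factor depends on them.\<close>

lemma nprod_span_left:
  fixes B C :: "'h::complex_vector modes"
  assumes "csubspace U" "is_field C" "truncated C" "B \<in> cspan X"
    and "\<And>B. B \<in> X \<Longrightarrow> is_field B \<and> truncated B \<and> nprod s B n C \<in> U"
  shows "nprod s B n C \<in> U"
proof -
  let ?P = "\<lambda>B. (is_field B \<and> truncated B) \<and> nprod s B n C \<in> U"
  have ft: "is_field (0 :: 'h modes) \<and> truncated (0 :: 'h modes)"
    "is_field B1 \<and> truncated B1 \<Longrightarrow> is_field B2 \<and> truncated B2 \<Longrightarrow> is_field (B1 + B2) \<and> truncated (B1 + B2)"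
    "is_field B1 \<and> truncated B1 \<Longrightarrow> is_field (c *\<^sub>C B1) \<and> truncated (c *\<^sub>C B1)" for c and B1 B2 :: "'h modes"
    using csubspaceD[OF is_field_truncated_subspace] by blast+
  have "csubspace (Collect ?P)"
  proof (rule complex_vector.subspaceI)
    have "nprod s 0 n C = 0"
      using nprod_lin_left[of 0 0 C s 0 0 n] ft(1) assms(2,3) by simp
    then show "0 \<in> Collect ?P" using ft(1) csubspaceD(1)[OF assms(1)] by simp
    fix B1 B2 assume B: "B1 \<in> Collect ?P" "B2 \<in> Collect ?P"
    then have "nprod s (B1 + B2) n C = nprod s B1 n C + nprod s B2 n C"
      using nprod_lin_left[of B1 B2 C s 1 1 n] assms(2,3) by (simp add: scaleC_one)
    then show "B1 + B2 \<in> Collect ?P"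
      using B ft(2)[of B1 B2] csubspaceD(2)[OF assms(1)] by simp
  next
    fix c B1 assume B: "B1 \<in> Collect ?P"
    then have "nprod s (c *\<^sub>C B1) n C = c *\<^sub>C nprod s B1 n C"
      using nprod_lin_left[of B1 B1 C s c 0 n] assms(2,3) by simp
    then show "c *\<^sub>C B1 \<in> Collect ?P"
      using B ft(3)[of B1 c] csubspaceD(3)[OF assms(1)] by simp
  qed
  then show ?thesis
    using complex_vector.span_induct[OF assms(4), of ?P] assms(5) by blast
qed

lemma nprod_span_right:
  fixes B C :: "'h::complex_vector modes"
  assumes "csubspace U" "is_field B" "truncated B" "C \<in> cspan X"
    and "\<And>C. C \<in> X \<Longrightarrow> is_field C \<and> truncated C \<and> nprod s B n C \<in> U"
  shows "nprod s B n C \<in> U"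
proof -
  let ?P = "\<lambda>C. (is_field C \<and> truncated C) \<and> nprod s B n C \<in> U"
  have ft: "is_field (0 :: 'h modes) \<and> truncated (0 :: 'h modes)"
    "is_field B1 \<and> truncated B1 \<Longrightarrow> is_field B2 \<and> truncated B2 \<Longrightarrow> is_field (B1 + B2) \<and> truncated (B1 + B2)"
    "is_field B1 \<and> truncated B1 \<Longrightarrow> is_field (c *\<^sub>C B1) \<and> truncated (c *\<^sub>C B1)" for c and B1 B2 :: "'h modes"
    using csubspaceD[OF is_field_truncated_subspace] by blast+
  have "csubspace (Collect ?P)"
  proof (rule complex_vector.subspaceI)
    have "nprod s B n 0 = 0"
      using nprod_lin_right[of B 0 0 s n 0 0] ft(1) assms(2,3) by simp
    then show "0 \<in> Collect ?P" using ft(1) csubspaceD(1)[OF assms(1)] by simp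
    fix C1 C2 assume C: "C1 \<in> Collect ?P" "C2 \<in> Collect ?P"
    then have "nprod s B n (C1 + C2) = nprod s B n C1 + nprod s B n C2"
      using nprod_lin_right[of B C1 C2 s n 1 1] assms(2,3) by (simp add: scaleC_one)
    then show "C1 + C2 \<in> Collect ?P"
      using C ft(2)[of C1 C2] csubspaceD(2)[OF assms(1)] by simp
  next
    fix c C1 assume C: "C1 \<in> Collect ?P"
    then have "nprod s B n (c *\<^sub>C C1) = c *\<^sub>C nprod s B n C1"
      using nprod_lin_right[of B C1 C1 s n c 0] assms(2,3) by simp
    then show "c *\<^sub>C C1 \<in> Collect ?P"
      using C ft(3)[of C1 c] csubspaceD(3)[OF assms(1)] by simp
  qed
  then show ?thesis
    using complex_vector.span_induct[OF assms(4), of ?P] assms(5) by blast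
qed

section \<open>Gradings\<close>

lemma sum_any_scaleC: "finite {i. x i \<noteq> 0} \<Longrightarrow> Sum_any (\<lambda>i. c *\<^sub>C x i) = c *\<^sub>C Sum_any x"
  by (subst Sum_any.expand_superset[of "{i. x i \<noteq> 0}"], simp, force)
    (simp add: Sum_any.expand_set complex_vector.scale_sum_right)

lemma direct_sum_spans:
  assumes "direct_sum U I W"
  shows "cspan (\<Union>i\<in>I. W i) = U"
proof
  show "cspan (\<Union>i\<in>I. W i) \<subseteq> U"
    by (rule complex_vector.span_minimal) (use assms in \<open>auto simp: direct_sum_def\<close>)
  show "U \<subseteq> cspan (\<Union>i\<in>I. W i)"
  proof
    fix u assume "u \<in> U"
    then obtain x where x: "\<And>i. i \<in> I \<Longrightarrow> x i \<in> W i" "\<And>i. i \<notin> I \<Longrightarrow> x i = 0" "u = Sum_any x"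
      using assms unfolding direct_sum_def by metis
    have "x i \<in> cspan (\<Union>i\<in>I. W i)" for i
      using x(1,2)[of i] by (cases "i \<in> I") (auto intro: complex_vector.span_base complex_vector.span_zero)
    then show "u \<in> cspan (\<Union>i\<in>I. W i)"
      unfolding x(3) Sum_any.expand_set by (intro complex_vector.span_sum)
  qed
qed

text \<open>Existence is an induction over the span. A family indexed by J, extended by zero, is one
  indexed by I, so uniqueness is inherited.\<close>

lemma direct_sum_restrict:
  assumes "direct_sum U I W" "J \<subseteq> I"
  shows "direct_sum (cspan (\<Union>i\<in>J. W i)) J W"
  unfolding direct_sum_def
proof (intro conjI ballI)
  fix u assume u: "u \<in> cspan (\<Union>i\<in>J. W i)"
  have WI: "csubspace (W i)" if "i \<in> J" for i
    using that assms unfolding direct_sum_def by blast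
  have "cspan (\<Union>i\<in>J. W i) \<subseteq> cspan (\<Union>i\<in>I. W i)"
    using assms(2) by (intro complex_vector.span_mono) auto
  then have uU: "u \<in> U" using u direct_sum_spans[OF assms(1)] by auto
  let ?Q = "\<lambda>u x. (\<forall>i\<in>J. x i \<in> W i) \<and> (\<forall>i. i \<notin> J \<longrightarrow> x i = 0) \<and> finite {i. x i \<noteq> 0} \<and> u = Sum_any x"
  have "\<exists>x. ?Q u x"
  proof (rule complex_vector.span_induct[OF u, of "\<lambda>u. \<exists>x. ?Q u x"])
    show "csubspace {u. \<exists>x. ?Q u x}"
    proof (rule complex_vector.subspaceI)
      show "0 \<in> {u. \<exists>x. ?Q u x}"
        using csubspaceD(1)[OF WI] by (auto intro!: exI[of _ "\<lambda>_. 0"])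
    next
      fix u v assume "u \<in> {u. \<exists>x. ?Q u x}" "v \<in> {u. \<exists>x. ?Q u x}"
      then obtain x y where x: "?Q u x" and y: "?Q v y" by auto
      have "finite {i. x i + y i \<noteq> 0}"
        by (rule finite_subset[of _ "{i. x i \<noteq> 0} \<union> {i. y i \<noteq> 0}"]) (use x y in auto)
      then have "?Q (u + v) (\<lambda>i. x i + y i)"
        using x y csubspaceD(2)[OF WI] by (auto simp: Sum_any.distrib)
      then show "u + v \<in> {u. \<exists>x. ?Q u x}"
        unfolding mem_Collect_eq by (rule exI[of _ "\<lambda>i. x i + y i"])
    next
      fix c u assume "u \<in> {u. \<exists>x. ?Q u x}"
      then obtain x where x: "?Q u x" by auto
      have "finite {i. c *\<^sub>C x i \<noteq> 0}"
        by (rule finite_subset[of _ "{i. x i \<noteq> 0}"]) (use x in auto)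
      then have "?Q (c *\<^sub>C u) (\<lambda>i. c *\<^sub>C x i)"
        using x csubspaceD(3)[OF WI] by (auto simp: sum_any_scaleC)
      then show "c *\<^sub>C u \<in> {u. \<exists>x. ?Q u x}"
        unfolding mem_Collect_eq by (rule exI[of _ "\<lambda>i. c *\<^sub>C x i"])
    qed
    fix v assume "v \<in> (\<Union>i\<in>J. W i)"
    then obtain j where j: "j \<in> J" "v \<in> W j" by blast
    have "?Q v (\<lambda>i. if i = j then v else 0)"
      using j csubspaceD(1)[OF WI] by auto
    then show "\<exists>x. ?Q v x" by (rule exI[of _ "\<lambda>i. if i = j then v else 0"])
  qed
  moreover have "x = y" if x: "?Q u x" and y: "?Q u y" for x y
  proof -
    have W0: "0 \<in> W i" if "i \<in> I" for i
      using that assms(1) csubspaceD(1) unfolding direct_sum_def by blast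
    have "(\<forall>i\<in>I. x i \<in> W i) \<and> (\<forall>i. i \<notin> I \<longrightarrow> x i = 0) \<and> finite {i. x i \<noteq> 0} \<and> u = Sum_any x"
      "(\<forall>i\<in>I. y i \<in> W i) \<and> (\<forall>i. i \<notin> I \<longrightarrow> y i = 0) \<and> finite {i. y i \<noteq> 0} \<and> u = Sum_any y"
      using x y W0 assms(2) by (metis subsetD)+
    then show ?thesis using assms(1) uU unfolding direct_sum_def by blast
  qed
  ultimately show "\<exists>!x. ?Q u x" by blast
next
  fix i assume "i \<in> J"
  then show "csubspace (W i)" using assms unfolding direct_sum_def by blast
  show "W i \<subseteq> cspan (\<Union>i\<in>J. W i)" using \<open>i \<in> J\<close> by (auto intro: complex_vector.span_base)
qed simp

section \<open>Parities and half-integral degrees\<close>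

lemma bit_UNIV: "(UNIV :: bit set) = {0, 1}"
  by (auto intro: bit.exhaust)

lemma finite_bit_set: "finite (X :: bit set)"
proof (rule finite_subset[OF subset_UNIV])
  show "finite (UNIV :: bit set)" unfolding bit_UNIV by (intro finite.intros)
qed

lemma Sum_any_bit: "Sum_any x = x 0 + x (1 :: bit)"
proof -
  have "Sum_any x = sum x UNIV"
    by (rule Sum_any.expand_superset[OF finite_bit_set]) simp
  also have "\<dots> = x 0 + x 1" unfolding bit_UNIV by (subst sum.insert) auto
  finally show ?thesis .
qed

lemma direct_sum_bit:
  fixes S :: "bit \<Rightarrow> 'h::complex_vector set"
  assumes "csubspace U" "\<And>\<epsilon>. csubspace (S \<epsilon>)" "\<And>\<epsilon>. S \<epsilon> \<subseteq> U"
    and "\<And>u. u \<in> U \<Longrightarrow> \<exists>x\<in>S 0. \<exists>y\<in>S 1. u = x + y" and "S 0 \<inter> S 1 \<subseteq> {0}"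
  shows "direct_sum U UNIV S"
  unfolding direct_sum_def
proof (intro conjI ballI)
  fix u assume "u \<in> U"
  then obtain a b where ab: "a \<in> S 0" "b \<in> S 1" "u = a + b" using assms(4) by blast
  let ?Q = "\<lambda>x. (\<forall>i\<in>UNIV. x i \<in> S i) \<and> (\<forall>i. i \<notin> UNIV \<longrightarrow> x i = 0) \<and> finite {i. x i \<noteq> 0} \<and> u = Sum_any x"
  have ex: "?Q (\<lambda>i. if i = 0 then a else b)"
    using ab finite_bit_set by (auto simp: Sum_any_bit)
  have uniq: "x = y" if x: "?Q x" and y: "?Q y" for x y
  proof -
    have "x 0 + x 1 = y 0 + y 1" using x y by (simp add: Sum_any_bit)
    then have eq: "x 0 - y 0 = y 1 - x 1" by (simp add: algebra_simps)
    moreover have "x 0 - y 0 \<in> S 0" "y 1 - x 1 \<in> S 1"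
      using x y csubspaceD(4)[OF assms(2)] by auto
    ultimately have "x 0 - y 0 = 0" "y 1 - x 1 = 0" using assms(5) by auto
    then have "x i = y i" for i by (cases i) auto
    then show ?thesis by blast
  qed
  show "\<exists>!x. ?Q x"
    by (rule ex1I[of _ "\<lambda>i. if i = 0 then a else b"]) (fact ex, erule uniq[OF _ ex])
qed (use assms in auto)

lemma half_nats_eq: "half_nats = shifted_nats 0 \<union> shifted_nats 1"
proof
  show "half_nats \<subseteq> shifted_nats 0 \<union> shifted_nats 1"
  proof
    fix x assume "x \<in> half_nats"
    then obtain k :: nat where x: "x = real k / 2" unfolding half_nats_def by blast
    show "x \<in> shifted_nats 0 \<union> shifted_nats 1"
    proof (cases "even k")
      case True
      then obtain j where "k = 2 * j" by (auto elim: evenE)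
      then have "x \<in> shifted_nats 0" unfolding shifted_nats_def x by auto
      then show ?thesis ..
    next
      case False
      then obtain j where "k = 2 * j + 1" by (auto elim: oddE)
      then have "x \<in> shifted_nats 1" unfolding shifted_nats_def x by (auto simp: add_divide_distrib)
      then show ?thesis ..
    qed
  qed
  have "real k \<in> half_nats" "real k + 1 / 2 \<in> half_nats" for k
    unfolding half_nats_def
    by (auto intro: exI[of _ "2 * k"] exI[of _ "2 * k + 1"] simp: add_divide_distrib)
  then show "shifted_nats 0 \<union> shifted_nats 1 \<subseteq> half_nats"
    unfolding shifted_nats_def by auto
qed

lemma shifted_nats_subset: "shifted_nats \<epsilon> \<subseteq> half_nats"
  unfolding half_nats_eq by (cases \<epsilon>) auto

lemma shifted_nats_disjoint: "shifted_nats 0 \<inter> shifted_nats 1 = {}"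
proof -
  have "real j \<noteq> real k + 1 / 2" for j k
  proof
    assume "real j = real k + 1 / 2"
    then have "real (2 * j) = real (2 * k + 1)" by simp
    then have "2 * j = 2 * k + 1" by (simp only: of_nat_eq_iff)
    then show False by presburger
  qed
  then show ?thesis unfolding shifted_nats_def by auto
qed

text \<open>Mapping twice a degree into \<open>bit\<close> reads off its parity, which is how
  degrees and signs are compared throughout.\<close>

lemma of_int_bit: "(of_int k :: bit) = of_bool (odd k)"
proof -
  have "(2 :: bit) = 0" by simp
  then have 0: "(of_int (2 * j) :: bit) = 0" for j by (simp only: of_int_mult of_int_numeral) simp
  show ?thesis
  proof (cases "even k")
    case True
    then show ?thesis using 0 by (auto elim!: evenE)
  next
    case False
    then obtain j where j: "k = 2 * j + 1" by (auto elim: oddE)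
    have "(of_int k :: bit) = of_int (2 * j) + 1" unfolding j by (simp only: of_int_add of_int_1)
    then show ?thesis using 0[of j] False by simp
  qed
qed

lemma half_int_in_shifted_nats:
  assumes "real_of_int k / 2 \<in> half_nats"
  shows "real_of_int k / 2 \<in> shifted_nats (of_int k)"
proof -
  obtain n :: nat where "real_of_int k / 2 = real n / 2"
    using assms unfolding half_nats_def by blast
  then have "real_of_int k = real_of_int (int n)" by simp
  then have k: "k = int n" by (simp only: of_int_eq_iff)
  show ?thesis
  proof (cases "even n")
    case True
    then obtain j where "n = 2 * j" by (auto elim: evenE)
    then show ?thesis unfolding shifted_nats_def of_int_bit k by auto
  next
    case False
    then obtain j where "n = 2 * j + 1" by (auto elim: oddE)
    then show ?thesis unfolding shifted_nats_def of_int_bit k by (auto simp: add_divide_distrib)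
  qed
qed

lemma shifted_natsE:
  assumes "\<alpha> \<in> shifted_nats \<epsilon>"
  obtains k :: int where "\<alpha> = of_int k / 2" "\<epsilon> = of_int k"
proof -
  obtain n :: nat where n: "\<alpha> = real n + of_bool (\<epsilon> = 1) / 2"
    using assms unfolding shifted_nats_def by blast
  show ?thesis
  proof (rule that[of "2 * int n + of_bool (\<epsilon> = 1)"])
    show "\<alpha> = of_int (2 * int n + of_bool (\<epsilon> = 1)) / 2" unfolding n by (simp add: add_divide_distrib)
    show "\<epsilon> = of_int (2 * int n + of_bool (\<epsilon> = 1))" unfolding of_int_bit by (cases \<epsilon>) auto
  qed
qed

section \<open>The fields generated by a system of generators\<close>

declare One_nat_def [simp del]

text \<open>The existential data of a system are fixed here: \<open>e i\<close> is the sign of the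
  i-th generator with itself, and \<open>deg i\<close> is twice its degree, an integer so that its
  residue modulo 2 makes sense. The field identities are stated mode by mode; the \<open>- 1\<close>
  in the degree condition comes from the coefficient - (m + 1) in z A'(z).\<close>

locale generating_system =
  fixes A :: "nat \<Rightarrow> 'h::prehilbert modes" and r :: nat and D T :: "'h \<Rightarrow> 'h" and \<Omega> :: 'h
    and G :: "real \<Rightarrow> 'h set" and e :: "nat \<Rightarrow> bit" and deg :: "nat \<Rightarrow> int"
  assumes field_A: "i \<in> {1..r} \<Longrightarrow> is_field (A i)"
    and D: "clinear D" and T: "clinear T"
    and local_A: "i \<in> {1..r} \<Longrightarrow> j \<in> {1..r} \<Longrightarrow> local_with_sign (e i * e j) (A i) (A j)"
    and T_A: "i \<in> {1..r} \<Longrightarrow> T (A i m v) = A i m (T v) + of_int (- m) *\<^sub>C A i (m - 1) v"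
    and grading: "grading_of D G"
    and D_A: "i \<in> {1..r} \<Longrightarrow> D (A i m v) = A i m (D v) + (of_real (of_int (deg i) / 2) - 1 - of_int m) *\<^sub>C A i m v"
    and parity_A: "i \<in> {1..r} \<Longrightarrow> of_int (deg i) = e i"
    and vac_G: "\<Omega> \<in> G 0" and vac_norm: "hnorm \<Omega> = 1"
    and vac_A: "i \<in> {1..r} \<Longrightarrow> m \<ge> 0 \<Longrightarrow> A i m \<Omega> = 0"
    and vac_D: "D \<Omega> = 0" and vac_T: "T \<Omega> = 0"
    and irreducible: "acts_irreducibly {A i m | i m. i \<in> {1..r}}"
begin

section \<open>Homogeneous components and eigenvectors of \<open>D\<close>\<close>

lemma vac_nonzero: "\<Omega> \<noteq> 0"
  using vac_norm by (auto simp: hnorm_def cinner_simps)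

lemma irreducibleD:
  assumes "csubspace W" "\<And>i m v. i \<in> {1..r} \<Longrightarrow> v \<in> W \<Longrightarrow> A i m v \<in> W"
  shows "W = {0} \<or> W = UNIV"
  using irreducible assms unfolding acts_irreducibly_def by blast

lemma G_subspace: "x \<in> half_nats \<Longrightarrow> csubspace (G x)"
  and G_direct_sum: "direct_sum UNIV half_nats G"
  and G_eigen: "x \<in> half_nats \<Longrightarrow> v \<in> G x \<Longrightarrow> D v = of_real x *\<^sub>C v"
  and G_orth: "x \<in> half_nats \<Longrightarrow> y \<in> half_nats \<Longrightarrow> x \<noteq> y \<Longrightarrow> v \<in> G x \<Longrightarrow> w \<in> G y \<Longrightarrow> cinner v w = 0"
  using grading unfolding grading_of_def direct_sum_def by auto

lemma span_G: "cspan (\<Union>x\<in>half_nats. G x) = UNIV"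
  by (rule direct_sum_spans[OF G_direct_sum])

text \<open>A substitute for the projection onto degree y, valid because different degrees are
  orthogonal. Smaller subspaces \<open>U x\<close> are allowed so that the component can be required
  to come from a homogeneous field, which \<open>V_hom\<close> uses.\<close>

lemma component:
  assumes U: "\<And>x. x \<in> half_nats \<Longrightarrow> csubspace (U x)" "\<And>x. x \<in> half_nats \<Longrightarrow> U x \<subseteq> G x"
    and v: "v \<in> cspan (\<Union>x\<in>half_nats. U x)" and y: "y \<in> half_nats"
  shows "\<exists>u\<in>U y. \<forall>w\<in>G y. cinner (v - u) w = 0"
proof (rule complex_vector.span_induct[OF v, of "\<lambda>v. \<exists>u\<in>U y. \<forall>w\<in>G y. cinner (v - u) w = 0"])
  show "csubspace {v. \<exists>u\<in>U y. \<forall>w\<in>G y. cinner (v - u) w = 0}"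
  proof (rule complex_vector.subspaceI)
    show "0 \<in> {v. \<exists>u\<in>U y. \<forall>w\<in>G y. cinner (v - u) w = 0}"
      using csubspaceD(1)[OF U(1)[OF y]] by (auto intro!: bexI[of _ 0] simp: cinner_simps)
  next
    fix v1 v2 assume "v1 \<in> {v. \<exists>u\<in>U y. \<forall>w\<in>G y. cinner (v - u) w = 0}" "v2 \<in> {v. \<exists>u\<in>U y. \<forall>w\<in>G y. cinner (v - u) w = 0}"
    then obtain u1 u2 where u: "u1 \<in> U y" "u2 \<in> U y"
      "\<And>w. w \<in> G y \<Longrightarrow> cinner (v1 - u1) w = 0" "\<And>w. w \<in> G y \<Longrightarrow> cinner (v2 - u2) w = 0" by auto
    show "v1 + v2 \<in> {v. \<exists>u\<in>U y. \<forall>w\<in>G y. cinner (v - u) w = 0}"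
      using csubspaceD(2)[OF U(1)[OF y] u(1,2)] u(3,4)
      by (auto intro!: bexI[of _ "u1 + u2"] simp: cinner_simps cinner_add_left add_diff_add)
  next
    fix c v1 assume "v1 \<in> {v. \<exists>u\<in>U y. \<forall>w\<in>G y. cinner (v - u) w = 0}"
    then obtain u1 where u: "u1 \<in> U y" "\<And>w. w \<in> G y \<Longrightarrow> cinner (v1 - u1) w = 0" by auto
    show "c *\<^sub>C v1 \<in> {v. \<exists>u\<in>U y. \<forall>w\<in>G y. cinner (v - u) w = 0}"
      using csubspaceD(3)[OF U(1)[OF y] u(1), of c] u(2)
      by (auto intro!: bexI[of _ "c *\<^sub>C u1"] simp: cinner_scaleC_left simp flip: complex_vector.scale_right_diff_distrib)
  qed
  fix v assume "v \<in> (\<Union>x\<in>half_nats. U x)"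
  then obtain x where x: "x \<in> half_nats" "v \<in> U x" by blast
  show "\<exists>u\<in>U y. \<forall>w\<in>G y. cinner (v - u) w = 0"
  proof (cases "x = y")
    case True
    then show ?thesis using x by (intro bexI[of _ v]) (simp_all add: cinner_simps)
  next
    case False
    have "v \<in> G x" using U(2)[OF x(1)] x(2) by blast
    then have "\<forall>w\<in>G y. cinner v w = 0" using G_orth[OF x(1) y False] by blast
    then show ?thesis
      using csubspaceD(1)[OF U(1)[OF y]] by (intro bexI[of _ 0]) simp_all
  qed
qed

lemma orth_span: "v \<in> cspan X \<Longrightarrow> (\<And>x. x \<in> X \<Longrightarrow> cinner x w = 0) \<Longrightarrow> cinner v w = 0"
  by (rule complex_vector.span_induct[of v X "\<lambda>v. cinner v w = 0"])
    (auto intro!: complex_vector.subspaceI simp: cinner_simps cinner_add_left cinner_scaleC_left)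

lemma orth_all:
  assumes "\<And>x u. x \<in> half_nats \<Longrightarrow> u \<in> G x \<Longrightarrow> cinner v u = 0"
  shows "v = 0"
proof (rule cinner_eq_0I)
  fix d
  have "cinner u v = 0" if "u \<in> (\<Union>x\<in>half_nats. G x)" for u
    using assms that cinner_commute[of u v] by auto
  then have "cinner d v = 0" using orth_span[of d "\<Union>x\<in>half_nats. G x" v] span_G by auto
  then show "cinner v d = 0" using cinner_commute[of v d] by simp
qed

lemma D_symmetric:
  assumes "x \<in> half_nats" "u \<in> G x"
  shows "cinner (D v) u = of_real x * cinner v u"
proof -
  have v: "v \<in> cspan (\<Union>x\<in>half_nats. G x)" by (simp add: span_G)
  show ?thesis
  proof (rule complex_vector.span_induct[OF v, of "\<lambda>v. cinner (D v) u = of_real x * cinner v u"])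
    show "csubspace {v. cinner (D v) u = of_real x * cinner v u}"
      by (rule complex_vector.subspaceI)
        (auto simp: clinear_simps[OF D] cinner_simps cinner_add_left cinner_scaleC_left algebra_simps)
    fix v assume "v \<in> (\<Union>x\<in>half_nats. G x)"
    then obtain y where y: "y \<in> half_nats" "v \<in> G y" by blast
    then show "cinner (D v) u = of_real x * cinner v u"
      using G_orth[OF y(1) assms(1) _ y(2) assms(2)] by (cases "x = y") (auto simp: G_eigen cinner_scaleC_left)
  qed
qed

text \<open>Pairing \<open>D v\<close> with a vector of degree x multiplies by x and also by y, so v
  is orthogonal to all degrees other than y. Removing its component of degree y, if there is one,
  leaves a vector orthogonal to everything.\<close>

lemma eigenvector:
  assumes "D v = of_real y *\<^sub>C v"
  shows "y \<in> half_nats \<Longrightarrow> v \<in> G y" "y \<notin> half_nats \<Longrightarrow> v = 0"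
proof -
  have orth: "cinner v u = 0" if "x \<in> half_nats" "u \<in> G x" "x \<noteq> y" for x u
    using D_symmetric[OF that(1,2), of v] that(3) assms by (simp add: cinner_scaleC_left)
  show "y \<notin> half_nats \<Longrightarrow> v = 0"
    using orth orth_all[of v] by blast
  assume y: "y \<in> half_nats"
  obtain u where u: "u \<in> G y" "\<And>w. w \<in> G y \<Longrightarrow> cinner (v - u) w = 0"
    using component[of G v y] G_subspace y span_G by auto
  have "v - u = 0"
  proof (rule orth_all)
    fix x w assume x: "x \<in> half_nats" "w \<in> G x"
    show "cinner (v - u) w = 0"
    proof (cases "x = y")
      case True then show ?thesis using u(2) x by simp
    next
      case False
      then show ?thesis using orth[OF x] G_orth[OF y x(1) _ u(1) x(2)] by (simp add: cinner_simps)
    qed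
  qed
  then show "v \<in> G y" using u(1) by simp
qed

section \<open>Homogeneous fields and sums of them\<close>

definition hom :: "real \<Rightarrow> 'h modes \<Rightarrow> bool"
  where "hom a B \<longleftrightarrow> (\<forall>m v. D (B m v) = B m (D v) + (of_real a - 1 - of_int m) *\<^sub>C B m v)"

text \<open>In a homogeneous field of degree a, the mode m shifts the degree of vectors by a - 1 -
  m.\<close>

lemma hom_eigen:
  assumes "is_field B" "hom a B" "D v = of_real y *\<^sub>C v"
  shows "D (B m v) = of_real (y + a - 1 - of_int m) *\<^sub>C B m v"
proof -
  have "D (B m v) = of_real y *\<^sub>C B m v + (of_real a - 1 - of_int m) *\<^sub>C B m v"
    using assms unfolding hom_def by (simp add: clinear_simps[OF is_fieldD[OF assms(1)]])
  then show ?thesis by (simp flip: complex_vector.scale_left_distrib add: add_diff_eq)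
qed

text \<open>On a vector of degree x the mode m lands in degree x + a - 1 - m, which is negative for
  large m and so forces the value 0.\<close>

lemma hom_truncated:
  assumes "is_field B" "hom a B"
  shows "truncated B"
  unfolding truncated_def
proof
  fix v
  have v: "v \<in> cspan (\<Union>x\<in>half_nats. G x)" by (simp add: span_G)
  note cl = clinear_simps[OF is_fieldD[OF assms(1)]]
  show "\<exists>M. \<forall>m\<ge>M. B m v = 0"
  proof (rule complex_vector.span_induct[OF v, of "\<lambda>v. \<exists>M. \<forall>m\<ge>M. B m v = 0"])
    show "csubspace {v. \<exists>M. \<forall>m\<ge>M. B m v = 0}"
    proof (rule complex_vector.subspaceI)
      fix v w assume "v \<in> {v. \<exists>M. \<forall>m\<ge>M. B m v = 0}" "w \<in> {v. \<exists>M. \<forall>m\<ge>M. B m v = 0}"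
      then obtain M N where "\<And>m. m \<ge> M \<Longrightarrow> B m v = 0" "\<And>m. m \<ge> N \<Longrightarrow> B m w = 0" by auto
      then show "v + w \<in> {v. \<exists>M. \<forall>m\<ge>M. B m v = 0}"
        by (auto simp: cl intro!: exI[of _ "max M N"])
    qed (auto simp: cl)
    fix v assume "v \<in> (\<Union>x\<in>half_nats. G x)"
    then obtain x where x: "x \<in> half_nats" "v \<in> G x" by blast
    have "B m v = 0" if "m \<ge> \<lceil>x + a\<rceil>" for m
    proof (rule eigenvector(2)[OF hom_eigen[OF assms G_eigen[OF x]]])
      have "x + a \<le> of_int m" using that by linarith
      then show "x + a - 1 - of_int m \<notin> half_nats" by (auto simp: half_nats_def)
    qed
    then show "\<exists>M. \<forall>m\<ge>M. B m v = 0" by blast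
  qed
qed

lemma hom_matrix_bounded:
  assumes B: "is_field B" "hom a B" and C: "is_field C" "hom b C"
  shows "matrix_bounded B C"
  unfolding matrix_bounded_def
proof (intro allI)
  fix c d
  let ?P = "\<lambda>c d. \<exists>k. \<forall>m n. m + n < k \<longrightarrow> cinner (B m (C n c)) d = 0"
  note cB = clinear_simps[OF is_fieldD[OF B(1)]] and cC = clinear_simps[OF is_fieldD[OF C(1)]]
  have c: "c \<in> cspan (\<Union>x\<in>half_nats. G x)" and d: "d \<in> cspan (\<Union>x\<in>half_nats. G x)"
    by (simp_all add: span_G)
  have P_c: "csubspace {c. ?P c d}" for d
  proof (rule complex_vector.subspaceI)
    fix c1 c2 assume "c1 \<in> {c. ?P c d}" "c2 \<in> {c. ?P c d}"
    then obtain k1 k2 where "\<And>m n. m + n < k1 \<Longrightarrow> cinner (B m (C n c1)) d = 0"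
      "\<And>m n. m + n < k2 \<Longrightarrow> cinner (B m (C n c2)) d = 0" by auto
    then show "c1 + c2 \<in> {c. ?P c d}"
      by (auto simp: cB cC cinner_add_left intro!: exI[of _ "min k1 k2"])
  next
    fix x c1 assume "c1 \<in> {c. ?P c d}"
    then obtain k1 where "\<And>m n. m + n < k1 \<Longrightarrow> cinner (B m (C n c1)) d = 0" by auto
    then show "x *\<^sub>C c1 \<in> {c. ?P c d}"
      by (auto simp: cB cC cinner_scaleC_left intro!: exI[of _ k1])
  qed (auto simp: cB cC cinner_simps)
  have P_d: "csubspace {d. ?P c d}" for c
  proof (rule complex_vector.subspaceI)
    fix c1 c2 assume "c1 \<in> {d. ?P c d}" "c2 \<in> {d. ?P c d}"
    then obtain k1 k2 where "\<And>m n. m + n < k1 \<Longrightarrow> cinner (B m (C n c)) c1 = 0"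
      "\<And>m n. m + n < k2 \<Longrightarrow> cinner (B m (C n c)) c2 = 0" by auto
    then show "c1 + c2 \<in> {d. ?P c d}"
      by (auto simp: cinner_simps intro!: exI[of _ "min k1 k2"])
  next
    fix x c1 assume "c1 \<in> {d. ?P c d}"
    then obtain k1 where "\<And>m n. m + n < k1 \<Longrightarrow> cinner (B m (C n c)) c1 = 0" by auto
    then show "x *\<^sub>C c1 \<in> {d. ?P c d}"
      by (auto simp: cinner_simps intro!: exI[of _ k1])
  qed (auto simp: cinner_simps)
  show "?P c d"
  proof (rule complex_vector.span_induct[OF c, of "\<lambda>c. ?P c d"], rule P_c)
    fix c assume "c \<in> (\<Union>x\<in>half_nats. G x)"
    then obtain x where x: "x \<in> half_nats" "c \<in> G x" by blast
    show "?P c d"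
    proof (rule complex_vector.span_induct[OF d, of "\<lambda>d. ?P c d"], rule P_d)
      fix d assume "d \<in> (\<Union>x\<in>half_nats. G x)"
      then obtain y where y: "y \<in> half_nats" "d \<in> G y" by blast
      \<comment> \<open>The vector has degree x + a + b - 2 - (m + n), which exceeds the degree of d
        when m + n is small; different degrees are orthogonal.\<close>
      have "cinner (B m (C n c)) d = 0" if "m + n < \<lfloor>x + a + b - 2 - y\<rfloor>" for m n
      proof -
        let ?y = "x + b - 1 - of_int n + a - 1 - of_int m"
        have D: "D (B m (C n c)) = of_real ?y *\<^sub>C B m (C n c)"
          by (rule hom_eigen[OF B hom_eigen[OF C G_eigen[OF x]]])
        have "of_int (m + n) < x + a + b - 2 - y" using that by linarith
        then have "?y \<noteq> y" by simp
        then show ?thesis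
          using eigenvector[OF D] G_orth[OF _ y(1) _ _ y(2)] cinner_simps(2) by (cases "?y \<in> half_nats") auto
      qed
      then show "?P c d" by blast
    qed
  qed
qed

lemma hom_subspace: "csubspace {B. hom a B}"
  by (rule complex_vector.subspaceI)
    (auto simp: hom_def clinear_simps[OF D] scaleC_add_right scaleC_fun_def scaleC_scaleC mult.commute add_ac)

text \<open>Elements of the field spaces are only sums of homogeneous fields. This class contains
  them and is still narrow enough for analytic and formal locality to agree on it.\<close>

definition graded_fields :: "'h modes set"
  where "graded_fields = cspan {B. is_field B \<and> (\<exists>a. hom a B)}"

lemma graded_field_truncated:
  assumes "B \<in> graded_fields"
  shows "is_field B" "truncated B"
proof -
  have "graded_fields \<subseteq> {B. is_field B \<and> truncated B}"
    unfolding graded_fields_def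
    by (rule complex_vector.span_minimal[OF _ is_field_truncated_subspace]) (auto intro: hom_truncated)
  then show "is_field B" "truncated B" using assms by auto
qed

lemma matrix_bounded_subspace_left: "csubspace {B. matrix_bounded B C}"
proof (rule complex_vector.subspaceI)
  show "0 \<in> {B. matrix_bounded B C}" by (auto simp: matrix_bounded_def cinner_simps)
next
  fix B1 B2 assume B: "B1 \<in> {B. matrix_bounded B C}" "B2 \<in> {B. matrix_bounded B C}"
  show "B1 + B2 \<in> {B. matrix_bounded B C}"
    unfolding mem_Collect_eq matrix_bounded_def
  proof (intro allI)
    fix c d
    obtain k1 k2 where "\<And>m n. m + n < k1 \<Longrightarrow> cinner (B1 m (C n c)) d = 0"
      "\<And>m n. m + n < k2 \<Longrightarrow> cinner (B2 m (C n c)) d = 0"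
      using B unfolding matrix_bounded_def by blast
    then show "\<exists>b. \<forall>m n. m + n < b \<longrightarrow> cinner ((B1 + B2) m (C n c)) d = 0"
      by (auto simp: cinner_add_left intro!: exI[of _ "min k1 k2"])
  qed
next
  fix x B1 assume "B1 \<in> {B. matrix_bounded B C}"
  then show "x *\<^sub>C B1 \<in> {B. matrix_bounded B C}"
    unfolding mem_Collect_eq matrix_bounded_def scaleC_fun_def cinner_scaleC_left mult_eq_0_iff by blast
qed

lemma matrix_bounded_subspace_right:
  assumes "is_field B"
  shows "csubspace {C. matrix_bounded B C}"
proof (rule complex_vector.subspaceI)
  note cB = clinear_simps[OF is_fieldD[OF assms]]
  show "0 \<in> {C. matrix_bounded B C}" by (auto simp: matrix_bounded_def cinner_simps cB)
next
  note cB = clinear_simps[OF is_fieldD[OF assms]]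
  fix C1 C2 assume C: "C1 \<in> {C. matrix_bounded B C}" "C2 \<in> {C. matrix_bounded B C}"
  show "C1 + C2 \<in> {C. matrix_bounded B C}"
    unfolding mem_Collect_eq matrix_bounded_def
  proof (intro allI)
    fix c d
    obtain k1 k2 where "\<And>m n. m + n < k1 \<Longrightarrow> cinner (B m (C1 n c)) d = 0"
      "\<And>m n. m + n < k2 \<Longrightarrow> cinner (B m (C2 n c)) d = 0"
      using C unfolding matrix_bounded_def by blast
    then show "\<exists>b. \<forall>m n. m + n < b \<longrightarrow> cinner (B m ((C1 + C2) n c)) d = 0"
      by (auto simp: cinner_add_left cB intro!: exI[of _ "min k1 k2"])
  qed
next
  note cB = clinear_simps[OF is_fieldD[OF assms]]
  fix x C1 assume "C1 \<in> {C. matrix_bounded B C}"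
  then show "x *\<^sub>C C1 \<in> {C. matrix_bounded B C}"
    unfolding mem_Collect_eq matrix_bounded_def scaleC_fun_def cB(2) cinner_scaleC_left mult_eq_0_iff by blast
qed

lemma graded_matrix_bounded:
  assumes "B \<in> graded_fields" "C \<in> graded_fields"
  shows "matrix_bounded B C"
proof -
  have 1: "matrix_bounded B C" if C: "is_field C" "hom b C" for C b
  proof -
    have "graded_fields \<subseteq> {B. matrix_bounded B C}"
      unfolding graded_fields_def
      by (rule complex_vector.span_minimal[OF _ matrix_bounded_subspace_left]) (auto intro: hom_matrix_bounded C)
    then show ?thesis using assms by auto
  qed
  have "graded_fields \<subseteq> {C. matrix_bounded B C}"
    unfolding graded_fields_def
    by (rule complex_vector.span_minimal[OF _ matrix_bounded_subspace_right[OF graded_field_truncated(1)[OF assms(1)]]])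
      (auto intro: 1)
  then show ?thesis using assms by auto
qed

lemma local_with_sign_iff:
  assumes "B \<in> graded_fields" "C \<in> graded_fields"
  shows "local_with_sign \<epsilon> B C \<longleftrightarrow> local_modes (parity_sign \<epsilon>) B C"
  using local_with_sign_imp_local_modes[of B C \<epsilon>] local_modes_imp_local_with_sign[of B C \<epsilon>]
    graded_field_truncated[OF assms(1)] graded_field_truncated[OF assms(2)]
    graded_matrix_bounded[OF assms] graded_matrix_bounded[OF assms(2,1)] by blast

lemma hom_A: "i \<in> {1..r} \<Longrightarrow> hom (of_int (deg i) / 2) (A i)"
  using D_A unfolding hom_def by blast

lemma hom_graded: "is_field B \<Longrightarrow> hom a B \<Longrightarrow> B \<in> graded_fields"
  unfolding graded_fields_def by (intro complex_vector.span_base) auto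

lemma graded_A: "i \<in> {1..r} \<Longrightarrow> A i \<in> graded_fields"
  by (blast intro: hom_graded field_A hom_A)

text \<open>The last condition asks for locality with the generators as if \<open>B\<close> had parity \<open>\<epsilon>\<close>.\<close>

definition vertex_fields :: "bit \<Rightarrow> 'h modes set"
  where "vertex_fields \<epsilon> = {B. B \<in> graded_fields
    \<and> (\<forall>m v. T (B m v) = B m (T v) + of_int (- m) *\<^sub>C B (m - 1) v)
    \<and> (\<forall>m\<ge>0. B m \<Omega> = 0)
    \<and> (\<forall>i\<in>{1..r}. local_modes (parity_sign (\<epsilon> * e i)) B (A i))}"

lemma vertex_fieldsD:
  assumes "B \<in> vertex_fields \<epsilon>"
  shows "B \<in> graded_fields" "is_field B" "truncated B"
    "T (B m v) = B m (T v) + of_int (- m) *\<^sub>C B (m - 1) v" "m \<ge> 0 \<Longrightarrow> B m \<Omega> = 0"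
    "i \<in> {1..r} \<Longrightarrow> local_modes (parity_sign (\<epsilon> * e i)) B (A i)"
  using assms graded_field_truncated unfolding vertex_fields_def by auto

lemma vertex_fields_subspace: "csubspace (vertex_fields \<epsilon>)"
proof -
  have "csubspace graded_fields" unfolding graded_fields_def by simp
  note gr = csubspaceD[OF this]
  have lo: "csubspace {B. local_modes (parity_sign (\<epsilon> * e i)) B (A i)}" if "i \<in> {1..r}" for i
    by (rule local_modes_subspace_left[OF field_A[OF that]])
  note lo = csubspaceD[OF lo, simplified mem_Collect_eq]
  show ?thesis
  proof (rule complex_vector.subspaceI)
    show "0 \<in> vertex_fields \<epsilon>"
      unfolding vertex_fields_def using gr(1) lo(1) by (auto simp: clinear_simps[OF T])
  next
    fix B C assume "B \<in> vertex_fields \<epsilon>" "C \<in> vertex_fields \<epsilon>"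
    then show "B + C \<in> vertex_fields \<epsilon>"
      unfolding vertex_fields_def using gr(2) lo(2)
      by (auto simp: clinear_simps[OF T] complex_vector.scale_right_diff_distrib scaleC_add_right algebra_simps)
  next
    fix c B assume "B \<in> vertex_fields \<epsilon>"
    then show "c *\<^sub>C B \<in> vertex_fields \<epsilon>"
      unfolding vertex_fields_def using gr(3) lo(3)
      by (auto simp: clinear_simps[OF T] complex_vector.scale_right_diff_distrib scaleC_fun_def
          scaleC_scaleC mult.commute)
  qed
qed

lemma annihilator:
  assumes B: "B \<in> vertex_fields \<epsilon>" and v: "v \<noteq> 0" "\<And>m. B m v = 0"
  shows "B = 0"
proof -
  define W where "W = {v. \<forall>m. B m v = 0}"
  note cB = clinear_simps[OF is_fieldD[OF vertex_fieldsD(2)[OF B]]]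
  have "csubspace W"
    by (rule complex_vector.subspaceI) (auto simp: W_def cB)
  moreover have "A i n v \<in> W" if i: "i \<in> {1..r}" and v: "v \<in> W" for i n v
  proof -
    note cA = clinear_simps[OF is_fieldD[OF field_A[OF i]]]
    obtain N where N: "(diff_mul ^^ N) (\<lambda>k l. B k (A i l v) - parity_sign (\<epsilon> * e i) *\<^sub>C A i l (B k v)) = (\<lambda>k l. 0)"
      using vertex_fieldsD(6)[OF B i] unfolding local_modes_def by blast
    \<comment> \<open>On v the second order of the product vanishes, so locality leaves (z - w)^N
      B(z) A_i(w) v = 0. Truncation of the generator then permits cancelling the power of z -
      w.\<close>
    have "(\<lambda>k l. B k (A i l v) - parity_sign (\<epsilon> * e i) *\<^sub>C A i l (B k v)) = (\<lambda>k l. B k (A i l v))"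
      using v by (simp add: W_def cA)
    then have "(diff_mul ^^ N) (\<lambda>k l. B k (A i l v)) = (\<lambda>k l. 0)" using N by simp
    from diff_mul_funpow_inject[OF bounded_right_AB[OF vertex_fieldsD(2)[OF B] hom_truncated[OF field_A[OF i] hom_A[OF i]]] this]
    show ?thesis by (simp add: W_def)
  qed
  ultimately have "W = {0} \<or> W = UNIV" by (rule irreducibleD)
  moreover have "v \<in> W" using v by (simp add: W_def)
  ultimately have "W = UNIV" using v(1) by auto
  then show ?thesis unfolding W_def by (auto simp: fun_eq_iff)
qed

lemma vacuum_separating:
  assumes B: "B \<in> vertex_fields \<epsilon>" and 0: "B (- 1) \<Omega> = 0"
  shows "B = 0"
proof (rule annihilator[OF B vac_nonzero])
  fix m
  note cB = clinear_simps[OF is_fieldD[OF vertex_fieldsD(2)[OF B]]]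
  \<comment> \<open>As \<open>T\<close> kills the vacuum, covariance gives T B(-1-j) \<Omega> = (j +
    1) B(-2-j) \<Omega>, and the factor j + 1 is nonzero.\<close>
  have neg: "B (- 1 - int j) \<Omega> = 0" for j
  proof (induction j)
    case (Suc j)
    have "T (B (- 1 - int j) \<Omega>) = of_nat (Suc j) *\<^sub>C B (- 1 - int (Suc j)) \<Omega>"
      using vertex_fieldsD(4)[OF B, of "- 1 - int j" \<Omega>] by (simp add: vac_T cB algebra_simps)
    then have "of_nat (Suc j) *\<^sub>C B (- 1 - int (Suc j)) \<Omega> = 0"
      by (simp only: Suc.IH clinear_simps[OF T])
    then show ?case
      by (simp only: complex_vector.scale_eq_0_iff of_nat_eq_0_iff) simp
  qed (simp add: 0)
  show "B m \<Omega> = 0"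
  proof (cases "m \<ge> 0")
    case False
    then show ?thesis using neg[of "nat (- 1 - m)"] by simp
  qed (rule vertex_fieldsD(5)[OF B])
qed

text \<open>A homogeneous field whose parity is that of twice its degree and that is local with
  \<^emph>\<open>every\<close> vertex field; the latter is what makes a single induction over the
  generated fields suffice.\<close>

definition good :: "bit \<Rightarrow> 'h modes \<Rightarrow> bool"
  where "good \<epsilon> B \<longleftrightarrow> B \<in> vertex_fields \<epsilon> \<and> (\<exists>k :: int. hom (of_int k / 2) B \<and> of_int k = \<epsilon>)
    \<and> (\<forall>\<delta>. \<forall>C\<in>vertex_fields \<delta>. local_modes (parity_sign (\<epsilon> * \<delta>)) B C)"

lemma goodD:
  assumes "good \<epsilon> B"
  shows "B \<in> vertex_fields \<epsilon>" "\<exists>k :: int. hom (of_int k / 2) B \<and> of_int k = \<epsilon>"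
    "C \<in> vertex_fields \<delta> \<Longrightarrow> local_modes (parity_sign (\<epsilon> * \<delta>)) B C"
  using assms unfolding good_def by blast+

text \<open>The zero field is homogeneous of every degree and so carries both parities; it is the
  exceptional case in \<open>good_parity\<close>.\<close>

lemma good_zero: "good \<epsilon> 0"
  unfolding good_def
proof (intro conjI allI ballI)
  show "0 \<in> vertex_fields \<epsilon>" by (rule csubspaceD(1)[OF vertex_fields_subspace])
  show "\<exists>k :: int. hom (of_int k / 2) 0 \<and> of_int k = \<epsilon>"
    using csubspaceD(1)[OF hom_subspace] by (intro exI[of _ "of_bool (\<epsilon> = 1)"]) (cases \<epsilon>; simp)
  show "local_modes (parity_sign (\<epsilon> * \<delta>)) 0 C" if "C \<in> vertex_fields \<delta>" for \<delta> C
    using csubspaceD(1)[OF local_modes_subspace_left[OF vertex_fieldsD(2)[OF that]]] by simp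
qed

lemma vertex_fields_A: "i \<in> {1..r} \<Longrightarrow> A i \<in> vertex_fields (e i)"
  unfolding vertex_fields_def
  using graded_A T_A vac_A local_A local_with_sign_iff by auto

text \<open>Membership in \<open>vertex_fields\<close> includes locality with the generators, so
  symmetry of locality gives the condition on all vertex fields at once.\<close>

lemma good_A:
  assumes "i \<in> {1..r}"
  shows "good (e i) (A i)"
  unfolding good_def
proof (intro conjI allI ballI)
  show "A i \<in> vertex_fields (e i)" by (rule vertex_fields_A[OF assms])
  show "\<exists>k :: int. hom (of_int k / 2) (A i) \<and> of_int k = e i"
    using hom_A[OF assms] parity_A[OF assms] by blast
  show "local_modes (parity_sign (e i * \<delta>)) (A i) C" if "C \<in> vertex_fields \<delta>" for \<delta> C
    using local_modes_sym[OF vertex_fieldsD(6)[OF that assms] parity_sign_square] by (simp only: mult.commute)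
qed

lemma local_modes_id: "is_field C \<Longrightarrow> local_modes (parity_sign 0) id_field C"
  unfolding local_modes_def
  by (intro exI[of _ 0])
    (auto simp: fun_eq_iff id_field_def parity_sign_def scaleC_one clinear_simps(3)[OF is_fieldD])

lemma good_id: "good 0 id_field"
  unfolding good_def
proof (intro conjI allI ballI)
  have hom: "hom 0 id_field"
    unfolding hom_def id_field_def by (auto simp: clinear_simps[OF D])
  have fld: "is_field (id_field :: 'h modes)"
    unfolding is_field_def id_field_def by (auto intro: clinearI)
  show "id_field \<in> vertex_fields 0"
    unfolding vertex_fields_def
  proof (intro CollectI conjI allI impI ballI)
    show "id_field \<in> graded_fields" by (rule hom_graded[OF fld hom])
    show "T (id_field m v) = id_field m (T v) + of_int (- m) *\<^sub>C id_field (m - 1) v" for m v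
      by (auto simp: id_field_def clinear_simps[OF T])
    show "local_modes (parity_sign (0 * e i)) id_field (A i)" if "i \<in> {1..r}" for i
      using local_modes_id[OF field_A[OF that]] by simp
  qed (auto simp: id_field_def)
  show "\<exists>k :: int. hom (of_int k / 2) id_field \<and> of_int k = (0 :: bit)"
    using hom by (intro exI[of _ 0]) simp
  show "local_modes (parity_sign (0 * \<delta>)) id_field C" if "C \<in> vertex_fields \<delta>" for \<delta> C
    using local_modes_id[OF vertex_fieldsD(2)[OF that]] by simp
qed

lemma deriv_field_is_field: "is_field B \<Longrightarrow> is_field (deriv_field B)"
  unfolding is_field_def deriv_field_def
  by (auto intro!: clinearI simp: clinear_simps(1,2)[OF is_fieldD] is_field_def scaleC_add_right scaleC_scaleC mult.commute)

lemma good_deriv: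
  assumes "good \<epsilon> B"
  shows "good \<epsilon> (deriv_field B)"
  unfolding good_def
proof (intro conjI allI ballI)
  note B = vertex_fieldsD[OF goodD(1)[OF assms]]
  note cB = clinear_simps[OF is_fieldD[OF B(2)]]
  obtain k :: int where k: "hom (of_int k / 2) B" "of_int k = \<epsilon>" using goodD(2)[OF assms] by blast
  \<comment> \<open>Differentiation raises the degree by 1, hence twice the degree by 2, and the
    parity stays.\<close>
  have hom: "hom (of_int (k + 2) / 2) (deriv_field B)"
    unfolding hom_def
  proof (intro allI)
    fix m v
    have "D (B (m - 1) v) = B (m - 1) (D v) + (of_real (of_int k / 2) - 1 - of_int (m - 1)) *\<^sub>C B (m - 1) v"
      using k(1) unfolding hom_def by blast
    moreover have "(of_real (of_int k / 2) - 1 - of_int (m - 1)) = (of_real (of_int (k + 2) / 2) - 1 - of_int m :: complex)"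
      by (simp add: add_divide_distrib)
    ultimately show "D (deriv_field B m v) = deriv_field B m (D v) + (of_real (of_int (k + 2) / 2) - 1 - of_int m) *\<^sub>C deriv_field B m v"
      unfolding deriv_field_def clinear_simps(2)[OF D] by (simp only: scaleC_add_right scaleC_scaleC mult.commute)
  qed
  have "(of_int (k + 2) :: bit) = \<epsilon>" using k(2) by (simp add: of_int_bit)
  with hom show "\<exists>k :: int. hom (of_int k / 2) (deriv_field B) \<and> of_int k = \<epsilon>" by blast
  show "deriv_field B \<in> vertex_fields \<epsilon>"
    unfolding vertex_fields_def
  proof (intro CollectI conjI allI impI ballI)
    show "deriv_field B \<in> graded_fields" by (rule hom_graded[OF deriv_field_is_field[OF B(2)] hom])
    show "T (deriv_field B m v) = deriv_field B m (T v) + of_int (- m) *\<^sub>C deriv_field B (m - 1) v" for m v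
      unfolding deriv_field_def clinear_simps(2)[OF T] B(4) by (simp add: scaleC_add_right)
    show "deriv_field B m \<Omega> = 0" if "m \<ge> 0" for m
      using B(5)[of "m - 1"] that by (cases "m = 0") (simp_all add: deriv_field_def)
    show "local_modes (parity_sign (\<epsilon> * e i)) (deriv_field B) (A i)" if "i \<in> {1..r}" for i
      by (rule local_modes_deriv[OF B(6)[OF that] field_A[OF that]])
  qed
  show "local_modes (parity_sign (\<epsilon> * \<delta>)) (deriv_field B) C" if "C \<in> vertex_fields \<delta>" for \<delta> C
    by (rule local_modes_deriv[OF goodD(3)[OF assms that] vertex_fieldsD(2)[OF that]])
qed

text \<open>The sign \<open>s\<close> is left arbitrary because generated fields may be multiplied
  with any sign for which they are local. In Dong's lemma only the signs relative to the third field
  multiply, so parities add independently of \<open>s\<close>.\<close>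

lemma good_nprod:
  assumes B: "good \<epsilon> B" and C: "good \<delta> C" and loc: "local_modes s B C"
  shows "good (\<epsilon> + \<delta>) (nprod s B n C)"
  unfolding good_def
proof (intro conjI allI ballI)
  note vB = vertex_fieldsD[OF goodD(1)[OF B]] and vC = vertex_fieldsD[OF goodD(1)[OF C]]
  obtain k :: int where k: "hom (of_int k / 2) B" "of_int k = \<epsilon>" using goodD(2)[OF B] by blast
  obtain l :: int where l: "hom (of_int l / 2) C" "of_int l = \<delta>" using goodD(2)[OF C] by blast
  have fld: "is_field (nprod s B n C)"
    by (rule nprod_is_field[OF vB(2) vC(2) vB(3) vC(3)])
  \<comment> \<open>Twice the degree k/2 + l/2 - n - 1 of the product; it is congruent to k + l
    modulo 2.\<close>
  let ?j = "k + l - 2 * n - 2"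
  have hom: "hom (of_int ?j / 2) (nprod s B n C)"
    unfolding hom_def
  proof (intro allI)
    fix m v
    have "D (nprod s B n C m v) = nprod s B n C m (D v)
      + ((of_real (of_int k / 2) - 1) + (of_real (of_int l / 2) - 1) - of_int n - of_int m) *\<^sub>C nprod s B n C m v"
      by (rule nprod_degree[OF vB(2) vC(2) vB(3) vC(3) D]) (use k(1) l(1) in \<open>unfold hom_def, blast+\<close>)
    moreover have "(of_real (of_int k / 2) - 1) + (of_real (of_int l / 2) - 1) - of_int n - of_int m
      = (of_real (of_int ?j / 2) - 1 - of_int m :: complex)"
      by (simp add: field_simps)
    ultimately show "D (nprod s B n C m v) = nprod s B n C m (D v)
      + (of_real (of_int ?j / 2) - 1 - of_int m) *\<^sub>C nprod s B n C m v" by simp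
  qed
  have "(of_int ?j :: bit) = of_int (k + l)" by (simp only: of_int_bit) simp
  also have "\<dots> = \<epsilon> + \<delta>" by (simp only: of_int_add k(2) l(2))
  finally show "\<exists>k :: int. hom (of_int k / 2) (nprod s B n C) \<and> of_int k = \<epsilon> + \<delta>" using hom by blast
  show "nprod s B n C \<in> vertex_fields (\<epsilon> + \<delta>)"
    unfolding vertex_fields_def
  proof (intro CollectI conjI allI impI ballI)
    show "nprod s B n C \<in> graded_fields" by (rule hom_graded[OF fld hom])
    show "T (nprod s B n C m v) = nprod s B n C m (T v) + of_int (- m) *\<^sub>C nprod s B n C (m - 1) v" for m v
      by (rule nprod_translation[OF vB(2) vC(2) vB(3) vC(3) T vB(4) vC(4)])
    show "nprod s B n C m \<Omega> = 0" if "m \<ge> 0" for m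
      by (rule nprod_vacuum(1)[OF vB(2) vC(2) vB(5) vC(5) that])
    show "local_modes (parity_sign ((\<epsilon> + \<delta>) * e i)) (nprod s B n C) (A i)" if i: "i \<in> {1..r}" for i
      using dong[OF vB(2) vC(2) field_A[OF i] vB(3) vC(3) hom_truncated[OF field_A[OF i] hom_A[OF i]]
          loc vB(6)[OF i] vC(6)[OF i]]
      by (simp only: parity_sign_mult distrib_right)
  qed
  show "local_modes (parity_sign ((\<epsilon> + \<delta>) * \<eta>)) (nprod s B n C) E" if E: "E \<in> vertex_fields \<eta>" for \<eta> E
    using dong[OF vB(2) vC(2) vertex_fieldsD(2)[OF E] vB(3) vC(3) vertex_fieldsD(3)[OF E]
        loc goodD(3)[OF B E] goodD(3)[OF C E]]
    by (simp only: parity_sign_mult distrib_right)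
qed

section \<open>Generated fields and their parity\<close>

abbreviation "gen \<equiv> generated_fields (A ` {1..r})"
abbreviation "fs \<equiv> field_space (A ` {1..r})"
abbreviation "fsp \<equiv> field_space_parity (A ` {1..r})"
abbreviation "V \<equiv> state_field (A ` {1..r}) \<Omega>"

lemma nth_product_graded:
  assumes "B \<in> graded_fields" "C \<in> graded_fields"
  shows "nth_product \<epsilon> B n C = nprod (parity_sign \<epsilon>) B n C"
  using nth_product_eq_nprod graded_field_truncated assms by blast

lemma generated_good: "B \<in> gen \<Longrightarrow> \<exists>\<epsilon>. good \<epsilon> B"
proof (induction rule: generated_fields.induct)
  case gen_id
  then show ?case using good_id by blast
next
  case (gen_base B)
  then show ?case using good_A by blast
next
  case (gen_product B C \<epsilon> n)
  then obtain \<delta> \<eta> where B: "good \<delta> B" and C: "good \<eta> C" by blast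
  note g = vertex_fieldsD(1)[OF goodD(1)[OF B]] vertex_fieldsD(1)[OF goodD(1)[OF C]]
  have "local_modes (parity_sign \<epsilon>) B C"
    using gen_product local_with_sign_iff[OF g] by blast
  from good_nprod[OF B C this, of n] show ?case
    by (auto simp: nth_product_graded[OF g])
next
  case (gen_deriv B)
  then show ?case using good_deriv by blast
qed

lemma good_local:
  assumes "good \<epsilon> B" "good \<delta> C"
  shows "local_with_sign (\<epsilon> * \<delta>) B C"
  using local_with_sign_iff[OF vertex_fieldsD(1)[OF goodD(1)[OF assms(1)]] vertex_fieldsD(1)[OF goodD(1)[OF assms(2)]]]
    goodD(3)[OF assms(1) goodD(1)[OF assms(2)]] by blast

lemma good_local_self:
  assumes "good \<epsilon> B"
  shows "local_with_sign \<epsilon> B B"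
  using good_local[OF assms assms] by (simp only: bit_mult_self)

text \<open>A nonzero field cannot be local with itself for both signs: otherwise \<open>B(z) B(w) = 0\<close>, and
  \<open>B(-1) \<Omega>\<close> is annihilated by all modes of \<open>B\<close>.\<close>

lemma good_parity:
  assumes B: "good \<delta> B" and loc: "local_with_sign \<epsilon> B B"
  shows "good \<epsilon> B"
proof (cases "\<epsilon> = \<delta>")
  case False
  note vB = vertex_fieldsD[OF goodD(1)[OF B]]
  have sign: "parity_sign \<epsilon> = - parity_sign \<delta>"
    using False by (cases \<epsilon>; cases \<delta>) (auto simp: parity_sign_def)
  obtain N1 where N1: "\<And>v. (diff_mul ^^ N1) (\<lambda>k l. B k (B l v) - parity_sign \<epsilon> *\<^sub>C B l (B k v)) = (\<lambda>k l. 0)"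
    using loc local_with_sign_iff[OF vB(1) vB(1)] unfolding local_modes_def by blast
  obtain N2 where N2: "\<And>v. (diff_mul ^^ N2) (\<lambda>k l. B k (B l v) - parity_sign \<delta> *\<^sub>C B l (B k v)) = (\<lambda>k l. 0)"
    using good_local_self[OF B] local_with_sign_iff[OF vB(1) vB(1)] unfolding local_modes_def by blast
  have BB: "B k (B l v) = 0" for k l v
  proof -
    \<comment> \<open>The two signs are opposite, so the average of the two brackets is B(z) B(w)
      itself. Locality with both signs kills it after a power of z - w, and that power
      cancels.\<close>
    have "(\<lambda>k l. B k (B l v)) = (\<lambda>k l. (1 / 2) *\<^sub>C (B k (B l v) - parity_sign \<epsilon> *\<^sub>C B l (B k v))
        + (1 / 2) *\<^sub>C (B k (B l v) - parity_sign \<delta> *\<^sub>C B l (B k v)))"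
      by (simp add: fun_eq_iff sign scaleC_one flip: scaleC_add_right complex_vector.scale_left_distrib)
        (simp add: scaleC_add_right scaleC_one flip: complex_vector.scale_left_distrib)
    then have "(diff_mul ^^ max N1 N2) (\<lambda>k l. B k (B l v)) = (\<lambda>k l. 0)"
      by (simp only: diff_mul_funpow_lin diff_mul_funpow_mono[OF N1, of "max N1 N2"]
          diff_mul_funpow_mono[OF N2, of "max N1 N2"] max.cobounded1 max.cobounded2) simp
    from diff_mul_funpow_inject[OF bounded_right_AB[OF vB(2,3)] this] show ?thesis .
  qed
  have "B = 0"
  proof (cases "B (- 1) \<Omega> = 0")
    case True
    then show ?thesis by (rule vacuum_separating[OF goodD(1)[OF B]])
  next
    case False
    then show ?thesis by (rule annihilator[OF goodD(1)[OF B]]) (rule BB)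
  qed
  then show ?thesis using good_zero by simp
qed (use B in simp)

text \<open>This replaces the self-locality in the definition by the parity that governs locality
  with all other fields. The two agree by \<open>good_parity\<close>, the zero field having both
  parities.\<close>

lemma fsp_eq: "fsp \<epsilon> = cspan {B \<in> gen. good \<epsilon> B}"
proof -
  have "{B \<in> gen. local_with_sign \<epsilon> B B} = {B \<in> gen. good \<epsilon> B}"
    using generated_good good_parity good_local_self by blast
  then show ?thesis unfolding field_space_parity_def by simp
qed

lemma fsp_subspace: "csubspace (fsp \<epsilon>)"
  unfolding fsp_eq by simp

lemma gen_fsp: "B \<in> gen \<Longrightarrow> good \<epsilon> B \<Longrightarrow> B \<in> fsp \<epsilon>"
  unfolding fsp_eq by (intro complex_vector.span_base) simp

lemma fsp_vertex_fields: "fsp \<epsilon> \<subseteq> vertex_fields \<epsilon>"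
  unfolding fsp_eq
  by (rule complex_vector.span_minimal[OF _ vertex_fields_subspace]) (auto dest: goodD(1))

lemma fsp_induct:
  assumes "B \<in> fsp \<epsilon>" "csubspace {B. P B}" "\<And>B. B \<in> gen \<Longrightarrow> good \<epsilon> B \<Longrightarrow> P B"
  shows "P B"
  using complex_vector.span_induct[of B "{B \<in> gen. good \<epsilon> B}" P] assms unfolding fsp_eq by auto

lemma fsp_subset: "fsp \<epsilon> \<subseteq> fs"
  unfolding field_space_def
proof
  fix B assume B: "B \<in> fsp \<epsilon>"
  note z = csubspaceD(1)[OF fsp_subspace]
  show "B \<in> {B + C |B C. B \<in> fsp 0 \<and> C \<in> fsp 1}"
    using B z[of 0] z[of 1] by (cases \<epsilon>) (auto intro: exI[of _ 0] exI[of _ B])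
qed

lemma fs_subspace: "csubspace fs"
proof -
  have "fs = {B + C |B C. B \<in> fsp 0 \<and> C \<in> fsp 1}" by (simp add: field_space_def)
  then show ?thesis
    using complex_vector.subspace_sums[OF fsp_subspace fsp_subspace, of 0 1] by simp
qed

section \<open>The state-field correspondence\<close>

abbreviation "R \<equiv> vacuum_value \<Omega>"

lemma R_lin: "R (B + C) = R B + R C" "R (c *\<^sub>C B) = c *\<^sub>C R B"
  by (simp_all add: vacuum_value_def scaleC_fun_def)

abbreviation "Hs \<equiv> parity_part G"

lemma Hs_subspace: "csubspace (Hs \<epsilon>)"
  unfolding parity_part_def by simp

lemma hom_vacuum_value:
  assumes "is_field B" "hom a B"
  shows "D (R B) = of_real a *\<^sub>C R B"
  using hom_eigen[OF assms, of \<Omega> 0 "- 1"] vac_D by (simp add: vacuum_value_def)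

text \<open>The vacuum value is an eigenvector of \<open>D\<close> whose eigenvalue is the degree of
  the field. If that is not an admissible degree, the value is 0; otherwise twice the degree has
  residue \<epsilon>.\<close>

lemma good_vacuum_value:
  assumes "good \<epsilon> B"
  shows "R B \<in> Hs \<epsilon>"
proof -
  obtain k :: int where k: "hom (of_int k / 2) B" "of_int k = \<epsilon>" using goodD(2)[OF assms] by blast
  note eig = eigenvector[OF hom_vacuum_value[OF vertex_fieldsD(2)[OF goodD(1)[OF assms]] k(1)]]
  show ?thesis
  proof (cases "real_of_int k / 2 \<in> half_nats")
    case True
    then have "R B \<in> (\<Union>n\<in>shifted_nats \<epsilon>. G n)"
      using eig(1) half_int_in_shifted_nats k(2) by blast
    then show ?thesis unfolding parity_part_def by (rule complex_vector.span_base)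
  next
    case False
    then show ?thesis using eig(2) csubspaceD(1)[OF Hs_subspace] by simp
  qed
qed

lemma fsp_vacuum_value: "B \<in> fsp \<epsilon> \<Longrightarrow> R B \<in> Hs \<epsilon>"
proof (erule fsp_induct)
  show "csubspace {B. R B \<in> Hs \<epsilon>}"
    by (rule complex_vector.subspaceI)
      (auto simp: R_lin csubspaceD[OF Hs_subspace] vacuum_value_def scaleC_fun_def)
qed (rule good_vacuum_value)

text \<open>The two parity spaces are spanned by distinct degrees and hence orthogonal, so a common
  vector is orthogonal to itself.\<close>

lemma Hs_disjoint: "Hs 0 \<inter> Hs 1 \<subseteq> {0}"
proof
  fix v assume v: "v \<in> Hs 0 \<inter> Hs 1"
  have 1: "cinner v w = 0" if w: "w \<in> (\<Union>n\<in>shifted_nats 1. G n)" for w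
  proof (rule orth_span)
    show "v \<in> cspan (\<Union>n\<in>shifted_nats 0. G n)" using v by (simp add: parity_part_def)
    fix x assume "x \<in> (\<Union>n\<in>shifted_nats 0. G n)"
    then show "cinner x w = 0"
      using w G_orth shifted_nats_disjoint shifted_nats_subset by blast
  qed
  have "cinner v v = 0"
  proof (rule orth_span)
    show "v \<in> cspan (\<Union>n\<in>shifted_nats 1. G n)" using v by (simp add: parity_part_def)
    show "cinner x v = 0" if "x \<in> (\<Union>n\<in>shifted_nats 1. G n)" for x
      using 1[OF that] cinner_commute[of x v] by simp
  qed
  then show "v \<in> {0}" using cinner_pos[of v] by force
qed

lemma fs_cases:
  assumes "B \<in> fs"
  obtains B0 B1 where "B0 \<in> fsp 0" "B1 \<in> fsp 1" "B = B0 + B1"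
  using assms unfolding field_space_def by blast

lemma fsp_eq_0: "B \<in> fsp \<epsilon> \<Longrightarrow> R B = 0 \<Longrightarrow> B = 0"
  using vacuum_separating fsp_vertex_fields unfolding vacuum_value_def by blast

text \<open>Separation by the vacuum is available for a fixed parity. If the two parts have opposite
  vacuum values, these lie in both parity spaces and vanish one by one.\<close>

lemma R_eq_0:
  assumes "B \<in> fs" "R B = 0"
  shows "B = 0"
proof -
  obtain B0 B1 where B: "B0 \<in> fsp 0" "B1 \<in> fsp 1" "B = B0 + B1" using fs_cases[OF assms(1)] .
  have "R B0 = (- 1) *\<^sub>C R B1"
    using assms(2) by (simp add: B(3) R_lin scaleC_one eq_neg_iff_add_eq_0)
  then have "R B0 \<in> Hs 0 \<inter> Hs 1"
    using fsp_vacuum_value[OF B(1)] csubspaceD(3)[OF Hs_subspace fsp_vacuum_value[OF B(2)], of "- 1"] by simp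
  then have "R B0 = 0" using Hs_disjoint by blast
  moreover from this have "R B1 = 0" using assms(2) by (simp add: B(3) R_lin)
  ultimately show ?thesis using fsp_eq_0[OF B(1)] fsp_eq_0[OF B(2)] B(3) by simp
qed

lemma R_inj: "inj_on R fs"
proof (rule inj_onI)
  fix B C assume BC: "B \<in> fs" "C \<in> fs" "R B = R C"
  have "R (B - C) = 0" using BC(3) by (simp add: vacuum_value_def)
  then have "B - C = 0" using R_eq_0 csubspaceD(4)[OF fs_subspace BC(1,2)] by blast
  then show "B = C" by simp
qed

lemma span_R_gen: "cspan (R ` gen) = UNIV"
proof -
  have "cspan (R ` gen) = {0} \<or> cspan (R ` gen) = UNIV"
  proof (rule irreducibleD)
    fix i m v assume i: "i \<in> {1..r}" and v: "v \<in> cspan (R ` gen)"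
    note cA = clinear_simps[OF is_fieldD[OF field_A[OF i]]]
    show "A i m v \<in> cspan (R ` gen)"
    proof (rule complex_vector.span_induct[OF v, of "\<lambda>v. A i m v \<in> cspan (R ` gen)"])
      show "csubspace {v. A i m v \<in> cspan (R ` gen)}"
        by (rule complex_vector.subspaceI)
          (auto simp: cA complex_vector.span_add complex_vector.span_scale complex_vector.span_zero)
      fix v assume "v \<in> R ` gen"
      then obtain B where B: "B \<in> gen" "v = R B" by blast
      obtain \<epsilon> where g: "good \<epsilon> B" using generated_good[OF B(1)] by blast
      note vB = vertex_fieldsD[OF goodD(1)[OF g]] and vA = vertex_fieldsD[OF vertex_fields_A[OF i]]
      have "nth_product (e i * \<epsilon>) (A i) m B \<in> gen"
        by (rule gen_product[OF gen_base[OF imageI[OF i]] B(1) good_local[OF good_A[OF i] g]])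
      moreover have "R (nth_product (e i * \<epsilon>) (A i) m B) = A i m v"
        unfolding nth_product_graded[OF vA(1) vB(1)] vacuum_value_def B(2)
        by (rule nprod_vacuum(2)[OF vA(2) vB(2) vA(5) vB(5)])
      ultimately show "A i m v \<in> cspan (R ` gen)"
        by (metis complex_vector.span_base image_eqI)
    qed
  qed simp
  moreover have "\<Omega> \<in> R ` gen"
    by (rule image_eqI[of _ _ id_field]) (simp_all add: gen_id vacuum_value_def id_field_def)
  then have "\<Omega> \<in> cspan (R ` gen)" by (rule complex_vector.span_base)
  ultimately show ?thesis using vac_nonzero by auto
qed

lemma gen_fs: "gen \<subseteq> fs"
  using generated_good gen_fsp fsp_subset by blast

lemma R_surj: "R ` fs = UNIV"
proof -
  have "csubspace (R ` fs)"
  proof (rule complex_vector.subspaceI)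
    have "R 0 = 0" by (simp add: vacuum_value_def)
    then show "0 \<in> R ` fs" using csubspaceD(1)[OF fs_subspace] by (metis imageI)
    show "x + y \<in> R ` fs" if "x \<in> R ` fs" "y \<in> R ` fs" for x y
      using that csubspaceD(2)[OF fs_subspace] by (auto simp flip: R_lin)
    show "c *\<^sub>C x \<in> R ` fs" if "x \<in> R ` fs" for c x
      using that csubspaceD(3)[OF fs_subspace] by (auto simp flip: R_lin)
  qed
  then have "cspan (R ` gen) \<subseteq> R ` fs"
    using gen_fs by (intro complex_vector.span_minimal) auto
  then show ?thesis using span_R_gen by auto
qed

lemma V_fs: "V a \<in> fs"
  unfolding state_field_def by (rule inv_into_into) (simp add: R_surj)

lemma R_V: "R (V a) = a"
  unfolding state_field_def by (rule f_inv_into_f[where f = R and A = fs]) (simp add: R_surj)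

lemma V_R: "B \<in> fs \<Longrightarrow> V (R B) = B"
  unfolding state_field_def by (rule inv_into_f_f[OF R_inj])

lemma range_V: "range V = fs"
  using V_fs V_R by (metis (no_types, lifting) image_subset_iff rangeI subsetI subset_antisym)

lemma V_linear: "clinear V"
proof (rule clinearI)
  show "V (x + y) = V x + V y" for x y
    using V_R[OF csubspaceD(2)[OF fs_subspace V_fs V_fs, of x y]] by (simp add: R_lin R_V)
  show "V (c *\<^sub>C x) = c *\<^sub>C V x" for c x
    using V_R[OF csubspaceD(3)[OF fs_subspace V_fs, of c x]] by (simp add: R_lin R_V)
qed

text \<open>For a state of parity \<epsilon>, the part of its field of the other parity has a vacuum
  value in both parity spaces; this value is 0, and so is that part.\<close>

lemma V_Hs: "V ` Hs \<epsilon> = fsp \<epsilon>"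
proof
  show "fsp \<epsilon> \<subseteq> V ` Hs \<epsilon>"
  proof
    fix B assume B: "B \<in> fsp \<epsilon>"
    then have "V (R B) = B" using V_R fsp_subset by blast
    then show "B \<in> V ` Hs \<epsilon>" using fsp_vacuum_value[OF B] by (rule image_eqI[OF sym])
  qed
  show "V ` Hs \<epsilon> \<subseteq> fsp \<epsilon>"
  proof clarify
    fix a assume a: "a \<in> Hs \<epsilon>"
    obtain B0 B1 where B: "B0 \<in> fsp 0" "B1 \<in> fsp 1" "V a = B0 + B1" using fs_cases[OF V_fs] .
    have eq: "a = R B0 + R B1" using R_V[of a] by (simp add: B(3) R_lin)
    note R = fsp_vacuum_value[OF B(1)] fsp_vacuum_value[OF B(2)]
    show "V a \<in> fsp \<epsilon>"
    proof (cases \<epsilon>)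
      case zero
      then have "R B1 \<in> Hs 0" using csubspaceD(4)[OF Hs_subspace, of a 0 "R B0"] a R eq by simp
      then have "R B1 = 0" using Hs_disjoint R by blast
      then show ?thesis using fsp_eq_0[OF B(2)] B zero by simp
    next
      case one
      then have "R B0 \<in> Hs 1" using csubspaceD(4)[OF Hs_subspace, of a 1 "R B1"] a R eq by simp
      then have "R B0 = 0" using Hs_disjoint R by blast
      then show ?thesis using fsp_eq_0[OF B(1)] B one by simp
    qed
  qed
qed

lemma fs_vertex:
  assumes "B \<in> fs"
  shows "is_field B" "T (B m v) = B m (T v) + of_int (- m) *\<^sub>C B (m - 1) v" "m \<ge> 0 \<Longrightarrow> B m \<Omega> = 0"
    "deriv_field B \<in> fs"
proof -
  obtain B0 B1 where B: "B0 \<in> fsp 0" "B1 \<in> fsp 1" "B = B0 + B1" using fs_cases[OF assms] .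
  have v: "B0 \<in> vertex_fields 0" "B1 \<in> vertex_fields 1" using B fsp_vertex_fields by auto
  have "B \<in> graded_fields"
    using vertex_fieldsD(1)[OF v(1)] vertex_fieldsD(1)[OF v(2)] complex_vector.span_add
    unfolding graded_fields_def B(3) by blast
  then show "is_field B" by (rule graded_field_truncated)
  show "T (B m v) = B m (T v) + of_int (- m) *\<^sub>C B (m - 1) v"
    unfolding B(3) plus_fun_apply clinear_simps(1)[OF T] vertex_fieldsD(4)[OF v(1)] vertex_fieldsD(4)[OF v(2)]
    by (simp add: scaleC_add_right)
  show "m \<ge> 0 \<Longrightarrow> B m \<Omega> = 0"
    using vertex_fieldsD(5)[OF v(1)] vertex_fieldsD(5)[OF v(2)] by (simp add: B(3))
  have "deriv_field C \<in> fsp \<epsilon>" if "C \<in> fsp \<epsilon>" for C \<epsilon>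
  proof (rule fsp_induct[OF that])
    have d: "deriv_field 0 = (0 :: 'h modes)" "deriv_field (B + C) = deriv_field B + deriv_field C"
      "deriv_field (c *\<^sub>C B) = c *\<^sub>C deriv_field B" for B C :: "'h modes" and c
      by (simp_all add: fun_eq_iff deriv_field_def scaleC_fun_def scaleC_add_right scaleC_scaleC mult.commute)
    show "csubspace {C. deriv_field C \<in> fsp \<epsilon>}"
      by (rule complex_vector.subspaceI) (auto simp: d csubspaceD[OF fsp_subspace])
    show "deriv_field C \<in> fsp \<epsilon>" if "C \<in> gen" "good \<epsilon> C" for C
      using that by (intro gen_fsp gen_deriv good_deriv)
  qed
  then have "deriv_field B0 + deriv_field B1 \<in> fs"
    using B fsp_subset csubspaceD(2)[OF fs_subspace] by blast
  moreover have "deriv_field B = deriv_field B0 + deriv_field B1"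
    by (simp add: fun_eq_iff deriv_field_def B(3) scaleC_add_right)
  ultimately show "deriv_field B \<in> fs" by simp
qed

text \<open>The inverse of \<open>R\<close> does not visibly respect degrees. But the vacuum values
  of homogeneous fields span H, so the component of \<open>a\<close> in degree x is the value of a
  homogeneous field of degree x, and injectivity of \<open>R\<close> makes that field
  \<open>V a\<close>.\<close>

lemma V_hom:
  assumes "x \<in> half_nats" "a \<in> G x"
  shows "hom x (V a)"
proof -
  define U where "U y = {R B | B. B \<in> fs \<and> hom y B}" for y
  have U_sub: "csubspace (U y)" for y
  proof (rule complex_vector.subspaceI)
    show "0 \<in> U y"
      using csubspaceD(1)[OF fs_subspace] csubspaceD(1)[OF hom_subspace[of y]]
      unfolding U_def mem_Collect_eq by (intro exI[of _ 0]) (simp add: vacuum_value_def)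
    show "u + v \<in> U y" if "u \<in> U y" "v \<in> U y" for u v
      using that csubspaceD(2)[OF fs_subspace] csubspaceD(2)[OF hom_subspace] unfolding U_def
      by clarsimp (metis R_lin(1) mem_Collect_eq)
    show "c *\<^sub>C u \<in> U y" if "u \<in> U y" for c u
      using that csubspaceD(3)[OF fs_subspace] csubspaceD(3)[OF hom_subspace] unfolding U_def
      by clarsimp (metis R_lin(2) mem_Collect_eq)
  qed
  have U_G: "U y \<subseteq> G y" if "y \<in> half_nats" for y
    using eigenvector(1)[OF hom_vacuum_value] fs_vertex(1) that by (auto simp: U_def)
  have "R ` gen \<subseteq> cspan (\<Union>y\<in>half_nats. U y)"
  proof clarify
    fix B assume B: "B \<in> gen"
    obtain \<epsilon> where g: "good \<epsilon> B" using generated_good[OF B] by blast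
    obtain k :: int where k: "hom (of_int k / 2) B" using goodD(2)[OF g] by blast
    have "B \<in> fs" using B gen_fs by blast
    show "R B \<in> cspan (\<Union>y\<in>half_nats. U y)"
    proof (cases "real_of_int k / 2 \<in> half_nats")
      case True
      then show ?thesis using k \<open>B \<in> fs\<close> unfolding U_def by (intro complex_vector.span_base) blast
    next
      case False
      then show ?thesis
        using eigenvector(2)[OF hom_vacuum_value[OF fs_vertex(1)[OF \<open>B \<in> fs\<close>] k]]
        by (simp add: complex_vector.span_zero)
    qed
  qed
  then have "cspan (R ` gen) \<subseteq> cspan (\<Union>y\<in>half_nats. U y)"
    by (intro complex_vector.span_minimal) simp_all
  then have "a \<in> cspan (\<Union>y\<in>half_nats. U y)" using span_R_gen by auto
  then obtain u where u: "u \<in> U x" "\<And>w. w \<in> G x \<Longrightarrow> cinner (a - u) w = 0"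
    using component[of U a x] U_sub U_G assms(1) by blast
  \<comment> \<open>The difference is orthogonal to degree x and also lies in it, so it is
    0.\<close>
  have "a - u \<in> G x"
    using u(1) U_G[OF assms(1)] csubspaceD(4)[OF G_subspace[OF assms(1)] assms(2)] by blast
  then have "cinner (a - u) (a - u) = 0" by (rule u(2))
  then have "a - u = 0" using cinner_pos[of "a - u"] by force
  then obtain B where "B \<in> fs" "hom x B" "a = R B" using u(1) by (auto simp: U_def)
  then show ?thesis using V_R by simp
qed

lemma fsp_local:
  assumes B: "B \<in> fsp \<epsilon>" and C: "C \<in> fsp \<delta>"
  shows "local_with_sign (\<epsilon> * \<delta>) B C"
proof -
  have vB: "B \<in> vertex_fields \<epsilon>" and vC: "C \<in> vertex_fields \<delta>"
    using B C fsp_vertex_fields by auto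
  have "local_modes (parity_sign (\<epsilon> * \<delta>)) B C"
    by (rule fsp_induct[OF B local_modes_subspace_left[OF vertex_fieldsD(2)[OF vC]]]) (rule goodD(3)[OF _ vC])
  then show ?thesis
    using local_with_sign_iff[OF vertex_fieldsD(1)[OF vB] vertex_fieldsD(1)[OF vC]] by simp
qed

lemma fsp_nth_product:
  assumes B: "B \<in> fsp \<epsilon>" and C: "C \<in> fsp \<delta>"
  shows "nth_product (\<epsilon> * \<delta>) B n C \<in> fsp (\<epsilon> + \<delta>)"
proof -
  let ?s = "parity_sign (\<epsilon> * \<delta>)"
  have vC: "C \<in> vertex_fields \<delta>" and vB: "B \<in> vertex_fields \<epsilon>"
    using B C fsp_vertex_fields by auto
  have 1: "nprod ?s B n C \<in> fsp (\<epsilon> + \<delta>)" if B: "B \<in> gen" "good \<epsilon> B" and C: "C \<in> gen" "good \<delta> C" for B C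
  proof -
    have "nth_product (\<epsilon> * \<delta>) B n C \<in> gen"
      using B C good_local by (intro gen_product) auto
    then have "nprod ?s B n C \<in> gen"
      using nth_product_graded vertex_fieldsD(1)[OF goodD(1)[OF B(2)]] vertex_fieldsD(1)[OF goodD(1)[OF C(2)]] by simp
    then show ?thesis
      using good_nprod[OF B(2) C(2) goodD(3)[OF B(2) goodD(1)[OF C(2)]]] gen_fsp by blast
  qed
  have 2: "nprod ?s B n C \<in> fsp (\<epsilon> + \<delta>)" if B: "B \<in> gen" "good \<epsilon> B" for B
    by (rule nprod_span_right[OF fsp_subspace _ _ C[unfolded fsp_eq]])
      (use vertex_fieldsD(2,3)[OF goodD(1)] B 1 in auto)
  have "nprod ?s B n C \<in> fsp (\<epsilon> + \<delta>)"
    by (rule nprod_span_left[OF fsp_subspace vertex_fieldsD(2,3)[OF vC] B[unfolded fsp_eq]])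
      (use vertex_fieldsD(2,3)[OF goodD(1)] 2 in auto)
  then show ?thesis
    using nth_product_graded[OF vertex_fieldsD(1)[OF vB] vertex_fieldsD(1)[OF vC]] by simp
qed

section \<open>Verification of the axioms for a system with a Virasoro operator\<close>

theorem vertex_operator_superalgebra_V:
  assumes L: "L \<in> fs" and vir: "virasoro_relations L (2 * (hnorm (R L))\<^sup>2)"
    and DL: "D = vmode L 0" and TL: "T = vmode L (- 1)"
  shows "vertex_operator_superalgebra Hs V \<Omega> (R L)"
proof -
  have VL: "V (R L) = L" by (rule V_R[OF L])
  have Hs_sum: "direct_sum UNIV UNIV Hs"
  proof (rule direct_sum_bit[OF _ Hs_subspace _ _ Hs_disjoint])
    fix u
    obtain B0 B1 where B: "B0 \<in> fsp 0" "B1 \<in> fsp 1" "V u = B0 + B1" using fs_cases[OF V_fs] .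
    have "u = R B0 + R B1" using R_V[of u] by (simp add: B(3) R_lin)
    then show "\<exists>x\<in>Hs 0. \<exists>y\<in>Hs 1. u = x + y" using fsp_vacuum_value B by blast
  qed simp_all
  have fs_sum: "direct_sum fs UNIV fsp"
  proof (rule direct_sum_bit[OF fs_subspace fsp_subspace fsp_subset])
    show "\<exists>x\<in>fsp 0. \<exists>y\<in>fsp 1. u = x + y" if "u \<in> fs" for u
      using fs_cases[OF that] by metis
    show "fsp 0 \<inter> fsp 1 \<subseteq> {0}"
      using fsp_vacuum_value Hs_disjoint fsp_eq_0 by blast
  qed
  have irr: "acts_irreducibly {B n | B n. B \<in> fs}"
    unfolding acts_irreducibly_def
  proof (intro conjI allI impI)
    show "\<exists>v::'h. v \<noteq> 0" using vac_nonzero by blast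
    fix W :: "'h set" assume W: "csubspace W \<and> (\<forall>f\<in>{B n | B n. B \<in> fs}. f ` W \<subseteq> W)"
    show "W = {0} \<or> W = UNIV"
    proof (rule irreducibleD)
      fix i m v assume i: "i \<in> {1..r}" and v: "v \<in> W"
      have "A i \<in> fs" using gen_base[of "A i" "A ` {1..r}"] i gen_fs by blast
      then show "A i m v \<in> W" using W v by blast
    qed (use W in blast)
  qed
  have V_id: "V \<Omega> = id_field"
  proof -
    have "id_field \<in> fs" using gen_id gen_fs by blast
    from V_R[OF this] show ?thesis by (simp add: vacuum_value_def id_field_def)
  qed
  have L_vac: "vmode L 0 \<Omega> = 0" "vmode L (- 1) \<Omega> = 0"
    using vac_D vac_T by (simp_all add: DL TL)
  have omega: "R L = vmode L (- 2) \<Omega>"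
    by (simp add: vacuum_value_def vmode_def)
  have "vmode L (- 2) 0 = 0"
    unfolding vmode_def by (rule clinear_simps(3)[OF is_fieldD[OF fs_vertex(1)[OF L]]])
  \<comment> \<open>The relation [L_0, L_(-2)] = 2 L_(-2), which has no central term, applied to the
    vacuum: it places \<open>R L\<close> in degree 2.\<close>
  moreover have "vmode L 0 (vmode L (- 2) \<Omega>) - vmode L (- 2) (vmode L 0 \<Omega>)
      = of_int (0 - (- 2)) *\<^sub>C vmode L (0 + (- 2)) \<Omega> + 0"
    using vir[unfolded virasoro_relations_def, rule_format, of 0 "- 2" \<Omega>] by simp
  ultimately have "D (R L) = of_real 2 *\<^sub>C R L"
    unfolding omega DL L_vac by simp
  moreover have "(2 :: real) \<in> half_nats" unfolding half_nats_def by (auto intro: exI[of _ 4])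
  ultimately have omega_G: "R L \<in> G 2" by (rule eigenvector(1))
  have deg_V: "commutator_field D (V a) = z_times (deriv_field (V a)) + of_real \<alpha> *\<^sub>C V a"
    if "\<alpha> \<in> half_nats" "a \<in> G \<alpha>" for \<alpha> a
  proof (intro ext)
    fix m v
    have "D (V a m v) = V a m (D v) + (of_real \<alpha> - 1 - of_int m) *\<^sub>C V a m v"
      using V_hom[OF that] unfolding hom_def by blast
    moreover have "(of_real \<alpha> - 1 - of_int m) *\<^sub>C V a m v = of_int (- (m + 1)) *\<^sub>C V a m v + of_real \<alpha> *\<^sub>C V a m v"
      by (simp flip: complex_vector.scale_left_distrib)
    ultimately show "commutator_field D (V a) m v = (z_times (deriv_field (V a)) + of_real \<alpha> *\<^sub>C V a) m v"
      by (simp add: commutator_field_def z_times_def deriv_field_def scaleC_fun_def)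
  qed
  have T_V: "commutator_field T (V a) = deriv_field (V a)" for a
    by (simp add: fun_eq_iff commutator_field_def deriv_field_def fs_vertex(2)[OF V_fs])
  \<comment> \<open>By covariance and T \<Omega> = 0, \<open>T a\<close> is the mode -2 of
    \<open>V a\<close> on the vacuum, which is the vacuum value of the derivative. Injectivity of
    \<open>R\<close> lifts this equality to fields.\<close>
  have V_T: "deriv_field (V a) = V (T a)" for a
  proof -
    have "T (R (V a)) = R (deriv_field (V a))"
      unfolding vacuum_value_def fs_vertex(2)[OF V_fs]
      by (simp add: vac_T deriv_field_def clinear_simps(3)[OF is_fieldD[OF fs_vertex(1)[OF V_fs]]])
    then show ?thesis using V_R[OF fs_vertex(4)[OF V_fs, of a]] R_V[of a] by simp
  qed
  have parts: "direct_sum (Hs \<epsilon>) (shifted_nats \<epsilon>) G" for \<epsilon>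
    unfolding parity_part_def by (rule direct_sum_restrict[OF G_direct_sum shifted_nats_subset])
  show ?thesis
    unfolding vertex_operator_superalgebra_def Let_def VL range_V V_Hs
  proof (intro conjI allI ballI impI)
    show "is_field (V a)" for a by (rule fs_vertex(1)[OF V_fs])
    show "B n \<Omega> = 0" if "B \<in> fs" "0 \<le> n" for B n by (rule fs_vertex(3)[OF that])
    show "V a (- 1) \<Omega> = a" for a using R_V[of a] by (simp add: vacuum_value_def)
    show "local_with_sign (\<epsilon>\<^sub>1 * \<epsilon>\<^sub>2) B C" if "B \<in> fsp \<epsilon>\<^sub>1" "C \<in> fsp \<epsilon>\<^sub>2" for \<epsilon>\<^sub>1 \<epsilon>\<^sub>2 B C by (rule fsp_local[OF that])
    show "nth_product (\<epsilon>\<^sub>1 * \<epsilon>\<^sub>2) B n C \<in> fsp (\<epsilon>\<^sub>1 + \<epsilon>\<^sub>2)" if "B \<in> fsp \<epsilon>\<^sub>1" "C \<in> fsp \<epsilon>\<^sub>2" for \<epsilon>\<^sub>1 \<epsilon>\<^sub>2 B C n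
      by (rule fsp_nth_product[OF that])
    show "\<exists>G. grading_of (vmode L 0) G \<and> (\<forall>\<epsilon>. direct_sum (Hs \<epsilon>) (shifted_nats \<epsilon>) G) \<and> \<Omega> \<in> G 0 \<and> R L \<in> G 2 \<and>
      (\<forall>\<alpha>\<in>half_nats. \<forall>a\<in>G \<alpha>. commutator_field (vmode L 0) (V a) = z_times (deriv_field (V a)) + of_real \<alpha> *\<^sub>C V a)"
      using grading parts vac_G omega_G deg_V unfolding DL by blast
    show "commutator_field (vmode L (- 1)) (V a) = deriv_field (V a)" for a
      using T_V unfolding TL .
    show "deriv_field (V a) = V (vmode L (- 1) a)" for a
      using V_T unfolding TL .
    show "deriv_field (V a) \<in> fs" for a by (rule fs_vertex(4)[OF V_fs])
  qed (fact Hs_sum V_linear fs_sum V_id irr L_vac omega vir)+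
qed

end

section \<open>From a system of generators to its mode-by-mode form\<close>

lemma system_of_generators_imp_generating_system:
  assumes "system_of_generators r A D T \<Omega> G"
  shows "\<exists>e deg. generating_system A r D T \<Omega> G e deg"
proof -
  note sys = assms[unfolded system_of_generators_def]
  obtain \<epsilon> :: "nat \<Rightarrow> nat \<Rightarrow> bit" and \<alpha> where ex:
    "\<forall>i\<in>{1..r}. \<forall>j\<in>{1..r}. local_with_sign (\<epsilon> i j) (A i) (A j) \<and> \<epsilon> i j = \<epsilon> i i * \<epsilon> j j"
    "\<forall>i\<in>{1..r}. commutator_field T (A i) = deriv_field (A i)"
    "grading_of D G"
    "\<forall>i\<in>{1..r}. \<alpha> i \<in> shifted_nats (\<epsilon> i i) \<and>
        commutator_field D (A i) = z_times (deriv_field (A i)) + complex_of_real (\<alpha> i) *\<^sub>C A i"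
    using sys by (elim conjE exE) (rule that; assumption)
  have rest: "\<forall>i\<in>{1..r}. is_field (A i)" "clinear D" "clinear T" "\<Omega> \<in> G 0" "hnorm \<Omega> = 1"
    "\<forall>i\<in>{1..r}. \<forall>m\<ge>0. A i m \<Omega> = 0" "D \<Omega> = 0" "T \<Omega> = 0"
    "acts_irreducibly {A i m | i m. i \<in> {1..r}}"
    using sys by - (elim conjE, assumption)+
  note loc = ex(1)[rule_format] and T = ex(2)[rule_format] and D = ex(4)[rule_format]
  \<comment> \<open>A degree in \<nat> + \<epsilon>/2 is half an integer of parity \<epsilon>; that
    integer serves as \<open>deg i\<close>.\<close>
  have "\<forall>i\<in>{1..r}. \<exists>k :: int. \<alpha> i = of_int k / 2 \<and> \<epsilon> i i = of_int k"
  proof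
    fix i assume i: "i \<in> {1..r}"
    show "\<exists>k :: int. \<alpha> i = of_int k / 2 \<and> \<epsilon> i i = of_int k"
      by (rule shifted_natsE[OF conjunct1[OF D[OF i]]]) (rule exI, rule conjI)
  qed
  from bchoice[OF this] obtain deg :: "nat \<Rightarrow> int"
    where deg: "\<And>i. i \<in> {1..r} \<Longrightarrow> \<alpha> i = of_int (deg i) / 2 \<and> \<epsilon> i i = of_int (deg i)"
    by blast
  have "generating_system A r D T \<Omega> G (\<lambda>i. \<epsilon> i i) deg"
  proof (rule generating_system.intro)
    fix i m v assume i: "i \<in> {1..r}"
    show "T (A i m v) = A i m (T v) + of_int (- m) *\<^sub>C A i (m - 1) v"
      using fun_cong[OF fun_cong[OF T[OF i], of m], of v]
      by (simp add: commutator_field_def deriv_field_def algebra_simps)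
    have "D (A i m v) - A i m (D v) = of_int (- (m + 1)) *\<^sub>C A i m v + complex_of_real (\<alpha> i) *\<^sub>C A i m v"
      using fun_cong[OF fun_cong[OF conjunct2[OF D[OF i]], of m], of v]
      by (simp add: commutator_field_def z_times_def deriv_field_def scaleC_fun_def)
    also have "\<dots> = (complex_of_real (\<alpha> i) - 1 - of_int m) *\<^sub>C A i m v"
      by (simp flip: complex_vector.scale_left_distrib)
    finally show "D (A i m v) = A i m (D v) + (complex_of_real (real_of_int (deg i) / 2) - 1 - of_int m) *\<^sub>C A i m v"
      using deg[OF i] by (simp add: diff_eq_eq add.commute)
  next
    fix i j assume ij: "i \<in> {1..r}" "j \<in> {1..r}"
    show "local_with_sign (\<epsilon> i i * \<epsilon> j j) (A i) (A j)"
      using conjunct1[OF loc[OF ij]] unfolding conjunct2[OF loc[OF ij]] .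
  next
    show "of_int (deg i) = \<epsilon> i i" if "i \<in> {1..r}" for i
      using deg[OF that] by simp
  qed (rule rest[rule_format] ex(3); assumption)+
  then show ?thesis by blast
qed

theorem corollary3p83:
  fixes A :: "nat \<Rightarrow> 'h::prehilbert modes"
    and D T :: "'h \<Rightarrow> 'h" and \<Omega> \<omega> :: 'h and G :: "real \<Rightarrow> 'h set"
    and L :: "'h modes" and r :: nat
  assumes "system_of_generators r A D T \<Omega> G"
    and "virasoro_operator (A ` {1..r}) \<Omega> L"
    and "D = vmode L 0" and "T = vmode L (- 1)"
    and "\<omega> = vacuum_value \<Omega> L"
  shows "vertex_operator_superalgebra (parity_part G) (state_field (A ` {1..r}) \<Omega>) \<Omega> \<omega>"
proof -
  obtain e deg where "generating_system A r D T \<Omega> G e deg"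
    using system_of_generators_imp_generating_system[OF assms(1)] by blast
  then interpret generating_system A r D T \<Omega> G e deg .
  show ?thesis
    using vertex_operator_superalgebra_V assms(2-5) unfolding virasoro_operator_def by blast
qed

end
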